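(* Let $(M,g_1)$ be a compact Einstein manifold of dimension at least $3$ with positive Einstein constant $\mu$ and suppose that $2\mu\in\operatorname{spec}(\Delta)$, where $\Delta$ is the Laplace-Beltrami operator on functions of $(M,g_1)$. Then for any other compact Einstein manifold $(N,g_2)$ of dimension at least $3$ with the same Einstein constant $\mu$, the product manifold $(M\times N,g_1+g_2)$ admits (nonzero) infinitesimal Einstein deformations.
   Context: A Riemannian metric $g$ is Einstein with Einstein constant $\mu$ if $\operatorname{Ric}_g=\mu g$. The Laplace-Beltrami operator is $\Delta=-\operatorname{tr}\nabla^2$. For an Einstein metric $g$, the Einstein operator acts on symmetric $(0,2)$-tensors by $\Delta_E h=\nabla^*\nabla h-2\mathring{R}h$, where $\mathring{R}h(X,Y)=\sum_{i}h(R_{e_i,X}Y,e_i)$ for a local orthonormal frame $\{e_i\}$, with $R_{X,Y}Z=\nabla^2_{X,Y}Z-\nabla^2_{Y,X}Z$. Infinitesimal Einstein deformations are the symmetric $(0,2)$-tensors $h$ that are trace-free and divergence-free and satisfy $\Delta_Eh=0$. *)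

theory Defs
  imports "HOL-Analysis.Analysis"
begin

section \<open>Smooth maps and smooth manifolds\<close>

abbreviation deriv_at :: "('a::real_normed_vector \<Rightarrow> 'b::real_normed_vector) \<Rightarrow> 'a \<Rightarrow> 'a \<Rightarrow> 'b"
  where "deriv_at f x u \<equiv> frechet_derivative f (at x) u"

text \<open>Meant for open subsets of finite-dimensional spaces, where it is the usual \<open>C\<^sup>k\<close> condition.\<close>

fun Ck_on :: "nat \<Rightarrow> ('a::euclidean_space \<Rightarrow> 'b::real_normed_vector) \<Rightarrow> 'a set \<Rightarrow> bool" where
  "Ck_on 0 f S \<longleftrightarrow> continuous_on S f"
| "Ck_on (Suc k) f S \<longleftrightarrow> f differentiable_on S \<and> (\<forall>u. Ck_on k (\<lambda>x. deriv_at f x u) S)"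

definition smooth_map_on :: "'a::euclidean_space set \<Rightarrow> ('a \<Rightarrow> 'b::real_normed_vector) \<Rightarrow> bool"
  where "smooth_map_on S f \<longleftrightarrow> (\<forall>k. Ck_on k f S)"

text \<open>
  A manifold modelled on the Euclidean space \<open>'a\<close>, so of dimension \<open>DIM('a)\<close>, is given by a
  topology on its point set together with a (not necessarily maximal) smooth atlas
  \<open>(chart_dom i, chart_map i)\<close>, indexed by \<open>i \<in> chart_index\<close>. Values of \<open>chart_map i\<close> outside
  \<open>chart_dom i\<close> carry no meaning.
\<close>

record ('i, 'p, 'a) manifold =
  mtop :: "'p topology"
  chart_index :: "'i set"
  chart_dom :: "'i \<Rightarrow> 'p set"
  chart_map :: "'i \<Rightarrow> 'p \<Rightarrow> 'a"

definition chart_range :: "('i, 'p, 'a) manifold \<Rightarrow> 'i \<Rightarrow> 'a set"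
  where "chart_range M i = chart_map M i ` chart_dom M i"

definition chart_inv :: "('i, 'p, 'a) manifold \<Rightarrow> 'i \<Rightarrow> 'a \<Rightarrow> 'p"
  where "chart_inv M i = inv_into (chart_dom M i) (chart_map M i)"

definition transition :: "('i, 'p, 'a) manifold \<Rightarrow> 'i \<Rightarrow> 'i \<Rightarrow> 'a \<Rightarrow> 'a"
  where "transition M i j = chart_map M j \<circ> chart_inv M i"

text \<open>Manifolds are nonempty and without boundary; connectedness is not required.\<close>

definition smooth_manifold :: "('i, 'p, 'a::euclidean_space) manifold \<Rightarrow> bool" where
  "smooth_manifold M \<longleftrightarrow>
     Hausdorff_space (mtop M) \<and> second_countable (mtop M) \<and> topspace (mtop M) \<noteq> {} \<and>
     (\<Union>i\<in>chart_index M. chart_dom M i) = topspace (mtop M) \<and>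
     (\<forall>i\<in>chart_index M. openin (mtop M) (chart_dom M i) \<and> open (chart_range M i) \<and>
        homeomorphic_map (subtopology (mtop M) (chart_dom M i)) (top_of_set (chart_range M i))
          (chart_map M i)) \<and>
     (\<forall>i\<in>chart_index M. \<forall>j\<in>chart_index M.
        smooth_map_on (chart_map M i ` (chart_dom M i \<inter> chart_dom M j)) (transition M i j))"

definition product_manifold ::
  "('i, 'p, 'a) manifold \<Rightarrow> ('j, 'q, 'b) manifold \<Rightarrow> ('i \<times> 'j, 'p \<times> 'q, 'a \<times> 'b) manifold" where
  "product_manifold M N =
     \<lparr> mtop = prod_topology (mtop M) (mtop N),
       chart_index = chart_index M \<times> chart_index N,
       chart_dom = (\<lambda>(i, j). chart_dom M i \<times> chart_dom N j),
       chart_map = (\<lambda>(i, j). map_prod (chart_map M i) (chart_map N j)) \<rparr>"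


section \<open>Functions and tensor fields\<close>

definition local_rep :: "('i, 'p, 'a) manifold \<Rightarrow> ('p \<Rightarrow> real) \<Rightarrow> 'i \<Rightarrow> 'a \<Rightarrow> real"
  where "local_rep M f i = f \<circ> chart_inv M i"

definition smooth_function :: "('i, 'p, 'a::euclidean_space) manifold \<Rightarrow> ('p \<Rightarrow> real) \<Rightarrow> bool" where
  "smooth_function M f \<longleftrightarrow> (\<forall>i\<in>chart_index M. smooth_map_on (chart_range M i) (local_rep M f i))"

text \<open>
  A (0,2)-tensor field is given by its coordinate expressions \<open>h i\<close> on the chart ranges, which are
  related by the tensor transformation law. \<open>h i x u v\<close> is the value at the point with coordinates
  \<open>x\<close> on the tangent vectors represented by \<open>u\<close> and \<open>v\<close> in the chart \<open>i\<close>.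
\<close>

type_synonym 'a local_tensor2 = "'a \<Rightarrow> 'a \<Rightarrow> 'a \<Rightarrow> real"
type_synonym ('i, 'a) tensor2 = "'i \<Rightarrow> 'a local_tensor2"

definition smooth_symmetric_tensor2 ::
  "('i, 'p, 'a::euclidean_space) manifold \<Rightarrow> ('i, 'a) tensor2 \<Rightarrow> bool" where
  "smooth_symmetric_tensor2 M h \<longleftrightarrow>
     (\<forall>i\<in>chart_index M. \<forall>x\<in>chart_range M i. bilinear (h i x) \<and> (\<forall>u v. h i x u v = h i x v u)) \<and>
     (\<forall>i\<in>chart_index M. \<forall>u v. smooth_map_on (chart_range M i) (\<lambda>x. h i x u v)) \<and>
     (\<forall>i\<in>chart_index M. \<forall>j\<in>chart_index M. \<forall>p\<in>chart_dom M i \<inter> chart_dom M j. \<forall>u v.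
        h i (chart_map M i p) u v =
        h j (chart_map M j p) (deriv_at (transition M i j) (chart_map M i p) u)
                              (deriv_at (transition M i j) (chart_map M i p) v))"

definition riemannian_metric ::
  "('i, 'p, 'a::euclidean_space) manifold \<Rightarrow> ('i, 'a) tensor2 \<Rightarrow> bool" where
  "riemannian_metric M g \<longleftrightarrow> smooth_symmetric_tensor2 M g \<and>
     (\<forall>i\<in>chart_index M. \<forall>x\<in>chart_range M i. \<forall>u. u \<noteq> 0 \<longrightarrow> g i x u u > 0)"

text \<open>The metric \<open>g\<^sub>1 + g\<^sub>2\<close>, i.e. the sum of the pullbacks of both metrics to the product.\<close>

definition product_metric ::
  "('i, 'a) tensor2 \<Rightarrow> ('j, 'b) tensor2 \<Rightarrow> ('i \<times> 'j, 'a \<times> 'b) tensor2" where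
  "product_metric g\<^sub>1 g\<^sub>2 =
     (\<lambda>(i, j) (x, y) u v. g\<^sub>1 i x (fst u) (fst v) + g\<^sub>2 j y (snd u) (snd v))"

definition nonzero_tensor2 :: "('i, 'p, 'a) manifold \<Rightarrow> ('i, 'a) tensor2 \<Rightarrow> bool" where
  "nonzero_tensor2 M h \<longleftrightarrow> (\<exists>i\<in>chart_index M. \<exists>x\<in>chart_range M i. \<exists>u v. h i x u v \<noteq> 0)"


section \<open>Riemannian geometry in a chart\<close>

text \<open>Throughout this section, \<open>g\<close> is the coordinate expression of a metric on an open set.\<close>

definition orthonormal_frame :: "('a::euclidean_space \<Rightarrow> 'a \<Rightarrow> real) \<Rightarrow> 'a set \<Rightarrow> bool" where
  "orthonormal_frame b E \<longleftrightarrow> finite E \<and> card E = DIM('a) \<and>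
     (\<forall>e\<in>E. \<forall>e'\<in>E. b e e' = (if e = e' then 1 else 0))"

text \<open>The trace of a bilinear form \<open>B\<close> with respect to the inner product \<open>b\<close>. It does not depend on
  the orthonormal frame chosen.\<close>

definition metric_trace ::
  "('a::euclidean_space \<Rightarrow> 'a \<Rightarrow> real) \<Rightarrow> ('a \<Rightarrow> 'a \<Rightarrow> real) \<Rightarrow> real" where
  "metric_trace b B = (\<Sum>e\<in>(SOME E. orthonormal_frame b E). B e e)"

text \<open>The Levi-Civita connection: \<open>christoffel g x u v\<close> is the covariant derivative, in direction \<open>u\<close>,
  of the vector field that is constantly \<open>v\<close> in the chart. It is determined by the Koszul formula, in
  which the Lie brackets of constant fields vanish.\<close>

definition christoffel :: "'a::euclidean_space local_tensor2 \<Rightarrow> 'a \<Rightarrow> 'a \<Rightarrow> 'a \<Rightarrow> 'a" where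
  "christoffel g x u v = (THE w. \<forall>z. 2 * g x w z =
     deriv_at (\<lambda>y. g y v z) x u + deriv_at (\<lambda>y. g y u z) x v - deriv_at (\<lambda>y. g y u v) x z)"

text \<open>Covariant derivatives of vector fields and of (0,k)-tensor fields, \<open>k = 1, 2, 3\<close>. The direction
  \<open>u\<close> of differentiation is always the first argument after the point.\<close>

definition nabla_vec :: "'a::euclidean_space local_tensor2 \<Rightarrow> ('a \<Rightarrow> 'a) \<Rightarrow> 'a \<Rightarrow> 'a \<Rightarrow> 'a" where
  "nabla_vec g Z x u = deriv_at Z x u + christoffel g x u (Z x)"

definition nabla1 :: "'a::euclidean_space local_tensor2 \<Rightarrow> ('a \<Rightarrow> 'a \<Rightarrow> real) \<Rightarrow>
    'a \<Rightarrow> 'a \<Rightarrow> 'a \<Rightarrow> real" where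
  "nabla1 g \<alpha> x u v = deriv_at (\<lambda>y. \<alpha> y v) x u - \<alpha> x (christoffel g x u v)"

definition nabla2 :: "'a::euclidean_space local_tensor2 \<Rightarrow> ('a \<Rightarrow> 'a \<Rightarrow> 'a \<Rightarrow> real) \<Rightarrow>
    'a \<Rightarrow> 'a \<Rightarrow> 'a \<Rightarrow> 'a \<Rightarrow> real" where
  "nabla2 g h x u v w = deriv_at (\<lambda>y. h y v w) x u
     - h x (christoffel g x u v) w - h x v (christoffel g x u w)"

definition nabla3 :: "'a::euclidean_space local_tensor2 \<Rightarrow> ('a \<Rightarrow> 'a \<Rightarrow> 'a \<Rightarrow> 'a \<Rightarrow> real) \<Rightarrow>
    'a \<Rightarrow> 'a \<Rightarrow> 'a \<Rightarrow> 'a \<Rightarrow> 'a \<Rightarrow> real" where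
  "nabla3 g T x u v w z = deriv_at (\<lambda>y. T y v w z) x u
     - T x (christoffel g x u v) w z - T x v (christoffel g x u w) z - T x v w (christoffel g x u z)"

text \<open>\<open>\<nabla>\<^sup>2\<^bsub>u,v\<^esub> Z\<close> is the covariant derivative in direction \<open>u\<close> of the (1,1)-tensor field \<open>\<nabla>Z\<close>,
  evaluated at \<open>v\<close>.\<close>

definition nabla_sq_vec ::
  "'a::euclidean_space local_tensor2 \<Rightarrow> ('a \<Rightarrow> 'a) \<Rightarrow> 'a \<Rightarrow> 'a \<Rightarrow> 'a \<Rightarrow> 'a" where
  "nabla_sq_vec g Z x u v = deriv_at (\<lambda>y. nabla_vec g Z y v) x u
     + christoffel g x u (nabla_vec g Z x v) - nabla_vec g Z x (christoffel g x u v)"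

text \<open>\<open>R\<^bsub>u,v\<^esub>w\<close>. The right-hand side is tensorial in \<open>Z\<close>, so \<open>w\<close> may be extended to a constant field.\<close>

definition curvature ::
  "'a::euclidean_space local_tensor2 \<Rightarrow> 'a \<Rightarrow> 'a \<Rightarrow> 'a \<Rightarrow> 'a \<Rightarrow> 'a" where
  "curvature g x u v w = nabla_sq_vec g (\<lambda>_. w) x u v - nabla_sq_vec g (\<lambda>_. w) x v u"

text \<open>The trace of \<open>Z \<mapsto> R\<^bsub>Z,u\<^esub>v\<close>; with this sign, round spheres have positive Ricci curvature.\<close>

definition ricci :: "'a::euclidean_space local_tensor2 \<Rightarrow> 'a local_tensor2" where
  "ricci g x u v = metric_trace (g x) (\<lambda>e e'. g x (curvature g x e u v) e')"

definition hessian :: "'a::euclidean_space local_tensor2 \<Rightarrow> ('a \<Rightarrow> real) \<Rightarrow> 'a local_tensor2" where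
  "hessian g f = nabla1 g (\<lambda>y. deriv_at f y)"

definition laplacian :: "'a::euclidean_space local_tensor2 \<Rightarrow> ('a \<Rightarrow> real) \<Rightarrow> 'a \<Rightarrow> real" where
  "laplacian g f x = - metric_trace (g x) (hessian g f x)"

definition divergence ::
  "'a::euclidean_space local_tensor2 \<Rightarrow> 'a local_tensor2 \<Rightarrow> 'a \<Rightarrow> 'a \<Rightarrow> real" where
  "divergence g h x v = - metric_trace (g x) (\<lambda>e e'. nabla2 g h x e e' v)"

text \<open>The formal adjoint \<open>\<nabla>\<^sup>*\<close> of \<open>\<nabla>\<close> on (0,2)-tensor fields,
  \<open>\<nabla>\<^sup>* T (v, w) = - \<Sum>\<^sub>i (\<nabla>T)(e\<^sub>i, e\<^sub>i, v, w)\<close>.\<close>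

definition nabla_adjoint ::
  "'a::euclidean_space local_tensor2 \<Rightarrow> ('a \<Rightarrow> 'a \<Rightarrow> 'a \<Rightarrow> 'a \<Rightarrow> real) \<Rightarrow> 'a local_tensor2" where
  "nabla_adjoint g T x v w = - metric_trace (g x) (\<lambda>e e'. nabla3 g T x e e' v w)"

definition curvature_action ::
  "'a::euclidean_space local_tensor2 \<Rightarrow> 'a local_tensor2 \<Rightarrow> 'a local_tensor2" where
  "curvature_action g h x u v = metric_trace (g x) (\<lambda>e e'. h x (curvature g x e u v) e')"

definition einstein_operator ::
  "'a::euclidean_space local_tensor2 \<Rightarrow> 'a local_tensor2 \<Rightarrow> 'a local_tensor2" where
  "einstein_operator g h x u v =
     nabla_adjoint g (nabla2 g h) x u v - 2 * curvature_action g h x u v"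


section \<open>Einstein manifolds, spectrum and infinitesimal Einstein deformations\<close>

definition compact_einstein_manifold ::
  "('i, 'p, 'a::euclidean_space) manifold \<Rightarrow> ('i, 'a) tensor2 \<Rightarrow> real \<Rightarrow> bool" where
  "compact_einstein_manifold M g \<mu> \<longleftrightarrow>
     smooth_manifold M \<and> compact_space (mtop M) \<and> riemannian_metric M g \<and>
     (\<forall>i\<in>chart_index M. \<forall>x\<in>chart_range M i. \<forall>u v. ricci (g i) x u v = \<mu> * g i x u v)"

text \<open>On a closed manifold the spectrum of the Laplace-Beltrami operator is the set of its
  eigenvalues, all of which are real with smooth eigenfunctions.\<close>

definition laplace_spectrum ::
  "('i, 'p, 'a::euclidean_space) manifold \<Rightarrow> ('i, 'a) tensor2 \<Rightarrow> real set" where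
  "laplace_spectrum M g = {l. \<exists>f. smooth_function M f \<and> (\<exists>p\<in>topspace (mtop M). f p \<noteq> 0) \<and>
     (\<forall>i\<in>chart_index M. \<forall>x\<in>chart_range M i.
        laplacian (g i) (local_rep M f i) x = l * local_rep M f i x)}"

definition infinitesimal_einstein_deformation ::
  "('i, 'p, 'a::euclidean_space) manifold \<Rightarrow> ('i, 'a) tensor2 \<Rightarrow> ('i, 'a) tensor2 \<Rightarrow> bool" where
  "infinitesimal_einstein_deformation M g h \<longleftrightarrow> smooth_symmetric_tensor2 M h \<and>
     (\<forall>i\<in>chart_index M. \<forall>x\<in>chart_range M i.
        metric_trace (g i x) (h i x) = 0 \<and>
        (\<forall>v. divergence (g i) (h i) x v = 0) \<and>
        (\<forall>u v. einstein_operator (g i) (h i) x u v = 0))"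

end

theory Submission
  imports Defs
begin

text \<open>
  Let \<open>n = dim M\<close>, \<open>m = dim N\<close> and let \<open>f\<close> be an eigenfunction on \<open>M\<close> for the eigenvalue \<open>2\<mu>\<close>. The
  deformation is \<open>h = \<mu> f g\<^sub>1 + \<nabla>\<^sup>2f - ((n - 2) \<mu> / m) f g\<^sub>2\<close>. The coefficient of \<open>f g\<^sub>1\<close> makes \<open>h\<close>
  divergence-free, because \<open>\<nabla>\<^sup>2f\<close> has divergence \<open>\<mu> df\<close> by the Bochner formula, and that of \<open>f g\<^sub>2\<close>
  makes it trace-free. On an Einstein manifold \<open>\<Delta>\<^sub>E\<close> acts on \<open>f g\<close> and on \<open>\<nabla>\<^sup>2f\<close> through \<open>(\<Delta> - 2\<mu>) f\<close>, so
  \<open>\<Delta>\<^sub>E h = 0\<close>. For the Hessian this rests on the Ricci identities and on the contracted second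
  Bianchi identity. Since \<open>n > 2\<close>, \<open>h\<close> does not vanish in the directions of \<open>N\<close>.
\<close>

section \<open>Calculus of smooth maps\<close>

text \<open>On the product, f g2 is annihilated by the Einstein operator as well: its rough
  Laplacian is (\<Delta> f) g2 because g2 is parallel, and the curvature term contributes f Ric of
  N, which is \<mu> f g2. This is where the common Einstein constant enters. Any combination of f
  g1, Hess f and f g2 therefore lies in the kernel, and the trace and divergence conditions
  determine the three coefficients up to scale. The obstacle is the form of the operators. They are
  coordinate expressions in which the connection is a \<open>THE\<close> and the trace a sum over a
  \<open>SOME\<close> frame, and neither can be differentiated as it stands. A smooth orthonormal
  frame on each chart range makes both explicit; traces then commute with covariant derivatives. No
  normal coordinates are used, so every identity is proved with all its Christoffel terms. The
  chartwise expressions for h form a single tensor field because the second derivatives of a chart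
  transition, which enter both the Christoffel symbols and the second derivatives of f, cancel in
  the Hessian.\<close>

lemma Ck_on_cong:
  assumes "open S" "\<And>x. x \<in> S \<Longrightarrow> f x = g x" "Ck_on k f S"
  shows "Ck_on k g S"
  using assms(2,3)
proof (induction k arbitrary: f g)
  case 0
  then show ?case using continuous_on_cong by force
next
  case (Suc k)
  have diff: "f differentiable (at x)" if "x \<in> S" for x
    using Suc.prems(2) assms(1) that by (simp add: differentiable_on_eq_differentiable_at)
  have D: "deriv_at f x = deriv_at g x" if "x \<in> S" for x
    by (rule frechet_derivative_transform_within_open[OF diff[OF that] assms(1) that])
       (use Suc.prems(1) in auto)
  have "g differentiable_on S"
    using Suc.prems differentiable_on_def differentiable_transform_within
    by (metis (no_types, lifting) Ck_on.simps(2) zero_less_one)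
  then show ?case
    using Suc.IH[of "\<lambda>x. deriv_at f x u" "\<lambda>x. deriv_at g x u" for u] Suc.prems(2) D by auto
qed

lemma Ck_on_SucD: "Ck_on (Suc k) f S \<Longrightarrow> Ck_on k f S"
proof (induction k arbitrary: f)
  case 0
  then show ?case by (simp add: differentiable_imp_continuous_on)
next
  case (Suc k)
  then show ?case by (metis Ck_on.simps(2))
qed

text \<open>The recursion speaks of \<open>deriv_at\<close>. Here any formula for the derivative may
  take its place, which is how the sum, product, chain and inverse square root rules are
  proved.\<close>

lemma Ck_on_SucI:
  assumes "open S" "\<And>x. x \<in> S \<Longrightarrow> (f has_derivative f' x) (at x)" "\<And>u. Ck_on k (\<lambda>x. f' x u) S"
  shows "Ck_on (Suc k) f S"
proof -
  have "f differentiable_on S"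
    using assms(1,2) by (metis differentiable_def differentiable_on_eq_differentiable_at)
  moreover have "deriv_at f x = f' x" if "x \<in> S" for x
    using assms(2)[OF that] frechet_derivative_at by metis
  ultimately show ?thesis
    using Ck_on_cong[OF assms(1) _ assms(3)] by auto
qed

lemma Ck_on_has_derivative:
  assumes "Ck_on (Suc k) f S" "open S" "x \<in> S"
  shows "(f has_derivative deriv_at f x) (at x)"
  using assms by (simp add: differentiable_on_eq_differentiable_at frechet_derivative_works)

lemma Ck_on_const: "open S \<Longrightarrow> Ck_on k (\<lambda>x. c) S"
  by (induction k arbitrary: c) (auto intro: continuous_intros)

lemma Ck_on_add:
  assumes "open S"
  shows "Ck_on k f S \<Longrightarrow> Ck_on k g S \<Longrightarrow> Ck_on k (\<lambda>x. f x + g x) S"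
proof (induction k arbitrary: f g)
  case 0
  then show ?case by (auto intro: continuous_intros)
next
  case (Suc k)
  show ?case
  proof (rule Ck_on_SucI[OF assms])
    fix x assume "x \<in> S"
    then show "((\<lambda>x. f x + g x) has_derivative (\<lambda>u. deriv_at f x u + deriv_at g x u)) (at x)"
      by (intro has_derivative_add Ck_on_has_derivative[OF Suc.prems(1) assms] Ck_on_has_derivative[OF Suc.prems(2) assms])
  qed (use Suc in auto)
qed

lemma Ck_on_sum:
  assumes "open S" "\<And>i. i \<in> I \<Longrightarrow> Ck_on k (f i) S"
  shows "Ck_on k (\<lambda>x. \<Sum>i\<in>I. f i x) S"
  using assms(2) by (induction I rule: infinite_finite_induct)
    (auto intro: Ck_on_const Ck_on_add assms(1))

lemma Ck_on_scaleR:
  assumes "open S"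
  shows "Ck_on k f S \<Longrightarrow> Ck_on k g S \<Longrightarrow> Ck_on k (\<lambda>x. f x *\<^sub>R g x) S"
proof (induction k arbitrary: f g)
  case 0
  then show ?case by (auto intro: continuous_intros)
next
  case (Suc k)
  show ?case
  proof (rule Ck_on_SucI[OF assms])
    fix x assume "x \<in> S"
    then show "((\<lambda>x. f x *\<^sub>R g x) has_derivative
        (\<lambda>u. f x *\<^sub>R deriv_at g x u + deriv_at f x u *\<^sub>R g x)) (at x)"
      by (intro has_derivative_scaleR Ck_on_has_derivative[OF Suc.prems(1) assms] Ck_on_has_derivative[OF Suc.prems(2) assms])
  next
    fix u
    show "Ck_on k (\<lambda>x. f x *\<^sub>R deriv_at g x u + deriv_at f x u *\<^sub>R g x) S"
      using Suc.prems Ck_on_SucD[OF Suc.prems(1)] Ck_on_SucD[OF Suc.prems(2)]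
      by (intro Ck_on_add assms Suc.IH) auto
  qed
qed

lemma Ck_on_bounded_linear:
  assumes "open S" "bounded_linear L"
  shows "Ck_on k f S \<Longrightarrow> Ck_on k (\<lambda>x. L (f x)) S"
proof (induction k arbitrary: f)
  case 0
  then show ?case using bounded_linear.continuous_on[OF assms(2)] by auto
next
  case (Suc k)
  show ?case
  proof (rule Ck_on_SucI[OF assms(1)])
    fix x assume "x \<in> S"
    then show "((\<lambda>x. L (f x)) has_derivative (\<lambda>u. L (deriv_at f x u))) (at x)"
      using Ck_on_has_derivative[OF Suc.prems assms(1)] bounded_linear.has_derivative[OF assms(2)]
      by blast
  qed (use Suc in auto)
qed

lemma linear_sum_Basis:
  fixes h :: "'a::euclidean_space \<Rightarrow> 'b::real_vector"
  assumes "linear h"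
  shows "h v = (\<Sum>b\<in>Basis. (v \<bullet> b) *\<^sub>R h b)"
proof -
  have "h v = h (\<Sum>b\<in>Basis. (v \<bullet> b) *\<^sub>R b)" by (simp add: euclidean_representation)
  also have "\<dots> = (\<Sum>b\<in>Basis. (v \<bullet> b) *\<^sub>R h b)"
    by (simp add: linear_sum[OF assms] linear_cmul[OF assms])
  finally show ?thesis .
qed

text \<open>The chain rule evaluates the derivative of \<open>F\<close> in a direction that moves
  with \<open>x\<close>, whereas the recursion knows fixed directions only. Expanding the moving
  direction in the basis leaves sums of products of functions that the induction covers.\<close>

lemma Ck_on_compose:
  fixes \<phi> :: "'a::euclidean_space \<Rightarrow> 'b::euclidean_space"
  assumes "open S" "open T" "\<phi> ` S \<subseteq> T"
  shows "Ck_on k F T \<Longrightarrow> Ck_on k \<phi> S \<Longrightarrow> Ck_on k (\<lambda>x. F (\<phi> x)) S"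
proof (induction k arbitrary: F)
  case 0
  then show ?case using assms(3) continuous_on_compose2 by fastforce
next
  case (Suc k)
  show ?case
  proof (rule Ck_on_SucI[OF assms(1)])
    fix x assume x: "x \<in> S"
    then have D: "(F has_derivative deriv_at F (\<phi> x)) (at (\<phi> x))"
      using Ck_on_has_derivative[OF Suc.prems(1) assms(2)] assms(3) by auto
    have "((\<lambda>x. F (\<phi> x)) has_derivative (\<lambda>u. deriv_at F (\<phi> x) (deriv_at \<phi> x u))) (at x)"
      using D Ck_on_has_derivative[OF Suc.prems(2) assms(1) x] by (rule has_derivative_compose[rotated])
    then show "((\<lambda>x. F (\<phi> x)) has_derivative
       (\<lambda>u. \<Sum>b\<in>Basis. (deriv_at \<phi> x u \<bullet> b) *\<^sub>R deriv_at F (\<phi> x) b)) (at x)"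
      by (subst linear_sum_Basis[OF has_derivative_linear[OF D], symmetric])
  next
    fix u
    show "Ck_on k (\<lambda>x. \<Sum>b\<in>Basis. (deriv_at \<phi> x u \<bullet> b) *\<^sub>R deriv_at F (\<phi> x) b) S"
    proof (intro Ck_on_sum Ck_on_scaleR assms(1))
      fix b :: 'b
      show "Ck_on k (\<lambda>x. deriv_at \<phi> x u \<bullet> b) S"
        using Suc.prems(2)
        by (intro Ck_on_bounded_linear[OF assms(1) bounded_linear_inner_left, of k "\<lambda>x. deriv_at \<phi> x u" b]) auto
      show "Ck_on k (\<lambda>x. deriv_at F (\<phi> x) b) S"
        using Suc.prems Ck_on_SucD[OF Suc.prems(2)] by (intro Suc.IH) auto
    qed
  qed
qed

text \<open>With r = q^(-1/2) the derivative is - (1/2) r^3 dq, which involves only \<open>r\<close>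
  itself and dq, so each order of differentiability yields the next. The function occurs as the
  normalising factor in the Gram-Schmidt process.\<close>

lemma Ck_on_inverse_sqrt:
  assumes "open S" "\<And>x. x \<in> S \<Longrightarrow> q x > 0"
  shows "Ck_on k q S \<Longrightarrow> Ck_on k (\<lambda>x. inverse (sqrt (q x))) S"
proof (induction k)
  case 0
  then show ?case
    using assms(2) by (auto intro!: continuous_on_inverse continuous_on_real_sqrt simp: less_imp_neq[symmetric])
next
  case (Suc k)
  define r where "r x = inverse (sqrt (q x))" for x
  have r: "Ck_on k r S"
    using Suc.IH Ck_on_SucD[OF Suc.prems] by (simp add: r_def[abs_def])
  have "Ck_on (Suc k) r S"
  proof (rule Ck_on_SucI[OF assms(1)])
    fix x assume x: "x \<in> S"
    have "((\<lambda>x. inverse (sqrt (q x))) has_derivative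
       (\<lambda>u. - (inverse (sqrt (q x)) * (deriv_at q x u * (inverse (sqrt (q x)) / 2)) * inverse (sqrt (q x))))) (at x)"
      using Ck_on_has_derivative[OF Suc.prems assms(1) x] assms(2)[OF x]
      by (auto intro!: derivative_eq_intros)
    then show "(r has_derivative (\<lambda>u. r x *\<^sub>R r x *\<^sub>R r x *\<^sub>R (- 1 / 2) *\<^sub>R deriv_at q x u)) (at x)"
      by (simp add: r_def[abs_def] algebra_simps)
  next
    fix u
    show "Ck_on k (\<lambda>x. r x *\<^sub>R r x *\<^sub>R r x *\<^sub>R (- 1 / 2) *\<^sub>R deriv_at q x u) S"
      using Suc.prems r by (intro Ck_on_scaleR assms(1) Ck_on_const) auto
  qed
  then show ?case by (simp add: r_def[abs_def])
qed

section \<open>Closure properties of smooth maps\<close>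

lemma smooth_map_onD:
  assumes "smooth_map_on S f"
  shows "Ck_on k f S"
  using assms by (simp add: smooth_map_on_def)

lemma smooth_map_on_has_derivative:
  assumes "smooth_map_on S f" "open S" "x \<in> S"
  shows "(f has_derivative deriv_at f x) (at x)"
  using Ck_on_has_derivative[OF smooth_map_onD[OF assms(1)] assms(2,3)] .

lemma linear_deriv_at:
  assumes "smooth_map_on S f" "open S" "x \<in> S"
  shows "linear (deriv_at f x)"
  using smooth_map_on_has_derivative[OF assms] has_derivative_linear by blast

lemma deriv_at_eq:
  assumes "(f has_derivative f') (at x)"
  shows "deriv_at f x u = f' u"
  using frechet_derivative_at[OF assms] by simp

lemma smooth_map_on_deriv_at: "smooth_map_on S f \<Longrightarrow> smooth_map_on S (\<lambda>x. deriv_at f x u)"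
  unfolding smooth_map_on_def by (metis Ck_on.simps(2))

lemma smooth_map_on_const: "open S \<Longrightarrow> smooth_map_on S (\<lambda>x. c)"
  by (simp add: smooth_map_on_def Ck_on_const)

lemma smooth_map_on_add:
  "open S \<Longrightarrow> smooth_map_on S f \<Longrightarrow> smooth_map_on S g \<Longrightarrow> smooth_map_on S (\<lambda>x. f x + g x)"
  by (simp add: smooth_map_on_def Ck_on_add)

lemma smooth_map_on_scaleR:
  "open S \<Longrightarrow> smooth_map_on S f \<Longrightarrow> smooth_map_on S g \<Longrightarrow> smooth_map_on S (\<lambda>x. f x *\<^sub>R g x)"
  by (simp add: smooth_map_on_def Ck_on_scaleR)

lemma smooth_map_on_mult:
  fixes f g :: "'a::euclidean_space \<Rightarrow> real"
  shows "open S \<Longrightarrow> smooth_map_on S f \<Longrightarrow> smooth_map_on S g \<Longrightarrow> smooth_map_on S (\<lambda>x. f x * g x)"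
  using smooth_map_on_scaleR[of S f g] by simp

lemma smooth_map_on_minus:
  assumes "open S" "smooth_map_on S f"
  shows "smooth_map_on S (\<lambda>x. - f x)"
  using smooth_map_on_scaleR[OF assms(1) smooth_map_on_const[OF assms(1), of "- 1"] assms(2)] by simp

lemma smooth_map_on_diff:
  "open S \<Longrightarrow> smooth_map_on S f \<Longrightarrow> smooth_map_on S g \<Longrightarrow> smooth_map_on S (\<lambda>x. f x - g x)"
  using smooth_map_on_add[of S f "\<lambda>x. - g x"] smooth_map_on_minus[of S g] by simp

lemma smooth_map_on_sum:
  "open S \<Longrightarrow> (\<And>i. i \<in> I \<Longrightarrow> smooth_map_on S (f i)) \<Longrightarrow> smooth_map_on S (\<lambda>x. \<Sum>i\<in>I. f i x)"
  by (simp add: smooth_map_on_def Ck_on_sum)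

lemma smooth_map_on_bounded_linear:
  "open S \<Longrightarrow> bounded_linear L \<Longrightarrow> smooth_map_on S f \<Longrightarrow> smooth_map_on S (\<lambda>x. L (f x))"
  by (simp add: smooth_map_on_def Ck_on_bounded_linear)

lemma smooth_map_on_compose:
  fixes \<phi> :: "'a::euclidean_space \<Rightarrow> 'b::euclidean_space"
  shows "open S \<Longrightarrow> open T \<Longrightarrow> \<phi> ` S \<subseteq> T \<Longrightarrow> smooth_map_on T F \<Longrightarrow> smooth_map_on S \<phi> \<Longrightarrow>
    smooth_map_on S (\<lambda>x. F (\<phi> x))"
  by (simp add: smooth_map_on_def Ck_on_compose)

lemma smooth_map_on_inverse_sqrt:
  "open S \<Longrightarrow> (\<And>x. x \<in> S \<Longrightarrow> q x > 0) \<Longrightarrow> smooth_map_on S q \<Longrightarrow>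
    smooth_map_on S (\<lambda>x. inverse (sqrt (q x)))"
  by (simp add: smooth_map_on_def Ck_on_inverse_sqrt)

lemma smooth_map_on_cong:
  "open S \<Longrightarrow> (\<And>x. x \<in> S \<Longrightarrow> f x = g x) \<Longrightarrow> smooth_map_on S f \<Longrightarrow> smooth_map_on S g"
  unfolding smooth_map_on_def using Ck_on_cong by blast

lemma smooth_map_on_subset:
  assumes "smooth_map_on T f" "S \<subseteq> T"
  shows "smooth_map_on S f"
proof -
  have "Ck_on k f T \<Longrightarrow> Ck_on k f S" for k
    by (induction k arbitrary: f)
       (use assms(2) continuous_on_subset differentiable_on_subset in \<open>auto, blast+\<close>)
  then show ?thesis using assms(1) by (simp add: smooth_map_on_def)
qed

lemma smooth_map_on_linear:
  fixes L :: "'a::euclidean_space \<Rightarrow> 'b::real_normed_vector"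
  assumes "open S" "linear L"
  shows "smooth_map_on S L"
proof -
  have "Ck_on k L S" for k
  proof (cases k)
    case 0
    then show ?thesis using assms(2) linear_continuous_on linear_conv_bounded_linear by auto
  next
    case (Suc n)
    have "(L has_derivative L) (at x)" for x
      using assms(2) bounded_linear_imp_has_derivative linear_conv_bounded_linear by blast
    then show ?thesis
      unfolding Suc by (intro Ck_on_SucI[where f' = "\<lambda>_. L"] Ck_on_const assms(1)) auto
  qed
  then show ?thesis by (simp add: smooth_map_on_def)
qed

section \<open>Computation rules for directional derivatives\<close>

lemma deriv_at_cong:
  assumes "open S" "x \<in> S" "\<And>y. y \<in> S \<Longrightarrow> f y = g y" "smooth_map_on S f"
  shows "deriv_at f x = deriv_at g x"
  using frechet_derivative_transform_within_open[of f x S g] assms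
    smooth_map_on_has_derivative[OF assms(4,1,2)] differentiable_def by blast

lemma deriv_at_add:
  assumes "open S" "x \<in> S" "smooth_map_on S f" "smooth_map_on S g"
  shows "deriv_at (\<lambda>y. f y + g y) x u = deriv_at f x u + deriv_at g x u"
  by (rule deriv_at_eq, intro has_derivative_add smooth_map_on_has_derivative[OF _ assms(1,2)] assms)

lemma deriv_at_diff:
  assumes "open S" "x \<in> S" "smooth_map_on S f" "smooth_map_on S g"
  shows "deriv_at (\<lambda>y. f y - g y) x u = deriv_at f x u - deriv_at g x u"
  by (rule deriv_at_eq, intro has_derivative_diff smooth_map_on_has_derivative[OF _ assms(1,2)] assms)

lemma deriv_at_minus:
  assumes "open S" "x \<in> S" "smooth_map_on S f"
  shows "deriv_at (\<lambda>y. - f y) x u = - deriv_at f x u"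
  by (rule deriv_at_eq, intro has_derivative_minus smooth_map_on_has_derivative[OF _ assms(1,2)] assms)

lemma deriv_at_sum:
  assumes "open S" "x \<in> S" "\<And>i. i \<in> I \<Longrightarrow> smooth_map_on S (f i)"
  shows "deriv_at (\<lambda>y. \<Sum>i\<in>I. f i y) x u = (\<Sum>i\<in>I. deriv_at (f i) x u)"
  by (rule deriv_at_eq, rule has_derivative_sum) (rule smooth_map_on_has_derivative[OF assms(3,1,2)])

lemma deriv_at_scaleR:
  assumes "open S" "x \<in> S" "smooth_map_on S f" "smooth_map_on S g"
  shows "deriv_at (\<lambda>y. f y *\<^sub>R g y) x u = f x *\<^sub>R deriv_at g x u + deriv_at f x u *\<^sub>R g x"
  by (rule deriv_at_eq, intro has_derivative_scaleR smooth_map_on_has_derivative[OF _ assms(1,2)] assms)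

lemma deriv_at_mult:
  fixes f g :: "'a::euclidean_space \<Rightarrow> real"
  assumes "open S" "x \<in> S" "smooth_map_on S f" "smooth_map_on S g"
  shows "deriv_at (\<lambda>y. f y * g y) x u = f x * deriv_at g x u + deriv_at f x u * g x"
  using deriv_at_scaleR[OF assms] by simp

lemma deriv_at_cmult:
  fixes f :: "'a::euclidean_space \<Rightarrow> real"
  assumes "open S" "x \<in> S" "smooth_map_on S f"
  shows "deriv_at (\<lambda>y. c * f y) x u = c * deriv_at f x u"
  by (simp add: deriv_at_mult[OF assms(1,2) smooth_map_on_const[OF assms(1)] assms(3)])

lemma deriv_at_bounded_linear:
  assumes "open S" "x \<in> S" "smooth_map_on S f" "bounded_linear L"
  shows "deriv_at (\<lambda>y. L (f y)) x u = L (deriv_at f x u)"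
  by (rule deriv_at_eq, intro bounded_linear.has_derivative[OF assms(4)]
      smooth_map_on_has_derivative[OF assms(3,1,2)])

lemma deriv_at_compose:
  fixes \<phi> :: "'a::euclidean_space \<Rightarrow> 'b::euclidean_space"
  assumes "open S" "x \<in> S" "smooth_map_on S \<phi>" "open T" "\<phi> x \<in> T" "smooth_map_on T F"
  shows "deriv_at (\<lambda>y. F (\<phi> y)) x u = deriv_at F (\<phi> x) (deriv_at \<phi> x u)"
  by (rule deriv_at_eq, rule has_derivative_compose)
     (rule smooth_map_on_has_derivative[OF assms(3,1,2)], rule smooth_map_on_has_derivative[OF assms(6,4,5)])

lemma deriv_at_linear:
  assumes "linear (L :: 'a::euclidean_space \<Rightarrow> 'b::real_normed_vector)"
  shows "deriv_at L x u = L u"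
  using assms bounded_linear_imp_has_derivative deriv_at_eq linear_conv_bounded_linear by blast

text \<open>A field of linear maps is applied to a moving vector, while smoothness is assumed for
  each fixed argument only. Expanding \<open>Z\<close> in the standard basis reduces everything to
  products with scalar factors. This product rule, with the argument frozen at \<open>Z x\<close> in
  one term, underlies all covariant differentiation below.\<close>

lemma
  fixes \<alpha> :: "'a::euclidean_space \<Rightarrow> 'b::euclidean_space \<Rightarrow> 'c::real_normed_vector" and Z :: "'a \<Rightarrow> 'b"
  assumes S: "open S" and lin: "\<And>y. y \<in> S \<Longrightarrow> linear (\<alpha> y)"
    and \<alpha>: "\<And>v. smooth_map_on S (\<lambda>y. \<alpha> y v)" and Z: "smooth_map_on S Z"
  shows smooth_map_on_contract: "smooth_map_on S (\<lambda>y. \<alpha> y (Z y))"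
    and deriv_at_contract: "x \<in> S \<Longrightarrow>
      deriv_at (\<lambda>y. \<alpha> y (Z y)) x u = deriv_at (\<lambda>y. \<alpha> y (Z x)) x u + \<alpha> x (deriv_at Z x u)"
    and deriv_at_slot_linear: "x \<in> S \<Longrightarrow> linear (\<lambda>v. deriv_at (\<lambda>y. \<alpha> y v) x u)"
proof -
  have Zb: "smooth_map_on S (\<lambda>y. Z y \<bullet> b)" for b
    using smooth_map_on_bounded_linear[OF S bounded_linear_inner_left Z] .
  have E: "(\<Sum>b\<in>Basis. (Z y \<bullet> b) *\<^sub>R \<alpha> y b) = \<alpha> y (Z y)" if "y \<in> S" for y
    by (rule linear_sum_Basis[OF lin[OF that], symmetric])
  have sm: "smooth_map_on S (\<lambda>y. \<Sum>b\<in>Basis. (Z y \<bullet> b) *\<^sub>R \<alpha> y b)"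
    by (intro smooth_map_on_sum smooth_map_on_scaleR S Zb \<alpha>)
  show "smooth_map_on S (\<lambda>y. \<alpha> y (Z y))"
    by (rule smooth_map_on_cong[OF S E sm])
  assume x: "x \<in> S"
  have expand: "deriv_at (\<lambda>y. \<alpha> y v) x u = (\<Sum>b\<in>Basis. (v \<bullet> b) *\<^sub>R deriv_at (\<lambda>y. \<alpha> y b) x u)" for v
  proof -
    have eq: "\<alpha> y v = (\<Sum>b\<in>Basis. (v \<bullet> b) *\<^sub>R \<alpha> y b)" if "y \<in> S" for y
      by (rule linear_sum_Basis[OF lin[OF that]])
    have "deriv_at (\<lambda>y. \<alpha> y v) x u = deriv_at (\<lambda>y. \<Sum>b\<in>Basis. (v \<bullet> b) *\<^sub>R \<alpha> y b) x u"
      by (simp only: deriv_at_cong[OF S x eq \<alpha>])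
    also have "\<dots> = (\<Sum>b\<in>Basis. deriv_at (\<lambda>y. (v \<bullet> b) *\<^sub>R \<alpha> y b) x u)"
      by (intro deriv_at_sum[OF S x] smooth_map_on_scaleR smooth_map_on_const S \<alpha>)
    also have "\<dots> = (\<Sum>b\<in>Basis. (v \<bullet> b) *\<^sub>R deriv_at (\<lambda>y. \<alpha> y b) x u)"
      by (simp add: deriv_at_scaleR[OF S x smooth_map_on_const[OF S] \<alpha>])
    finally show ?thesis .
  qed
  show "linear (\<lambda>v. deriv_at (\<lambda>y. \<alpha> y v) x u)"
  proof -
    have "(\<lambda>v. deriv_at (\<lambda>y. \<alpha> y v) x u) = (\<lambda>v. \<Sum>b\<in>Basis. (v \<bullet> b) *\<^sub>R deriv_at (\<lambda>y. \<alpha> y b) x u)"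
      by (rule ext, rule expand)
    moreover have "linear (\<lambda>v. \<Sum>b\<in>Basis. (v \<bullet> b) *\<^sub>R deriv_at (\<lambda>y. \<alpha> y b) x u)"
      by (rule linearI) (simp_all add: inner_add_left scaleR_add_left sum.distrib scaleR_sum_right)
    ultimately show ?thesis by simp
  qed
  have "deriv_at (\<lambda>y. \<alpha> y (Z y)) x u = deriv_at (\<lambda>y. \<Sum>b\<in>Basis. (Z y \<bullet> b) *\<^sub>R \<alpha> y b) x u"
    by (simp only: deriv_at_cong[OF S x E sm])
  also have "\<dots> = (\<Sum>b\<in>Basis. deriv_at (\<lambda>y. (Z y \<bullet> b) *\<^sub>R \<alpha> y b) x u)"
    by (intro deriv_at_sum[OF S x] smooth_map_on_scaleR S Zb \<alpha>)
  also have "\<dots> = (\<Sum>b\<in>Basis. (Z x \<bullet> b) *\<^sub>R deriv_at (\<lambda>y. \<alpha> y b) x u + (deriv_at Z x u \<bullet> b) *\<^sub>R \<alpha> x b)"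
    by (simp add: deriv_at_scaleR[OF S x Zb \<alpha>] deriv_at_bounded_linear[OF S x Z bounded_linear_inner_left])
  also have "\<dots> = deriv_at (\<lambda>y. \<alpha> y (Z x)) x u + \<alpha> x (deriv_at Z x u)"
    using expand[of "Z x"] linear_sum_Basis[OF lin[OF x], of "deriv_at Z x u"] by (simp add: sum.distrib)
  finally show "deriv_at (\<lambda>y. \<alpha> y (Z y)) x u = deriv_at (\<lambda>y. \<alpha> y (Z x)) x u + \<alpha> x (deriv_at Z x u)" .
qed

section \<open>Symmetry of second derivatives\<close>

text \<open>The mean value theorem is applied along \<open>u\<close> to the increment in direction
  \<open>v\<close>, then along \<open>v\<close> to the derivative in direction \<open>u\<close>. The
  left-hand side is symmetric in \<open>u\<close> and \<open>v\<close>, the right-hand side is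
  not.\<close>

lemma second_difference_mvt:
  fixes f :: "'a::euclidean_space \<Rightarrow> real"
  assumes S: "open S" and f: "smooth_map_on S f" and t: "t > 0"
    and seg: "\<And>r s. 0 \<le> r \<Longrightarrow> r \<le> t \<Longrightarrow> 0 \<le> s \<Longrightarrow> s \<le> t \<Longrightarrow> x + r *\<^sub>R u + s *\<^sub>R v \<in> S"
  obtains r s where "0 \<le> r" "r \<le> t" "0 \<le> s" "s \<le> t"
    "f (x + t *\<^sub>R u + t *\<^sub>R v) - f (x + t *\<^sub>R u) - f (x + t *\<^sub>R v) + f x
      = t * t * deriv_at (\<lambda>y. deriv_at f y u) (x + r *\<^sub>R u + s *\<^sub>R v) v"
proof -
  define \<phi> where "\<phi> r = f (x + r *\<^sub>R u + t *\<^sub>R v) - f (x + r *\<^sub>R u)" for r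
  have D: "((\<lambda>r. F (p + r *\<^sub>R w)) has_real_derivative deriv_at F (p + r *\<^sub>R w) w) (at r)"
    if F: "smooth_map_on S F" and r: "p + r *\<^sub>R w \<in> S" for F :: "'a \<Rightarrow> real" and p w r
  proof -
    have "((\<lambda>r. F (p + r *\<^sub>R w)) has_derivative (\<lambda>h. deriv_at F (p + r *\<^sub>R w) (h *\<^sub>R w))) (at r)"
      using smooth_map_on_has_derivative[OF F S r]
      by (rule has_derivative_compose[rotated]) (auto intro!: derivative_eq_intros)
    then show ?thesis
      using linear_cmul[OF linear_deriv_at[OF F S r]]
      by (simp add: has_field_derivative_def mult.commute[of _ "deriv_at F (p + r *\<^sub>R w) w"] mult_commute_abs)
  qed
  have "\<exists>r>0. r < t \<and> \<phi> t - \<phi> 0 =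
      (t - 0) * (deriv_at f (x + r *\<^sub>R u + t *\<^sub>R v) u - deriv_at f (x + r *\<^sub>R u) u)"
  proof (rule MVT2[OF t])
    fix r assume r: "0 \<le> r" "r \<le> t"
    have "(x + t *\<^sub>R v) + r *\<^sub>R u \<in> S" "x + r *\<^sub>R u \<in> S"
      using seg[OF r, of t] seg[OF r, of 0] t by (simp_all add: algebra_simps)
    from D[OF f this(1)] D[OF f this(2)]
    show "(\<phi> has_real_derivative deriv_at f (x + r *\<^sub>R u + t *\<^sub>R v) u - deriv_at f (x + r *\<^sub>R u) u) (at r)"
      unfolding \<phi>_def[abs_def] by (intro DERIV_diff) (simp_all add: algebra_simps)
  qed
  then obtain r where r: "0 \<le> r" "r \<le> t" and
    1: "\<phi> t - \<phi> 0 = t * (deriv_at f (x + r *\<^sub>R u + t *\<^sub>R v) u - deriv_at f (x + r *\<^sub>R u) u)"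
    using less_imp_le by (metis diff_zero)
  have "\<exists>s>0. s < t \<and> deriv_at f (x + r *\<^sub>R u + t *\<^sub>R v) u - deriv_at f (x + r *\<^sub>R u + 0 *\<^sub>R v) u =
      (t - 0) * deriv_at (\<lambda>y. deriv_at f y u) (x + r *\<^sub>R u + s *\<^sub>R v) v"
    by (rule MVT2[OF t]) (use D[OF smooth_map_on_deriv_at[OF f]] seg[OF r] in auto)
  then obtain s where s: "0 \<le> s" "s \<le> t" and
    2: "deriv_at f (x + r *\<^sub>R u + t *\<^sub>R v) u - deriv_at f (x + r *\<^sub>R u) u =
      t * deriv_at (\<lambda>y. deriv_at f y u) (x + r *\<^sub>R u + s *\<^sub>R v) v"
    using less_imp_le by (metis diff_zero scaleR_zero_left add_0_right)
  show thesis
    by (rule that[OF r s]) (use 1 2 in \<open>simp add: \<phi>_def\<close>)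
qed

text \<open>One second difference over a small parallelogram equals t^2 times a value of either
  mixed derivative near \<open>x\<close>; continuity then forbids a gap at \<open>x\<close>.\<close>

lemma deriv_at_commute_real:
  fixes f :: "'a::euclidean_space \<Rightarrow> real"
  assumes S: "open S" and x: "x \<in> S" and f: "smooth_map_on S f"
  shows "deriv_at (\<lambda>y. deriv_at f y u) x v = deriv_at (\<lambda>y. deriv_at f y v) x u"
proof (rule ccontr)
  define p q where "p y = deriv_at (\<lambda>y. deriv_at f y u) y v"
    and "q y = deriv_at (\<lambda>y. deriv_at f y v) y u" for y
  assume "\<not> ?thesis"
  \<comment> \<open>Half the gap: a number closer than this to \<open>p x\<close> differs from every
    number closer than this to \<open>q x\<close>.\<close>
  then have e: "\<bar>p x - q x\<bar> / 2 > 0" (is "?e > 0") by (simp add: p_def q_def)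
  have "continuous_on S p" "continuous_on S q"
    unfolding p_def[abs_def] q_def[abs_def]
    using smooth_map_onD[OF smooth_map_on_deriv_at[OF smooth_map_on_deriv_at[OF f]], where k=0] by auto
  then have c: "isCont p x" "isCont q x"
    using S x continuous_on_eq_continuous_at by blast+
  obtain d1 where d1: "d1 > 0" "\<And>y. dist y x < d1 \<Longrightarrow> dist (p y) (p x) < ?e"
    using c(1) e unfolding continuous_at_eps_delta by blast
  obtain d2 where d2: "d2 > 0" "\<And>y. dist y x < d2 \<Longrightarrow> dist (q y) (q x) < ?e"
    using c(2) e unfolding continuous_at_eps_delta by blast
  obtain d3 where d3: "d3 > 0" "\<And>y. dist y x < d3 \<Longrightarrow> y \<in> S"
    using S x open_dist by blast
  define d where "d = min d1 (min d2 d3)"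
  have d: "d > 0" using d1 d2 d3 by (simp add: d_def)
  \<comment> \<open>This side length keeps the whole parallelogram within d/2 of \<open>x\<close>;
    the summand 1 covers the case u = v = 0.\<close>
  define t where "t = d / (2 * (norm u + norm v + 1))"
  have n: "norm u + norm v + 1 > 0" by (simp add: add_nonneg_pos)
  have t: "t > 0" using d n by (simp add: t_def)
  have near: "dist (x + r *\<^sub>R u + s *\<^sub>R v) x < d" if "0 \<le> r" "r \<le> t" "0 \<le> s" "s \<le> t" for r s
  proof -
    have "dist (x + r *\<^sub>R u + s *\<^sub>R v) x \<le> r * norm u + s * norm v"
      using that norm_triangle_ineq[of "r *\<^sub>R u" "s *\<^sub>R v"] by (simp add: dist_norm algebra_simps)
    also have "\<dots> \<le> t * norm u + t * norm v"
      using that by (intro add_mono mult_right_mono) auto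
    also have "\<dots> \<le> t * (norm u + norm v + 1)" using t by (simp add: algebra_simps)
    also have "\<dots> = d / 2"
    proof -
      have "d / (2 * c) * c = d / 2" if "c > 0" for c :: real using that by simp
      then show ?thesis using n unfolding t_def by blast
    qed
    also have "\<dots> < d" using d by simp
    finally show ?thesis .
  qed
  have seg: "x + r *\<^sub>R u + s *\<^sub>R v \<in> S" if "0 \<le> r" "r \<le> t" "0 \<le> s" "s \<le> t" for r s
    using near[OF that] d3 by (simp add: d_def)
  obtain r s where rs: "0 \<le> r" "r \<le> t" "0 \<le> s" "s \<le> t"
    "f (x + t *\<^sub>R u + t *\<^sub>R v) - f (x + t *\<^sub>R u) - f (x + t *\<^sub>R v) + f x = t * t * p (x + r *\<^sub>R u + s *\<^sub>R v)"
    by (rule second_difference_mvt[OF S f t seg, folded p_def])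
  have seg': "x + r *\<^sub>R v + s *\<^sub>R u \<in> S" if "0 \<le> r" "r \<le> t" "0 \<le> s" "s \<le> t" for r s
    using seg[of s r] that by (simp add: algebra_simps)
  obtain s' r' where rs': "0 \<le> r'" "r' \<le> t" "0 \<le> s'" "s' \<le> t"
    "f (x + t *\<^sub>R v + t *\<^sub>R u) - f (x + t *\<^sub>R v) - f (x + t *\<^sub>R u) + f x = t * t * q (x + s' *\<^sub>R v + r' *\<^sub>R u)"
    by (rule second_difference_mvt[OF S f t seg', folded q_def])
  have "t * t * p (x + r *\<^sub>R u + s *\<^sub>R v) = t * t * q (x + r' *\<^sub>R u + s' *\<^sub>R v)"
    using rs(5) rs'(5) by (simp add: algebra_simps)
  then have "p (x + r *\<^sub>R u + s *\<^sub>R v) = q (x + r' *\<^sub>R u + s' *\<^sub>R v)" using t by simp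
  moreover have "\<bar>p (x + r *\<^sub>R u + s *\<^sub>R v) - p x\<bar> < ?e" "\<bar>q (x + r' *\<^sub>R u + s' *\<^sub>R v) - q x\<bar> < ?e"
    using d1(2) d2(2) near[OF rs(1-4)] near[OF rs'(1-4)] by (simp_all add: d_def dist_real_def)
  ultimately show False by (simp add: abs_if field_simps split: if_splits)
qed

lemma deriv_at_commute:
  fixes f :: "'a::euclidean_space \<Rightarrow> 'b::euclidean_space"
  assumes S: "open S" and x: "x \<in> S" and f: "smooth_map_on S f"
  shows "deriv_at (\<lambda>y. deriv_at f y u) x v = deriv_at (\<lambda>y. deriv_at f y v) x u"
proof (rule euclidean_eqI)
  fix b :: 'b
  have fb: "smooth_map_on S (\<lambda>y. f y \<bullet> b)"
    using smooth_map_on_bounded_linear[OF S bounded_linear_inner_left f] .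
  have "deriv_at (\<lambda>y. deriv_at f y u) x v \<bullet> b = deriv_at (\<lambda>y. deriv_at (\<lambda>y. f y \<bullet> b) y u) x v" for u v
  proof -
    have "deriv_at (\<lambda>y. deriv_at f y u) x v \<bullet> b = deriv_at (\<lambda>y. deriv_at f y u \<bullet> b) x v"
      by (rule deriv_at_bounded_linear[OF S x smooth_map_on_deriv_at[OF f] bounded_linear_inner_left, symmetric])
    also have "\<dots> = deriv_at (\<lambda>y. deriv_at (\<lambda>y. f y \<bullet> b) y u) x v"
    proof -
      have "deriv_at (\<lambda>y. f y \<bullet> b) y u = deriv_at f y u \<bullet> b" if "y \<in> S" for y
        by (rule deriv_at_bounded_linear[OF S that f bounded_linear_inner_left])
      then show ?thesis
        by (simp only: deriv_at_cong[OF S x _ smooth_map_on_deriv_at[OF fb]])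
    qed
    finally show ?thesis .
  qed
  then show "deriv_at (\<lambda>y. deriv_at f y u) x v \<bullet> b = deriv_at (\<lambda>y. deriv_at f y v) x u \<bullet> b"
    using deriv_at_commute_real[OF S x fb] by simp
qed


section \<open>Inner products and traces\<close>

text \<open>Pairing with a frame element reads off its coefficient, so a frame is independent, and a
  frame of \<open>DIM('a)\<close> elements then spans the space.\<close>

lemma orthonormal_frame_expand:
  assumes b: "bilinear b" "\<And>u. u \<noteq> 0 \<Longrightarrow> b u u > 0" and E: "orthonormal_frame b E"
  shows "v = (\<Sum>e\<in>E. b v e *\<^sub>R e)"
proof -
  have fin: "finite E" and card: "card E = DIM('a)"
    and on: "\<And>e e'. e \<in> E \<Longrightarrow> e' \<in> E \<Longrightarrow> b e e' = (if e = e' then 1 else 0)"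
    using E by (auto simp: orthonormal_frame_def)
  have coeff: "b (\<Sum>e\<in>E. c e *\<^sub>R e) e' = c e'" if "e' \<in> E" for c e'
  proof -
    have "b (\<Sum>e\<in>E. c e *\<^sub>R e) e' = (\<Sum>e\<in>E. c e * b e e')"
    proof -
      have lin: "linear (\<lambda>u. b u e')" using b(1) by (simp add: bilinear_def)
      show ?thesis by (simp add: linear_sum[OF lin] linear_cmul[OF lin])
    qed
    also have "\<dots> = (\<Sum>e\<in>E. if e = e' then c e else 0)"
      by (rule sum.cong) (auto simp: on that)
    also have "\<dots> = c e'" using fin that by simp
    finally show ?thesis .
  qed
  have "independent E"
    using coeff b(1) by (intro independent_if_scalars_zero fin) (metis bilinear_lzero)
  then have "span E = UNIV"
    using card fin dim_eq_full[of E] dim_eq_card_independent by metis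
  then obtain c where "v = (\<Sum>e\<in>E. c e *\<^sub>R e)"
    using span_finite[OF fin] by (metis (no_types, lifting) UNIV_I imageE)
  then show ?thesis using coeff by simp
qed

text \<open>Expanding the chosen frame in \<open>E\<close> and resumming the other way shows that
  both sums agree. From here on the frame hidden in \<open>SOME\<close> can be replaced by any
  convenient one.\<close>

lemma metric_trace_eq:
  assumes b: "bilinear b" "\<And>u. u \<noteq> 0 \<Longrightarrow> b u u > 0" "\<And>u v. b u v = b v u"
    and E: "orthonormal_frame b E" and B: "bilinear B"
  shows "metric_trace b B = (\<Sum>e\<in>E. B e e)"
proof -
  define E' where "E' = (SOME E. orthonormal_frame b E)"
  have E': "orthonormal_frame b E'"
    unfolding E'_def using E by (rule someI)
  have linl: "linear (\<lambda>u. B u w)" and linr: "linear (B w)" for w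
    using B by (auto simp: bilinear_def)
  have "(\<Sum>e\<in>E'. B e e) = (\<Sum>e\<in>E'. B (\<Sum>f\<in>E. b e f *\<^sub>R f) e)"
    by (simp add: orthonormal_frame_expand[OF b(1,2) E, symmetric])
  also have "\<dots> = (\<Sum>e\<in>E'. \<Sum>f\<in>E. b e f * B f e)"
    by (simp add: linear_sum[OF linl] linear_cmul[OF linl])
  also have "\<dots> = (\<Sum>f\<in>E. \<Sum>e\<in>E'. b f e * B f e)"
    by (subst sum.swap) (simp add: b(3))
  also have "\<dots> = (\<Sum>f\<in>E. B f (\<Sum>e\<in>E'. b f e *\<^sub>R e))"
    by (simp add: linear_sum[OF linr] linear_cmul[OF linr])
  also have "\<dots> = (\<Sum>f\<in>E. B f f)"
    by (simp add: orthonormal_frame_expand[OF b(1,2) E', symmetric])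
  finally show ?thesis by (simp add: metric_trace_def E'_def)
qed


section \<open>Tensor fields on open sets\<close>

definition tensor1 :: "'a::euclidean_space set \<Rightarrow> ('a \<Rightarrow> 'a \<Rightarrow> 'c::real_normed_vector) \<Rightarrow> bool" where
  "tensor1 S \<alpha> \<longleftrightarrow> (\<forall>x\<in>S. linear (\<alpha> x)) \<and> (\<forall>v. smooth_map_on S (\<lambda>x. \<alpha> x v))"

definition tensor2 :: "'a::euclidean_space set \<Rightarrow> ('a \<Rightarrow> 'a \<Rightarrow> 'a \<Rightarrow> 'c::real_normed_vector) \<Rightarrow> bool" where
  "tensor2 S h \<longleftrightarrow> (\<forall>v. tensor1 S (\<lambda>x. h x v)) \<and> (\<forall>w. tensor1 S (\<lambda>x v. h x v w))"

definition tensor3 ::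
  "'a::euclidean_space set \<Rightarrow> ('a \<Rightarrow> 'a \<Rightarrow> 'a \<Rightarrow> 'a \<Rightarrow> 'c::real_normed_vector) \<Rightarrow> bool" where
  "tensor3 S T \<longleftrightarrow> (\<forall>u. tensor2 S (\<lambda>x. T x u)) \<and> (\<forall>v w. tensor1 S (\<lambda>x u. T x u v w))"

definition tensor4 ::
  "'a::euclidean_space set \<Rightarrow> ('a \<Rightarrow> 'a \<Rightarrow> 'a \<Rightarrow> 'a \<Rightarrow> 'a \<Rightarrow> 'c::real_normed_vector) \<Rightarrow> bool" where
  "tensor4 S T \<longleftrightarrow> (\<forall>u. tensor3 S (\<lambda>x. T x u)) \<and> (\<forall>v w z. tensor1 S (\<lambda>x u. T x u v w z))"

lemma tensor1D:
  assumes "tensor1 S \<alpha>"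
  shows "x \<in> S \<Longrightarrow> linear (\<alpha> x)" "smooth_map_on S (\<lambda>x. \<alpha> x v)"
  using assms by (auto simp: tensor1_def)

lemma tensor2D:
  assumes "tensor2 S h"
  shows "tensor1 S (\<lambda>x. h x v)" "tensor1 S (\<lambda>x v. h x v w)" "x \<in> S \<Longrightarrow> linear (h x v)"
    "x \<in> S \<Longrightarrow> linear (\<lambda>v. h x v w)" "smooth_map_on S (\<lambda>x. h x v w)"
  using assms by (auto simp: tensor2_def tensor1_def)

lemma tensor3D:
  assumes "tensor3 S T"
  shows "tensor2 S (\<lambda>x. T x u)" "tensor2 S (\<lambda>x u v. T x u v w)" "tensor2 S (\<lambda>x u w. T x u v w)"
    "x \<in> S \<Longrightarrow> linear (\<lambda>u. T x u v w)" "x \<in> S \<Longrightarrow> linear (\<lambda>v. T x u v w)"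
    "x \<in> S \<Longrightarrow> linear (T x u v)" "smooth_map_on S (\<lambda>x. T x u v w)"
  using assms by (auto simp: tensor3_def tensor2_def tensor1_def)

lemma tensor4D:
  assumes "tensor4 S T"
  shows "tensor3 S (\<lambda>x. T x u)" "tensor1 S (\<lambda>x u. T x u v w z)"
    "tensor2 S (\<lambda>x u v. T x u v w z)"
    "x \<in> S \<Longrightarrow> linear (\<lambda>u. T x u v w z)" "x \<in> S \<Longrightarrow> linear (\<lambda>v. T x u v w z)"
    "x \<in> S \<Longrightarrow> linear (\<lambda>w. T x u v w z)" "x \<in> S \<Longrightarrow> linear (T x u v w)"
    "smooth_map_on S (\<lambda>x. T x u v w z)"
  using assms by (auto simp: tensor4_def tensor3_def tensor2_def tensor1_def)

lemma tensor2_bilinear: "tensor2 S h \<Longrightarrow> x \<in> S \<Longrightarrow> bilinear (h x)"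
  by (simp add: bilinear_def tensor2D)

lemma
  assumes "open S" "tensor1 S \<alpha>" "smooth_map_on S Z"
  shows smooth_tensor1_contract: "smooth_map_on S (\<lambda>y. \<alpha> y (Z y))"
    and deriv_at_tensor1_contract: "x \<in> S \<Longrightarrow>
      deriv_at (\<lambda>y. \<alpha> y (Z y)) x u = deriv_at (\<lambda>y. \<alpha> y (Z x)) x u + \<alpha> x (deriv_at Z x u)"
  using smooth_map_on_contract[of S \<alpha> Z] deriv_at_contract[of S \<alpha> Z] assms
  by (auto simp: tensor1_def)

lemma linear_deriv_at_tensor1:
  fixes \<alpha> :: "'a::euclidean_space \<Rightarrow> 'a \<Rightarrow> 'c::real_normed_vector"
  assumes "open S" "tensor1 S \<alpha>" "x \<in> S"
  shows "linear (\<lambda>v. deriv_at (\<lambda>y. \<alpha> y v) x u)"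
  using deriv_at_slot_linear[of S \<alpha> "\<lambda>_. 0"] assms smooth_map_on_const[OF assms(1)]
  by (auto simp: tensor1_def)

lemma tensor1_contract_right:
  assumes "open S" "tensor2 S h" "smooth_map_on S W"
  shows "tensor1 S (\<lambda>y v. h y v (W y))"
  unfolding tensor1_def
proof (intro conjI allI ballI)
  show "linear (\<lambda>v. h x v (W x))" if "x \<in> S" for x
    by (rule tensor2D(4)[OF assms(2) that])
  show "smooth_map_on S (\<lambda>y. h y v (W y))" for v
    by (rule smooth_tensor1_contract[OF assms(1) tensor2D(1)[OF assms(2)] assms(3)])
qed

lemma smooth_tensor2_contract:
  assumes "open S" "tensor2 S h" "smooth_map_on S Z" "smooth_map_on S W"
  shows "smooth_map_on S (\<lambda>y. h y (Z y) (W y))"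
  using smooth_tensor1_contract[OF assms(1) tensor1_contract_right[OF assms(1,2,4)] assms(3)] .

lemma deriv_at_tensor2_contract:
  assumes "open S" "tensor2 S h" "smooth_map_on S Z" "smooth_map_on S W" "x \<in> S"
  shows "deriv_at (\<lambda>y. h y (Z y) (W y)) x u =
    deriv_at (\<lambda>y. h y (Z x) (W x)) x u + h x (deriv_at Z x u) (W x) + h x (Z x) (deriv_at W x u)"
  using deriv_at_tensor1_contract[OF assms(1) tensor1_contract_right[OF assms(1,2,4)] assms(3,5)]
    deriv_at_tensor1_contract[OF assms(1) tensor2D(1)[OF assms(2)] assms(4,5)]
  by simp

lemma tensor1_add:
  assumes "open S" "tensor1 S \<alpha>" "tensor1 S \<beta>"
  shows "tensor1 S (\<lambda>x u. \<alpha> x u + \<beta> x u)"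
  using assms unfolding tensor1_def
  by (auto intro!: linear_compose_add smooth_map_on_add[OF assms(1)])

lemma tensor1_diff:
  assumes "open S" "tensor1 S \<alpha>" "tensor1 S \<beta>"
  shows "tensor1 S (\<lambda>x u. \<alpha> x u - \<beta> x u)"
  using assms unfolding tensor1_def
  by (auto intro!: linear_compose_sub smooth_map_on_diff[OF assms(1)])

lemma tensor1_scaleR:
  assumes "open S" "smooth_map_on S f" "tensor1 S \<alpha>"
  shows "tensor1 S (\<lambda>x u. f x *\<^sub>R \<alpha> x u)"
  using assms unfolding tensor1_def
  by (auto intro!: linear_compose_scale_right smooth_map_on_scaleR[OF assms(1)])

lemma tensor2_add:
  assumes "open S" "tensor2 S \<alpha>" "tensor2 S \<beta>"
  shows "tensor2 S (\<lambda>x u v. \<alpha> x u v + \<beta> x u v)"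
  using assms unfolding tensor2_def by (auto intro: tensor1_add)

lemma tensor2_diff:
  assumes "open S" "tensor2 S \<alpha>" "tensor2 S \<beta>"
  shows "tensor2 S (\<lambda>x u v. \<alpha> x u v - \<beta> x u v)"
  using assms unfolding tensor2_def by (auto intro: tensor1_diff)

lemma tensor2_scaleR:
  assumes "open S" "smooth_map_on S f" "tensor2 S \<alpha>"
  shows "tensor2 S (\<lambda>x u v. f x *\<^sub>R \<alpha> x u v)"
  using assms unfolding tensor2_def by (auto intro: tensor1_scaleR)

lemma tensor1_deriv_at:
  assumes "open S" "smooth_map_on S f"
  shows "tensor1 S (\<lambda>x. deriv_at f x)"
  unfolding tensor1_def using assms linear_deriv_at smooth_map_on_deriv_at by blast

lemma tensor2_deriv_at:
  assumes "open S" "tensor1 S \<alpha>"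
  shows "tensor2 S (\<lambda>x u v. deriv_at (\<lambda>y. \<alpha> y v) x u)"
  unfolding tensor2_def
proof (intro conjI allI)
  fix u v
  show "tensor1 S (\<lambda>x v. deriv_at (\<lambda>y. \<alpha> y v) x u)"
    unfolding tensor1_def
    using assms tensor1D linear_deriv_at_tensor1 smooth_map_on_deriv_at by blast
  show "tensor1 S (\<lambda>x u. deriv_at (\<lambda>y. \<alpha> y v) x u)"
    by (intro tensor1_deriv_at assms(1) tensor1D(2)[OF assms(2)])
qed

lemma tensor3_deriv_at:
  assumes "open S" "tensor2 S h"
  shows "tensor3 S (\<lambda>x u v w. deriv_at (\<lambda>y. h y v w) x u)"
proof -
  have "tensor2 S (\<lambda>x u w. deriv_at (\<lambda>y. h y v w) x u)"
    "tensor2 S (\<lambda>x u w. deriv_at (\<lambda>y. h y w v) x u)" for v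
    using tensor2_deriv_at[OF assms(1) tensor2D(1)[OF assms(2)]]
      tensor2_deriv_at[OF assms(1) tensor2D(2)[OF assms(2)]] by blast+
  then show ?thesis unfolding tensor3_def tensor2_def by blast
qed

lemma tensor4_deriv_at:
  assumes "open S" "tensor3 S T"
  shows "tensor4 S (\<lambda>x u v w z. deriv_at (\<lambda>y. T y v w z) x u)"
proof -
  have "tensor3 S (\<lambda>x u w z. deriv_at (\<lambda>y. T y v w z) x u)" for v
    using tensor3_deriv_at[OF assms(1) tensor3D(1)[OF assms(2)]] .
  moreover have "tensor3 S (\<lambda>x u v w. deriv_at (\<lambda>y. T y v w z) x u)" for z
    using tensor3_deriv_at[OF assms(1) tensor3D(2)[OF assms(2)]] .
  ultimately show ?thesis unfolding tensor4_def tensor3_def tensor2_def by blast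
qed


section \<open>Metrics in a chart\<close>

text \<open>The local theory lives on an open set with a metric, free of atlas and topology. Chart
  ranges of a manifold are instances, and so are products of two of them.\<close>

locale riemannian_chart =
  fixes S :: "'a::euclidean_space set" and g :: "'a local_tensor2"
  assumes open_S: "open S"
    and bilinear_g: "x \<in> S \<Longrightarrow> bilinear (g x)"
    and sym_g: "x \<in> S \<Longrightarrow> g x u v = g x v u"
    and pos_g: "x \<in> S \<Longrightarrow> u \<noteq> 0 \<Longrightarrow> g x u u > 0"
    and smooth_g: "smooth_map_on S (\<lambda>x. g x u v)"
begin

lemma tensor2_g: "tensor2 S g"
  using bilinear_g smooth_g by (simp add: tensor2_def tensor1_def bilinear_def)

lemma nondegenerate:
  assumes "x \<in> S" "\<And>z. g x u z = g x v z"
  shows "u = v"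
proof (rule ccontr)
  assume "u \<noteq> v"
  then have "g x (u - v) (u - v) > 0" using pos_g[OF assms(1)] by simp
  moreover have "g x (u - v) (u - v) = 0"
    using assms(2) bilinear_lsub[OF bilinear_g[OF assms(1)]] by simp
  ultimately show False by simp
qed

section \<open>Smooth orthonormal frames and traces\<close>

text \<open>Gram-Schmidt applied to the constant basis fields, one at a time. The clause about
  \<open>span B\<close> keeps the next basis vector outside the span of the fields already built, so
  the vector to be normalised vanishes nowhere on \<open>S\<close>.\<close>

lemma smooth_orthonormal_family:
  assumes "finite B" "B \<subseteq> Basis"
  shows "\<exists>e. (\<forall>b\<in>B. smooth_map_on S (e b)) \<and>
    (\<forall>y\<in>S. (\<forall>b\<in>B. e b y \<in> span B) \<and> (\<forall>b\<in>B. \<forall>c\<in>B. g y (e b y) (e c y) = (if b = c then 1 else 0)))"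
  using assms
proof (induction B rule: finite_induct)
  case empty
  then show ?case by simp
next
  case (insert c B)
  then have "B \<subseteq> Basis" by simp
  from insert.IH[OF this] obtain e where e0: "(\<forall>b\<in>B. smooth_map_on S (e b)) \<and>
    (\<forall>y\<in>S. (\<forall>b\<in>B. e b y \<in> span B) \<and> (\<forall>b\<in>B. \<forall>c\<in>B. g y (e b y) (e c y) = (if b = c then 1 else 0)))"
    by (elim exE)
  have e: "\<And>b. b \<in> B \<Longrightarrow> smooth_map_on S (e b)"
    "\<And>b y. y \<in> S \<Longrightarrow> b \<in> B \<Longrightarrow> e b y \<in> span B"
    "\<And>b c y. y \<in> S \<Longrightarrow> b \<in> B \<Longrightarrow> c \<in> B \<Longrightarrow> g y (e b y) (e c y) = (if b = c then 1 else 0)"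
    using e0 by simp_all
  define w where "w y = c - (\<Sum>b\<in>B. g y c (e b y) *\<^sub>R e b y)" for y
  define q where "q y = g y (w y) (w y)" for y
  define r where "r y = inverse (sqrt (q y))" for y
  define e' where "e' = e(c := (\<lambda>y. r y *\<^sub>R w y))"
  have "independent (insert c B)"
    using insert.prems independent_Basis independent_mono by blast
  then have c: "c \<notin> span B" using insert.hyps by (simp add: independent_insert)
  have sum_span: "(\<Sum>b\<in>B. g y c (e b y) *\<^sub>R e b y) \<in> span B" if "y \<in> S" for y
    using e(2)[OF that] by (intro span_sum span_scale)
  have "w y \<noteq> 0" if "y \<in> S" for y
    using sum_span[OF that] c by (auto simp: w_def)
  then have q: "q y > 0" if "y \<in> S" for y
    using pos_g that by (simp add: q_def)
  have w: "smooth_map_on S w"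
    unfolding w_def[abs_def]
    by (intro smooth_map_on_diff smooth_map_on_const smooth_map_on_sum smooth_map_on_scaleR open_S e(1)
      smooth_tensor1_contract[OF open_S tensor2D(1)[OF tensor2_g]])
  have "smooth_map_on S r"
    unfolding r_def[abs_def] q_def[abs_def]
    by (intro smooth_map_on_inverse_sqrt open_S smooth_tensor2_contract[OF open_S tensor2_g w w])
      (use q in \<open>simp add: q_def\<close>)
  then have sm: "smooth_map_on S (e' b)" if "b \<in> insert c B" for b
    using that e(1) smooth_map_on_scaleR[OF open_S _ w] by (auto simp: e'_def)
  have sp: "e' b y \<in> span (insert c B)" if "y \<in> S" "b \<in> insert c B" for b y
  proof (cases "b = c")
    case True
    have "w y \<in> span (insert c B)"
      unfolding w_def using span_mono[THEN subsetD, OF subset_insertI sum_span[OF that(1)], of c]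
      by (intro span_diff) (auto intro: span_base)
    then show ?thesis using True by (simp add: e'_def span_scale)
  next
    case False
    then show ?thesis
      using that e(2)[THEN span_mono[THEN subsetD, OF subset_insertI]] by (auto simp: e'_def)
  qed
  have orth: "g y (w y) (e b y) = 0" if "y \<in> S" "b \<in> B" for b y
  proof -
    have lin: "linear (\<lambda>u. g y u v)" for v
      using tensor2D(4)[OF tensor2_g that(1)] .
    have "g y (w y) (e b y) = g y c (e b y) - (\<Sum>b'\<in>B. g y c (e b' y) * g y (e b' y) (e b y))"
      unfolding w_def by (simp add: linear_diff[OF lin] linear_sum[OF lin] linear_cmul[OF lin])
    also have "(\<Sum>b'\<in>B. g y c (e b' y) * g y (e b' y) (e b y)) = (\<Sum>b'\<in>B. if b' = b then g y c (e b' y) else 0)"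
      using e(3) that by (intro sum.cong) auto
    also have "\<dots> = g y c (e b y)" using insert.hyps that by simp
    finally show ?thesis by simp
  qed
  have norm1: "g y (e' c y) (e' c y) = 1" if "y \<in> S" for y
  proof -
    have "g y (r y *\<^sub>R w y) (r y *\<^sub>R w y) = r y * r y * q y"
      using bilinear_lmul[OF bilinear_g[OF that]] bilinear_rmul[OF bilinear_g[OF that]]
      by (simp add: q_def)
    also have "\<dots> = 1"
      using q[OF that] unfolding r_def
      by (metis inverse_mult_distrib less_imp_le less_irrefl left_inverse real_sqrt_mult_self abs_of_pos)
    finally show ?thesis by (simp add: e'_def)
  qed
  have on: "g y (e' a y) (e' b y) = (if a = b then 1 else 0)"
    if "y \<in> S" "a \<in> insert c B" "b \<in> insert c B" for a b y
  proof (cases "a = c")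
    case True
    show ?thesis
    proof (cases "b = c")
      case False
      then have "g y (e' c y) (e' b y) = r y * g y (w y) (e b y)"
        using bilinear_lmul[OF bilinear_g[OF that(1)]] by (simp add: e'_def)
      then show ?thesis using orth that True False by simp
    qed (use True norm1 that in simp)
  next
    case a: False
    show ?thesis
    proof (cases "b = c")
      case True
      then have "g y (e' a y) (e' c y) = r y * g y (w y) (e a y)"
        using a bilinear_rmul[OF bilinear_g[OF that(1)]] sym_g[OF that(1)] by (simp add: e'_def)
      then show ?thesis using orth that True a by auto
    next
      case False
      then show ?thesis using a that e(3) by (auto simp: e'_def)
    qed
  qed
  show ?case
    by (intro exI[of _ e'] conjI ballI sm sp on)
qed

text \<open>Indexing by the standard basis vectors turns a sum over the frame into a sum over the
  fixed set \<open>Basis\<close>, which can be differentiated term by term.\<close>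

definition frame :: "'a \<Rightarrow> 'a \<Rightarrow> 'a" where
  "frame = (SOME e. (\<forall>b\<in>Basis. smooth_map_on S (e b)) \<and>
    (\<forall>y\<in>S. \<forall>b\<in>Basis. \<forall>c\<in>Basis. g y (e b y) (e c y) = (if b = c then 1 else 0)))"

lemma
  shows smooth_frame: "b \<in> Basis \<Longrightarrow> smooth_map_on S (frame b)"
    and frame_orthonormal: "y \<in> S \<Longrightarrow> b \<in> Basis \<Longrightarrow> c \<in> Basis \<Longrightarrow>
      g y (frame b y) (frame c y) = (if b = c then 1 else 0)"
proof -
  have "\<exists>e :: 'a \<Rightarrow> 'a \<Rightarrow> 'a. (\<forall>b\<in>Basis. smooth_map_on S (e b)) \<and>
    (\<forall>y\<in>S. \<forall>b\<in>Basis. \<forall>c\<in>Basis. g y (e b y) (e c y) = (if b = c then 1 else 0))"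
    using smooth_orthonormal_family[OF finite_Basis subset_refl] by (rule ex_forward) simp
  from someI_ex[OF this]
  have *: "(\<forall>b\<in>Basis. smooth_map_on S (frame b)) \<and>
    (\<forall>y\<in>S. \<forall>b\<in>Basis. \<forall>c\<in>Basis. g y (frame b y) (frame c y) = (if b = c then 1 else 0))"
    unfolding frame_def .
  show "b \<in> Basis \<Longrightarrow> smooth_map_on S (frame b)"
    "y \<in> S \<Longrightarrow> b \<in> Basis \<Longrightarrow> c \<in> Basis \<Longrightarrow> g y (frame b y) (frame c y) = (if b = c then 1 else 0)"
    using * by blast+
qed

lemma inj_on_frame:
  assumes "y \<in> S"
  shows "inj_on (\<lambda>b. frame b y) Basis"
  using frame_orthonormal[OF assms] by (intro inj_onI) (metis zero_neq_one)

lemma orthonormal_frame_frame: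
  assumes "y \<in> S"
  shows "orthonormal_frame (g y) ((\<lambda>b. frame b y) ` Basis)"
  unfolding orthonormal_frame_def
proof (intro conjI ballI)
  show "card ((\<lambda>b. frame b y) ` Basis) = DIM('a)"
    by (rule card_image[OF inj_on_frame[OF assms]])
  fix e e' assume "e \<in> (\<lambda>b. frame b y) ` Basis" "e' \<in> (\<lambda>b. frame b y) ` Basis"
  then show "g y e e' = (if e = e' then 1 else 0)"
    using frame_orthonormal[OF assms] inj_on_frame[OF assms] by (auto simp: inj_on_def)
qed simp

lemma frame_expand:
  assumes "y \<in> S"
  shows "v = (\<Sum>b\<in>Basis. g y v (frame b y) *\<^sub>R frame b y)"
  using orthonormal_frame_expand[OF bilinear_g pos_g orthonormal_frame_frame, OF assms assms _ assms, of v]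
  by (simp add: sum.reindex[OF inj_on_frame[OF assms]])

lemma metric_trace_frame:
  assumes "x \<in> S" "bilinear B"
  shows "metric_trace (g x) B = (\<Sum>b\<in>Basis. B (frame b x) (frame b x))"
  using metric_trace_eq[OF bilinear_g pos_g sym_g orthonormal_frame_frame assms(2), OF assms(1,1) _ assms(1,1)]
  by (simp add: sum.reindex[OF inj_on_frame[OF assms(1)]])

lemma metric_trace_g:
  assumes "x \<in> S"
  shows "metric_trace (g x) (g x) = DIM('a)"
  using metric_trace_frame[OF assms bilinear_g[OF assms]] frame_orthonormal[OF assms] by simp

lemma metric_trace_add:
  assumes "x \<in> S" "bilinear A" "bilinear B"
  shows "metric_trace (g x) (\<lambda>e e'. A e e' + B e e') = metric_trace (g x) A + metric_trace (g x) B"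
proof -
  have "bilinear (\<lambda>e e'. A e e' + B e e')"
    using assms by (simp add: bilinear_def linear_compose_add)
  then show ?thesis using assms by (simp add: metric_trace_frame sum.distrib)
qed

lemma metric_trace_cmult:
  assumes "x \<in> S" "bilinear A"
  shows "metric_trace (g x) (\<lambda>e e'. c * A e e') = c * metric_trace (g x) A"
proof -
  have "bilinear (\<lambda>e e'. c * A e e')"
    using assms linear_compose_scale_right[where c=c] by (fastforce simp: bilinear_def)
  then show ?thesis using assms by (simp add: metric_trace_frame sum_distrib_left)
qed

section \<open>The Levi-Civita connection in a chart\<close>

text \<open>Twice the pairing of \<open>christoffel g x u v\<close> with \<open>z\<close>, see the Koszul formula.\<close>

definition koszul :: "'a \<Rightarrow> 'a \<Rightarrow> 'a \<Rightarrow> 'a \<Rightarrow> real" where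
  "koszul x u v z =
     deriv_at (\<lambda>y. g y v z) x u + deriv_at (\<lambda>y. g y u z) x v - deriv_at (\<lambda>y. g y u v) x z"

lemma koszul_smooth: "smooth_map_on S (\<lambda>x. koszul x u v z)"
  unfolding koszul_def
  by (intro smooth_map_on_add smooth_map_on_diff smooth_map_on_deriv_at open_S smooth_g)

lemma koszul_linear:
  assumes "x \<in> S"
  shows "linear (\<lambda>u. koszul x u v z)" "linear (\<lambda>v. koszul x u v z)" "linear (koszul x u v)"
proof -
  note t = tensor3_deriv_at[OF open_S tensor2_g]
  note t1 = tensor3D(4)[OF t assms] tensor3D(5)[OF t assms] tensor3D(6)[OF t assms]
  show "linear (\<lambda>u. koszul x u v z)" "linear (\<lambda>v. koszul x u v z)" "linear (koszul x u v)"
    unfolding koszul_def[abs_def] by (intro linear_compose_add linear_compose_sub t1)+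
qed

lemma christoffel_eqI:
  assumes "x \<in> S" "\<And>z. 2 * g x w z = koszul x u v z"
  shows "christoffel g x u v = w"
  unfolding christoffel_def koszul_def[symmetric]
proof (rule the_equality)
  fix w' assume *: "\<forall>z. 2 * g x w' z = koszul x u v z"
  show "w' = w"
  proof (rule nondegenerate[OF assms(1)])
    fix z show "g x w' z = g x w z" using *[rule_format, of z] assms(2)[of z] by simp
  qed
qed (use assms in simp)

text \<open>Riesz representation in an orthonormal frame: the vector representing a linear
  functional has the values of the functional on the frame as coefficients. This supplies the
  existence half of the \<open>THE\<close> in \<open>christoffel\<close>.\<close>

lemma koszul_frame:
  assumes "x \<in> S"
  shows "2 * g x (\<Sum>b\<in>Basis. (koszul x u v (frame b x) / 2) *\<^sub>R frame b x) z = koszul x u v z"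
proof -
  have lin: "linear (\<lambda>u. g x u z)"
    using tensor2D(4)[OF tensor2_g assms] .
  note K = koszul_linear(3)[OF assms]
  have "koszul x u v z = koszul x u v (\<Sum>b\<in>Basis. g x z (frame b x) *\<^sub>R frame b x)"
    by (simp add: frame_expand[OF assms, symmetric])
  also have "\<dots> = (\<Sum>b\<in>Basis. g x z (frame b x) * koszul x u v (frame b x))"
    by (simp add: linear_sum[OF K] linear_cmul[OF K])
  also have "\<dots> = 2 * g x (\<Sum>b\<in>Basis. (koszul x u v (frame b x) / 2) *\<^sub>R frame b x) z"
    by (simp add: linear_sum[OF lin] linear_cmul[OF lin] sum_distrib_left sym_g[OF assms, of z] mult.commute)
  finally show ?thesis by simp
qed

lemma christoffel_frame:
  assumes "x \<in> S"
  shows "christoffel g x u v = (\<Sum>b\<in>Basis. (koszul x u v (frame b x) / 2) *\<^sub>R frame b x)"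
  by (rule christoffel_eqI[OF assms koszul_frame[OF assms]])

lemma christoffel_koszul:
  assumes "x \<in> S"
  shows "2 * g x (christoffel g x u v) z = koszul x u v z"
  unfolding christoffel_frame[OF assms] by (rule koszul_frame[OF assms])

text \<open>Torsion-freeness: symmetry of the metric makes the Koszul expression symmetric in
  \<open>u\<close> and \<open>v\<close>.\<close>

lemma christoffel_commute:
  assumes "x \<in> S"
  shows "christoffel g x u v = christoffel g x v u"
proof (rule christoffel_eqI[OF assms])
  have "deriv_at (\<lambda>y. g y u v) x = deriv_at (\<lambda>y. g y v u) x" for u v
    by (rule deriv_at_cong[OF open_S assms sym_g smooth_g])
  then show "2 * g x (christoffel g x v u) z = koszul x u v z" for z
    by (simp add: christoffel_koszul[OF assms] koszul_def)
qed

text \<open>In the sum of the Koszul expressions for the two slots only the derivatives in direction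
  \<open>u\<close> survive.\<close>

lemma metric_compatible:
  assumes "x \<in> S"
  shows "deriv_at (\<lambda>y. g y v w) x u = g x (christoffel g x u v) w + g x v (christoffel g x u w)"
proof -
  have s: "deriv_at (\<lambda>y. g y u v) x = deriv_at (\<lambda>y. g y v u) x" for u v
    by (rule deriv_at_cong[OF open_S assms sym_g smooth_g])
  have "2 * g x (christoffel g x u v) w + 2 * g x v (christoffel g x u w) = 2 * deriv_at (\<lambda>y. g y v w) x u"
    using christoffel_koszul[OF assms, of u v w] christoffel_koszul[OF assms, of u w v]
      s[of u v] s[of u w] s[of v w]
    by (simp add: sym_g[OF assms, of v] koszul_def)
  then show ?thesis by simp
qed

text \<open>The frame formula makes visible the smoothness that the \<open>THE\<close> in the
  definition hides.\<close>

lemma christoffel_tensor2: "tensor2 S (christoffel g)"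
proof -
  have sm: "smooth_map_on S (\<lambda>x. christoffel g x u v)" for u v
  proof (rule smooth_map_on_cong[OF open_S])
    have K: "tensor1 S (\<lambda>x. koszul x u v)"
      by (simp add: tensor1_def koszul_smooth koszul_linear)
    show "smooth_map_on S (\<lambda>x. \<Sum>b\<in>Basis. (1 / 2 * koszul x u v (frame b x)) *\<^sub>R frame b x)"
      by (intro smooth_map_on_sum smooth_map_on_scaleR smooth_map_on_mult smooth_map_on_const[OF open_S]
          open_S smooth_tensor1_contract[OF open_S K smooth_frame] smooth_frame)
  qed (simp add: christoffel_frame)
  have "linear (\<lambda>u. christoffel g x u v)" if x: "x \<in> S" for x v
    by (rule linearI)
      (simp_all add: christoffel_frame[OF x] linear_add[OF koszul_linear(1)[OF x]]
        linear_cmul[OF koszul_linear(1)[OF x]] add_divide_distrib scaleR_add_left sum.distrib scaleR_sum_right)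
  then show ?thesis
    using sm christoffel_commute unfolding tensor2_def tensor1_def by simp
qed

lemmas christoffel_linear = tensor2D(3)[OF christoffel_tensor2] tensor2D(4)[OF christoffel_tensor2]
lemmas christoffel_smooth = tensor2D(5)[OF christoffel_tensor2]

lemma tensor2_nabla1:
  assumes "tensor1 S \<alpha>"
  shows "tensor2 S (nabla1 g \<alpha>)"
proof -
  have "tensor2 S (\<lambda>x u v. \<alpha> x (christoffel g x u v))"
    unfolding tensor2_def tensor1_def
    using smooth_tensor1_contract[OF open_S assms christoffel_smooth] christoffel_linear
      linear_compose[OF _ tensor1D(1)[OF assms], unfolded o_def] by blast
  then show ?thesis
    unfolding nabla1_def[abs_def] by (intro tensor2_diff open_S tensor2_deriv_at assms)
qed

lemma tensor3_nabla2:
  assumes "tensor2 S h"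
  shows "tensor3 S (nabla2 g h)"
proof -
  have 1: "tensor2 S (\<lambda>x u v. \<alpha> x (christoffel g x u v))" if "tensor1 S \<alpha>"
    for \<alpha> :: "'a \<Rightarrow> 'a \<Rightarrow> real"
    unfolding tensor2_def tensor1_def
    using smooth_tensor1_contract[OF open_S that christoffel_smooth] christoffel_linear
      linear_compose[OF _ tensor1D(1)[OF that], unfolded o_def] by blast
  have a: "linear (\<lambda>v. h x v w)" "linear (h x v)" if "x \<in> S" for x v w
    using tensor2D(3,4)[OF assms that] by auto
  have 2: "tensor2 S (\<lambda>x v w. h x (christoffel g x u v) w)" "tensor2 S (\<lambda>x v w. h x v (christoffel g x u w))" for u
    unfolding tensor2_def tensor1_def
    using smooth_tensor1_contract[OF open_S tensor2D(1)[OF assms] christoffel_smooth]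
      smooth_tensor1_contract[OF open_S tensor2D(2)[OF assms] christoffel_smooth]
      linear_compose[OF christoffel_linear(1) a(1), unfolded o_def]
      linear_compose[OF christoffel_linear(1) a(2), unfolded o_def] a by blast+
  have "tensor3 S (\<lambda>x u v w. h x (christoffel g x u v) w)"
    unfolding tensor3_def using 2 tensor2D(2)[OF 1[OF tensor2D(2)[OF assms]]] by blast
  moreover have "tensor3 S (\<lambda>x u v w. h x v (christoffel g x u w))"
    unfolding tensor3_def using 2 tensor2D(2)[OF 1[OF tensor2D(1)[OF assms]]] by blast
  moreover note tensor3_deriv_at[OF open_S assms]
  ultimately show ?thesis
    unfolding nabla2_def[abs_def] tensor3_def by (auto intro!: tensor1_diff tensor2_diff open_S)
qed

lemma tensor4_nabla3:
  assumes "tensor3 S T"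
  shows "tensor4 S (nabla3 g T)"
proof -
  have nab: "nabla3 g T x u v w z =
      nabla2 g (\<lambda>x. T x v) x u w z - T x (christoffel g x u v) w z" for x u v w z
    by (simp add: nabla3_def nabla2_def)
  have A: "tensor3 S (\<lambda>x u. nabla2 g (\<lambda>x. T x v) x u)" for v
    using tensor3_nabla2[OF tensor3D(1)[OF assms]] .
  have l: "linear (\<lambda>v. T x v w z)" "linear (\<lambda>v. T x w v z)" "linear (\<lambda>v. T x w z v)"  if "x \<in> S" for x w z
    using tensor3D(4-6)[OF assms that] by auto
  have sm: "smooth_map_on S (\<lambda>x. T x (christoffel g x u v) w z)"
    "smooth_map_on S (\<lambda>x. T x v (christoffel g x u w) z)"
    "smooth_map_on S (\<lambda>x. T x v w (christoffel g x u z))" for u v w z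
    using smooth_tensor1_contract[OF open_S tensor2D(2)[OF tensor3D(2)[OF assms]] christoffel_smooth]
      smooth_tensor1_contract[OF open_S tensor2D(2)[OF tensor3D(1)[OF assms]] christoffel_smooth]
      smooth_tensor1_contract[OF open_S tensor2D(1)[OF tensor3D(1)[OF assms]] christoffel_smooth] .
  have D: "tensor4 S (\<lambda>x u v w z. deriv_at (\<lambda>y. T y v w z) x u)"
    by (rule tensor4_deriv_at[OF open_S assms])
  have lin: "linear (\<lambda>u. T x (christoffel g x u v) w z)" "linear (\<lambda>u. T x (christoffel g x v u) w z)"
    "linear (\<lambda>u. T x v (christoffel g x u w) z)" "linear (\<lambda>u. T x v (christoffel g x w u) z)"
    "linear (\<lambda>u. T x v w (christoffel g x u z))" "linear (\<lambda>u. T x v w (christoffel g x z u))"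
    if "x \<in> S" for x v w z
    using linear_compose[OF christoffel_linear(1) l(1), OF that that, unfolded o_def]
      linear_compose[OF christoffel_linear(2) l(1), OF that that, unfolded o_def]
      linear_compose[OF christoffel_linear(1) l(2), OF that that, unfolded o_def]
      linear_compose[OF christoffel_linear(2) l(2), OF that that, unfolded o_def]
      linear_compose[OF christoffel_linear(1) l(3), OF that that, unfolded o_def]
      linear_compose[OF christoffel_linear(2) l(3), OF that that, unfolded o_def] by blast+
  show ?thesis
    unfolding tensor4_def tensor3_def tensor2_def tensor1_def
    unfolding nabla3_def
    by (intro conjI allI ballI linear_compose_sub lin l tensor4D(4-7)[OF D] tensor4D(8)[OF D]
      smooth_map_on_diff open_S sm; assumption)
qed

text \<open>The derivative of the frame contributes nothing, since its covariant derivative is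
  skew-symmetric.\<close>

lemma
  assumes B: "tensor2 S B"
  shows smooth_metric_trace: "smooth_map_on S (\<lambda>y. metric_trace (g y) (B y))"
    and deriv_at_metric_trace: "x \<in> S \<Longrightarrow>
      deriv_at (\<lambda>y. metric_trace (g y) (B y)) x u = metric_trace (g x) (nabla2 g B x u)"
proof -
  have tr: "(\<Sum>b\<in>Basis. B y (frame b y) (frame b y)) = metric_trace (g y) (B y)" if "y \<in> S" for y
    using metric_trace_frame[OF that tensor2_bilinear[OF B that]] by simp
  have sm: "smooth_map_on S (\<lambda>y. \<Sum>b\<in>Basis. B y (frame b y) (frame b y))"
    by (intro smooth_map_on_sum smooth_tensor2_contract[OF open_S B smooth_frame smooth_frame] open_S)
  show "smooth_map_on S (\<lambda>y. metric_trace (g y) (B y))"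
    by (rule smooth_map_on_cong[OF open_S tr sm])
  assume x: "x \<in> S"
  \<comment> \<open>\<open>W b\<close> is the covariant derivative of the frame field
    \<open>frame b\<close> along \<open>u\<close>. Its frame coefficients are skew because the
    products of the frame fields are constant.\<close>
  define W where "W b = deriv_at (frame b) x u + christoffel g x u (frame b x)" for b
  define e where "e b = frame b x" for b
  have e_expand: "v = (\<Sum>b\<in>Basis. g x v (e b) *\<^sub>R e b)" for v
    unfolding e_def by (rule frame_expand[OF x])
  have skew: "g x (W b) (e c) = - g x (W c) (e b)" if "b \<in> Basis" "c \<in> Basis" for b c
  proof -
    have "deriv_at (\<lambda>y. g y (frame b y) (frame c y)) x u = deriv_at (\<lambda>y. if b = c then 1 else 0) x u"
      by (rule fun_cong[OF deriv_at_cong[OF open_S x frame_orthonormal[OF _ that]]],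
          assumption, rule smooth_tensor2_contract[OF open_S tensor2_g smooth_frame smooth_frame, OF that])
    then have "0 = deriv_at (\<lambda>y. g y (e b) (e c)) x u
        + g x (deriv_at (frame b) x u) (e c) + g x (e b) (deriv_at (frame c) x u)"
      unfolding e_def
      using deriv_at_tensor2_contract[OF open_S tensor2_g smooth_frame smooth_frame x, OF that, of u]
      by simp
    also have "\<dots> = g x (W b) (e c) + g x (e b) (W c)"
      using bilinear_ladd[OF bilinear_g[OF x]] bilinear_radd[OF bilinear_g[OF x]]
      by (simp add: W_def e_def metric_compatible[OF x])
    finally show ?thesis using sym_g[OF x, of "e b" "W c"] by simp
  qed
  have linl: "linear (\<lambda>u. B x u w)" and linr: "linear (B x w)" for w
    using tensor2D(3,4)[OF B x] by auto
  have "(\<Sum>b\<in>Basis. B x (e b) (W b)) = (\<Sum>b\<in>Basis. B x (e b) (\<Sum>c\<in>Basis. g x (W b) (e c) *\<^sub>R e c))"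
    by (simp add: e_expand[symmetric])
  also have "\<dots> = (\<Sum>b\<in>Basis. \<Sum>c\<in>Basis. g x (W b) (e c) * B x (e b) (e c))"
    by (simp add: linear_sum[OF linr] linear_cmul[OF linr])
  \<comment> \<open>Skewness exchanges \<open>b\<close> and \<open>c\<close>, so the sums with
    \<open>W\<close> in the left and in the right slot cancel each other without any symmetry of
    \<open>B\<close>.\<close>
  also have "\<dots> = (\<Sum>c\<in>Basis. \<Sum>b\<in>Basis. - (g x (W c) (e b) * B x (e b) (e c)))"
    by (subst sum.swap) (intro sum.cong refl, subst skew, simp_all)
  also have "\<dots> = - (\<Sum>c\<in>Basis. B x (\<Sum>b\<in>Basis. g x (W c) (e b) *\<^sub>R e b) (e c))"
    by (simp add: linear_sum[OF linl] linear_cmul[OF linl] sum_negf)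
  also have "\<dots> = - (\<Sum>c\<in>Basis. B x (W c) (e c))"
    by (simp add: e_expand[symmetric])
  finally have cancel: "(\<Sum>b\<in>Basis. B x (e b) (W b)) + (\<Sum>b\<in>Basis. B x (W b) (e b)) = 0" by simp
  have "deriv_at (\<lambda>y. metric_trace (g y) (B y)) x u
      = deriv_at (\<lambda>y. \<Sum>b\<in>Basis. B y (frame b y) (frame b y)) x u"
    by (simp only: deriv_at_cong[OF open_S x tr sm])
  also have "\<dots> = (\<Sum>b\<in>Basis. deriv_at (\<lambda>y. B y (frame b y) (frame b y)) x u)"
    by (intro deriv_at_sum[OF open_S x] smooth_tensor2_contract[OF open_S B smooth_frame smooth_frame] open_S)
  also have "\<dots> = (\<Sum>b\<in>Basis. nabla2 g B x u (e b) (e b) + (B x (W b) (e b) + B x (e b) (W b)))"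
  proof (intro sum.cong refl)
    fix b :: 'a assume b: "b \<in> Basis"
    show "deriv_at (\<lambda>y. B y (frame b y) (frame b y)) x u
      = nabla2 g B x u (e b) (e b) + (B x (W b) (e b) + B x (e b) (W b))"
      unfolding deriv_at_tensor2_contract[OF open_S B smooth_frame[OF b] smooth_frame[OF b] x]
      by (simp add: nabla2_def W_def e_def linear_add[OF linl] linear_add[OF linr])
  qed
  also have "\<dots> = (\<Sum>b\<in>Basis. nabla2 g B x u (e b) (e b))"
    using cancel by (simp add: sum.distrib)
  also have "\<dots> = metric_trace (g x) (nabla2 g B x u)"
    using metric_trace_frame[OF x tensor2_bilinear[OF tensor3D(1)[OF tensor3_nabla2[OF B]] x]]
    by (simp add: e_def)
  finally show "deriv_at (\<lambda>y. metric_trace (g y) (B y)) x u = metric_trace (g x) (nabla2 g B x u)" .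
qed

end


section \<open>Curvature and commutation of covariant derivatives\<close>

context riemannian_chart
begin

abbreviation \<Gamma> where "\<Gamma> \<equiv> christoffel g"
abbreviation R where "R \<equiv> curvature g"

lemma deriv_at_christoffel_linear:
  assumes "x \<in> S"
  shows "linear (\<lambda>a. deriv_at (\<lambda>y. \<Gamma> y u v) x a)" "linear (\<lambda>u. deriv_at (\<lambda>y. \<Gamma> y u v) x a)"
    "linear (\<lambda>v. deriv_at (\<lambda>y. \<Gamma> y u v) x a)"
  using tensor3D(4-6)[OF tensor3_deriv_at[OF open_S christoffel_tensor2] assms] by auto

lemma deriv_at_christoffel_commute:
  assumes "x \<in> S"
  shows "deriv_at (\<lambda>y. \<Gamma> y u v) x = deriv_at (\<lambda>y. \<Gamma> y v u) x"
  by (rule deriv_at_cong[OF open_S assms christoffel_commute christoffel_smooth])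

lemma smooth_christoffel_christoffel: "smooth_map_on S (\<lambda>x. \<Gamma> x u (\<Gamma> x v w))"
  by (rule smooth_tensor1_contract[OF open_S tensor2D(1)[OF christoffel_tensor2] christoffel_smooth])

lemma deriv_at_christoffel_christoffel:
  assumes "x \<in> S"
  shows "deriv_at (\<lambda>y. \<Gamma> y u (\<Gamma> y v w)) x a =
    deriv_at (\<lambda>y. \<Gamma> y u (\<Gamma> x v w)) x a + \<Gamma> x u (deriv_at (\<lambda>y. \<Gamma> y v w) x a)"
  by (rule deriv_at_tensor1_contract[OF open_S tensor2D(1)[OF christoffel_tensor2] christoffel_smooth assms])

text \<open>The term \<Gamma>(\<Gamma>(u, v), w) of the second covariant derivative is symmetric in
  \<open>u\<close> and \<open>v\<close> and drops out, leaving the classical coordinate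
  formula.\<close>

lemma curvature_eq:
  "R x u v w = deriv_at (\<lambda>y. \<Gamma> y v w) x u - deriv_at (\<lambda>y. \<Gamma> y u w) x v
    + \<Gamma> x u (\<Gamma> x v w) - \<Gamma> x v (\<Gamma> x u w)" if "x \<in> S"
  using christoffel_commute[OF that, of u v]
  by (simp add: curvature_def nabla_sq_vec_def nabla_vec_def)

lemma curvature_skew: "R x u v w = - R x v u w"
  by (simp add: curvature_def)

lemma curvature_smooth: "smooth_map_on S (\<lambda>x. R x u v w)"
  by (rule smooth_map_on_cong[OF open_S curvature_eq[symmetric]], assumption,
      intro smooth_map_on_add smooth_map_on_diff open_S smooth_map_on_deriv_at christoffel_smooth
        smooth_christoffel_christoffel)

lemma curvature_linear:
  assumes "x \<in> S"
  shows "linear (\<lambda>u. R x u v w)" "linear (\<lambda>v. R x u v w)" "linear (R x u v)"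
proof -
  note l = deriv_at_christoffel_linear[OF assms] christoffel_linear[OF assms]
  have 1: "linear (\<lambda>u. \<Gamma> x v (\<Gamma> x u w))" "linear (\<lambda>w. \<Gamma> x v (\<Gamma> x u w))" for u v w
    using linear_compose[OF christoffel_linear(2) christoffel_linear(1), OF assms assms, unfolded o_def]
      linear_compose[OF christoffel_linear(1) christoffel_linear(1), OF assms assms, unfolded o_def]
    by blast+
  show u: "linear (\<lambda>u. R x u v w)" for v
    unfolding curvature_eq[OF assms] by (intro linear_compose_add linear_compose_sub l 1)
  show "linear (R x u v)"
    unfolding curvature_eq[OF assms, abs_def] by (intro linear_compose_add linear_compose_sub l 1)
  show "linear (\<lambda>v. R x u v w)"
    by (subst curvature_skew) (intro linear_compose_neg u)
qed

text \<open>By torsion-freeness the terms of the cyclic sum cancel in pairs.\<close>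

lemma bianchi_first:
  assumes "x \<in> S"
  shows "R x u v w + R x v w u + R x w u v = 0"
  unfolding curvature_eq[OF assms]
  by (simp add: christoffel_commute[OF assms, of w u] christoffel_commute[OF assms, of v u]
      christoffel_commute[OF assms, of w v] deriv_at_christoffel_commute[OF assms, of w u]
      deriv_at_christoffel_commute[OF assms, of v u] deriv_at_christoffel_commute[OF assms, of w v])

lemma deriv_at_nabla1:
  assumes \<alpha>: "tensor1 S \<alpha>" and x: "x \<in> S"
  shows "deriv_at (\<lambda>y. nabla1 g \<alpha> y v w) x u =
    deriv_at (\<lambda>y. deriv_at (\<lambda>z. \<alpha> z w) y v) x u - deriv_at (\<lambda>y. \<alpha> y (\<Gamma> x v w)) x u
    - \<alpha> x (deriv_at (\<lambda>y. \<Gamma> y v w) x u)"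
  unfolding nabla1_def
  by (subst deriv_at_diff[OF open_S x])
     (simp_all add: smooth_map_on_deriv_at tensor1D(2)[OF \<alpha>] smooth_tensor1_contract[OF open_S \<alpha> christoffel_smooth]
       deriv_at_tensor1_contract[OF open_S \<alpha> christoffel_smooth x])

text \<open>Second partial derivatives commute, and what is left of the Christoffel terms assembles
  to the curvature. The sign is that of the dual action on covectors.\<close>

lemma ricci_identity1:
  assumes \<alpha>: "tensor1 S \<alpha>" and x: "x \<in> S"
  shows "nabla2 g (nabla1 g \<alpha>) x u v w - nabla2 g (nabla1 g \<alpha>) x v u w = - \<alpha> x (R x u v w)"
proof -
  note l = linear_add[OF tensor1D(1)[OF \<alpha> x]] linear_diff[OF tensor1D(1)[OF \<alpha> x]]
  have "deriv_at (\<lambda>y. deriv_at (\<lambda>z. \<alpha> z w) y v) x u = deriv_at (\<lambda>y. deriv_at (\<lambda>z. \<alpha> z w) y u) x v"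
    by (rule deriv_at_commute[OF open_S x tensor1D(2)[OF \<alpha>]])
  then show ?thesis
    unfolding nabla2_def deriv_at_nabla1[OF \<alpha> x]
    by (simp add: nabla1_def curvature_eq[OF x] l christoffel_commute[OF x, of v u])
qed

lemma deriv_at_nabla2:
  assumes h: "tensor2 S h" and x: "x \<in> S"
  shows "deriv_at (\<lambda>y. nabla2 g h y v w z) x u =
    deriv_at (\<lambda>y. deriv_at (\<lambda>y'. h y' w z) y v) x u
    - deriv_at (\<lambda>y. h y (\<Gamma> x v w) z) x u - h x (deriv_at (\<lambda>y. \<Gamma> y v w) x u) z
    - deriv_at (\<lambda>y. h y w (\<Gamma> x v z)) x u - h x w (deriv_at (\<lambda>y. \<Gamma> y v z) x u)"
proof -
  note s1 = smooth_tensor1_contract[OF open_S tensor2D(2)[OF h] christoffel_smooth]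
  note s2 = smooth_tensor1_contract[OF open_S tensor2D(1)[OF h] christoffel_smooth]
  note s0 = smooth_map_on_deriv_at[OF tensor2D(5)[OF h]]
  show ?thesis
    unfolding nabla2_def
    by (simp add: deriv_at_diff[OF open_S x smooth_map_on_diff[OF open_S s0 s1] s2] deriv_at_diff[OF open_S x s0 s1]
      deriv_at_tensor1_contract[OF open_S tensor2D(2)[OF h] christoffel_smooth x]
      deriv_at_tensor1_contract[OF open_S tensor2D(1)[OF h] christoffel_smooth x])
qed

lemma ricci_identity2:
  assumes h: "tensor2 S h" and x: "x \<in> S"
  shows "nabla3 g (nabla2 g h) x u v w z - nabla3 g (nabla2 g h) x v u w z =
    - h x (R x u v w) z - h x w (R x u v z)"
proof -
  note l = linear_add[OF tensor2D(3)[OF h x]] linear_diff[OF tensor2D(3)[OF h x]]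
    linear_add[OF tensor2D(4)[OF h x]] linear_diff[OF tensor2D(4)[OF h x]]
  have "deriv_at (\<lambda>y. deriv_at (\<lambda>y'. h y' w z) y v) x u = deriv_at (\<lambda>y. deriv_at (\<lambda>y'. h y' w z) y u) x v"
    by (rule deriv_at_commute[OF open_S x tensor2D(5)[OF h]])
  then show ?thesis
    unfolding nabla3_def deriv_at_nabla2[OF h x]
    by (simp add: nabla2_def curvature_eq[OF x] l christoffel_commute[OF x, of v u])
qed

lemma nabla2_g: "x \<in> S \<Longrightarrow> nabla2 g g x u v w = 0"
  by (simp add: nabla2_def metric_compatible)

text \<open>The Ricci identity for \<open>g\<close> itself, whose covariant derivatives
  vanish.\<close>

lemma curvature_skew_last:
  assumes "x \<in> S"
  shows "g x (R x u v w) z = - g x (R x u v z) w"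
proof -
  have "deriv_at (\<lambda>y. nabla2 g g y v w z) x u = 0" for u v w z
    using deriv_at_cong[OF open_S assms nabla2_g tensor3D(7)[OF tensor3_nabla2[OF tensor2_g]]]
    by (simp add: frechet_derivative_const)
  then have "nabla3 g (nabla2 g g) x u v w z = 0" for u v w z
    by (simp add: nabla3_def nabla2_g[OF assms])
  then show ?thesis
    using ricci_identity2[OF tensor2_g assms, of u v w z] sym_g[OF assms, of w "R x u v z"] by simp
qed

text \<open>Pure algebra: four instances of the first Bianchi identity, combined through
  skew-symmetry in the first and in the last two slots.\<close>

lemma curvature_pair:
  assumes "x \<in> S"
  shows "g x (R x u v w) z = g x (R x w z u) v"
proof -
  define Q where "Q u v w z = g x (R x u v w) z" for u v w z
  have 1: "Q u v w z = - Q v u w z" for u v w z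
    using curvature_skew[of x u v w] bilinear_lneg[OF bilinear_g[OF assms]] by (simp add: Q_def)
  have 2: "Q u v w z = - Q u v z w" for u v w z
    unfolding Q_def by (rule curvature_skew_last[OF assms])
  have 3: "Q u v w z + Q v w u z + Q w u v z = 0" for u v w z
    using arg_cong[OF bianchi_first[OF assms, of u v w], of "\<lambda>t. g x t z"]
    by (simp add: Q_def bilinear_ladd[OF bilinear_g[OF assms]] bilinear_lzero[OF bilinear_g[OF assms]])
  have 4: "Q u v w z + Q v w u z = Q u w v z" for u v w z
    using 3[of u v w z] 1[of w u v z] by linarith
  \<comment> \<open>The instances of 1 and 2 only bring the terms of the four Bianchi relations to
    common orderings of their arguments.\<close>
  have "Q u v w z = Q w z u v"
    using 4[of u v w z] 4[of v u z w] 4[of w z u v] 4[of z w v u]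
      2[of v u z w] 2[of z w v u] 1[of v u w z] 1[of z w u v]
      2[of v w u z] 1[of v w z u] 2[of w v z u] 1[of w z v u]
      1[of u z w v] 2[of u z v w] 2[of u w v z] 1[of u w z v]
      1[of w u z v] 1[of z u v w] 2[of v z w u] 1[of v z u w] 2[of z v u w] 1[of v w u z]
    by linarith
  then show ?thesis by (simp add: Q_def)
qed

text \<open>The curvature is differentiated as a (1,3)-tensor, the direction \<open>a\<close> coming
  first; \<open>nabla2\<close> and \<open>nabla3\<close> act on real-valued fields, so the vector
  value needs its own correction term.\<close>

definition nabla_curvature :: "'a \<Rightarrow> 'a \<Rightarrow> 'a \<Rightarrow> 'a \<Rightarrow> 'a \<Rightarrow> 'a" where
  "nabla_curvature x a u v w = deriv_at (\<lambda>y. R y u v w) x a + \<Gamma> x a (R x u v w)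
    - R x (\<Gamma> x a u) v w - R x u (\<Gamma> x a v) w - R x u v (\<Gamma> x a w)"

lemma deriv_at_curvature:
  assumes x: "x \<in> S"
  shows "deriv_at (\<lambda>y. R y u v w) x a =
    deriv_at (\<lambda>y. deriv_at (\<lambda>z. \<Gamma> z v w) y u) x a - deriv_at (\<lambda>y. deriv_at (\<lambda>z. \<Gamma> z u w) y v) x a
    + (deriv_at (\<lambda>y. \<Gamma> y u (\<Gamma> x v w)) x a + \<Gamma> x u (deriv_at (\<lambda>y. \<Gamma> y v w) x a))
    - (deriv_at (\<lambda>y. \<Gamma> y v (\<Gamma> x u w)) x a + \<Gamma> x v (deriv_at (\<lambda>y. \<Gamma> y u w) x a))"
proof -
  note s = smooth_map_on_deriv_at[OF christoffel_smooth]
  note s2 = smooth_map_on_diff[OF open_S s s]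
  note s3 = smooth_map_on_add[OF open_S s2 smooth_christoffel_christoffel]
  show ?thesis
    unfolding deriv_at_christoffel_christoffel[OF x, symmetric]
      deriv_at_diff[OF open_S x s s, symmetric]
      deriv_at_add[OF open_S x s2 smooth_christoffel_christoffel, symmetric]
      deriv_at_diff[OF open_S x s3 smooth_christoffel_christoffel, symmetric]
    by (rule fun_cong[OF deriv_at_cong[OF open_S x curvature_eq curvature_smooth]])
qed

text \<open>The corrections in the two form slots cancel over the cyclic sum by torsion-freeness and
  skew-symmetry. The rest is a statement about the connection form alone.\<close>

lemma bianchi_second:
  assumes x: "x \<in> S"
  shows "nabla_curvature x a u v w + nabla_curvature x u v a w + nabla_curvature x v a u w = 0"
proof -
  note \<Gamma>l = linear_add[OF christoffel_linear(1)[OF x]] linear_diff[OF christoffel_linear(1)[OF x]]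
  have c: "deriv_at (\<lambda>y. deriv_at (\<lambda>z. \<Gamma> z v w) y u) x a = deriv_at (\<lambda>y. deriv_at (\<lambda>z. \<Gamma> z v w) y a) x u"
    for u v w a
    by (rule deriv_at_commute[OF open_S x christoffel_smooth])
  have 1: "nabla_curvature x a u v w = deriv_at (\<lambda>y. R y u v w) x a + \<Gamma> x a (R x u v w)
      - R x u v (\<Gamma> x a w) - R x (\<Gamma> x a u) v w + R x (\<Gamma> x a v) u w" for a u v w
    using curvature_skew[of x u "\<Gamma> x a v" w] by (simp add: nabla_curvature_def)
  \<comment> \<open>This is dR + [\<Gamma>, R] = 0 for the curvature as a matrix-valued 2-form: the
    second derivatives of \<Gamma> cancel because they commute, the products of \<Gamma> among
    themselves.\<close>
  have 2: "deriv_at (\<lambda>y. R y u v w) x a + \<Gamma> x a (R x u v w) - R x u v (\<Gamma> x a w)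
    + (deriv_at (\<lambda>y. R y v a w) x u + \<Gamma> x u (R x v a w) - R x v a (\<Gamma> x u w))
    + (deriv_at (\<lambda>y. R y a u w) x v + \<Gamma> x v (R x a u w) - R x a u (\<Gamma> x v w)) = 0"
    unfolding deriv_at_curvature[OF x] curvature_eq[OF x]
    by (simp add: \<Gamma>l c[of v w u a] c[of a w v u] c[of u w a v] algebra_simps)
  show ?thesis
    using 2 unfolding 1 christoffel_commute[OF x, of u a] christoffel_commute[OF x, of v a]
      christoffel_commute[OF x, of v u]
    by (simp add: algebra_simps)
qed

lemma riemann_tensor:
  shows "tensor2 S (\<lambda>y e e'. g y (R y e u v) e')" "smooth_map_on S (\<lambda>y. g y (R y u v w) z)"
proof -
  show s: "smooth_map_on S (\<lambda>y. g y (R y u v w) z)" for u v w z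
    by (rule smooth_tensor1_contract[OF open_S tensor2D(2)[OF tensor2_g] curvature_smooth])
  show "tensor2 S (\<lambda>y e e'. g y (R y e u v) e')"
    unfolding tensor2_def tensor1_def
    using s tensor2D(3)[OF tensor2_g] linear_compose[OF curvature_linear(1) tensor2D(4)[OF tensor2_g], unfolded o_def]
    by blast
qed

text \<open>Since \<open>g\<close> is parallel, lowering an index commutes with covariant
  differentiation. Solved for the partial derivative, the formula transfers algebraic symmetries of
  the curvature to its covariant derivative: the correction terms on both sides match by the same
  symmetry.\<close>

lemma deriv_at_riemann:
  assumes x: "x \<in> S"
  shows "deriv_at (\<lambda>y. g y (R y u v w) z) x a = g x (nabla_curvature x a u v w) z
    + g x (R x (\<Gamma> x a u) v w) z + g x (R x u (\<Gamma> x a v) w) z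
    + g x (R x u v (\<Gamma> x a w)) z + g x (R x u v w) (\<Gamma> x a z)"
  unfolding deriv_at_tensor1_contract[OF open_S tensor2D(2)[OF tensor2_g] curvature_smooth x]
    metric_compatible[OF x] nabla_curvature_def
  by (simp add: bilinear_ladd[OF bilinear_g[OF x]] bilinear_lsub[OF bilinear_g[OF x]])

lemma nabla_curvature_skew_last:
  assumes x: "x \<in> S"
  shows "g x (nabla_curvature x a u v w) z = - g x (nabla_curvature x a u v z) w"
proof -
  have "deriv_at (\<lambda>y. g y (R y u v w) z) x a = deriv_at (\<lambda>y. - g y (R y u v z) w) x a"
    by (rule fun_cong[OF deriv_at_cong[OF open_S x curvature_skew_last riemann_tensor(2)]])
  then show ?thesis
    unfolding deriv_at_minus[OF open_S x riemann_tensor(2)] deriv_at_riemann[OF x]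
    using curvature_skew_last[OF x, of "\<Gamma> x a u" v w z] curvature_skew_last[OF x, of u "\<Gamma> x a v" w z]
      curvature_skew_last[OF x, of u v "\<Gamma> x a w" z] curvature_skew_last[OF x, of u v w "\<Gamma> x a z"]
    by simp
qed

lemma nabla_curvature_pair:
  assumes x: "x \<in> S"
  shows "g x (nabla_curvature x a u v w) z = g x (nabla_curvature x a w z u) v"
proof -
  have "deriv_at (\<lambda>y. g y (R y u v w) z) x a = deriv_at (\<lambda>y. g y (R y w z u) v) x a"
    by (rule fun_cong[OF deriv_at_cong[OF open_S x curvature_pair riemann_tensor(2)]])
  then show ?thesis
    unfolding deriv_at_riemann[OF x]
    using curvature_pair[OF x, of "\<Gamma> x a u" v w z] curvature_pair[OF x, of u "\<Gamma> x a v" w z]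
      curvature_pair[OF x, of u v "\<Gamma> x a w" z] curvature_pair[OF x, of u v w "\<Gamma> x a z"]
    by simp
qed

lemma nabla_curvature_skew: "x \<in> S \<Longrightarrow> nabla_curvature x a u v w = - nabla_curvature x a v u w"
proof -
  assume x: "x \<in> S"
  have "deriv_at (\<lambda>y. R y u v w) x a = deriv_at (\<lambda>y. - R y v u w) x a"
    by (subst curvature_skew) simp
  then show ?thesis
    unfolding deriv_at_minus[OF open_S x curvature_smooth] nabla_curvature_def
    using curvature_skew[of x u v w] curvature_skew[of x "\<Gamma> x a u" v w]
      curvature_skew[of x u "\<Gamma> x a v" w] curvature_skew[of x u v "\<Gamma> x a w"]
    by (simp add: linear_neg[OF christoffel_linear(1)[OF x]])
qed

section \<open>The operators in the smooth frame and their linearity\<close>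

lemma curvature_action_frame:
  assumes h: "tensor2 S h" and x: "x \<in> S"
  shows "curvature_action g h x u v = (\<Sum>b\<in>Basis. h x (R x (frame b x) u v) (frame b x))"
proof -
  have "bilinear (\<lambda>e e'. h x (R x e u v) e')"
    using linear_compose[OF curvature_linear(1)[OF x] tensor2D(4)[OF h x], unfolded o_def]
      tensor2D(3)[OF h x] by (simp add: bilinear_def)
  then show ?thesis
    unfolding curvature_action_def by (rule metric_trace_frame[OF x])
qed

lemma nabla_adjoint_frame:
  assumes T: "tensor3 S T" and x: "x \<in> S"
  shows "nabla_adjoint g T x v w = - (\<Sum>b\<in>Basis. nabla3 g T x (frame b x) (frame b x) v w)"
proof -
  have "bilinear (\<lambda>e e'. nabla3 g T x e e' v w)"
    using tensor4D(4,5)[OF tensor4_nabla3[OF T] x] by (simp add: bilinear_def)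
  then show ?thesis
    unfolding nabla_adjoint_def by (simp add: metric_trace_frame[OF x])
qed

lemma divergence_frame:
  assumes h: "tensor2 S h" and x: "x \<in> S"
  shows "divergence g h x v = - (\<Sum>b\<in>Basis. nabla2 g h x (frame b x) (frame b x) v)"
proof -
  have "bilinear (\<lambda>e e'. nabla2 g h x e e' v)"
    using tensor3D(4,5)[OF tensor3_nabla2[OF h] x] by (simp add: bilinear_def)
  then show ?thesis
    unfolding divergence_def by (simp add: metric_trace_frame[OF x])
qed

lemma ricci_frame:
  assumes x: "x \<in> S"
  shows "ricci g x u v = (\<Sum>b\<in>Basis. g x (R x (frame b x) u v) (frame b x))"
  unfolding ricci_def by (rule metric_trace_frame[OF x tensor2_bilinear[OF riemann_tensor(1) x]])

lemma hessian_tensor2: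
  assumes "smooth_map_on S f"
  shows "tensor2 S (hessian g f)"
  unfolding hessian_def by (rule tensor2_nabla1[OF tensor1_deriv_at[OF open_S assms]])

lemma hessian_commute:
  assumes f: "smooth_map_on S (f :: 'a \<Rightarrow> real)" and x: "x \<in> S"
  shows "hessian g f x u v = hessian g f x v u"
  using deriv_at_commute[OF open_S x f, of u v] christoffel_commute[OF x, of u v]
  by (simp add: hessian_def nabla1_def)

lemma laplacian_frame:
  assumes f: "smooth_map_on S f" and x: "x \<in> S"
  shows "laplacian g f x = - (\<Sum>b\<in>Basis. hessian g f x (frame b x) (frame b x))"
  unfolding laplacian_def
  by (simp add: metric_trace_frame[OF x tensor2_bilinear[OF hessian_tensor2[OF f] x]])

lemma hessian_cmult:
  assumes f: "smooth_map_on S f" and x: "x \<in> S"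
  shows "hessian g (\<lambda>x. c * f x) x u v = c * hessian g f x u v"
proof -
  have sm: "smooth_map_on S (\<lambda>x. c * f x)"
    by (intro smooth_map_on_mult smooth_map_on_const open_S f)
  have "deriv_at (\<lambda>y. deriv_at (\<lambda>x. c * f x) y v) x u = deriv_at (\<lambda>y. c * deriv_at f y v) x u"
    by (rule fun_cong[OF deriv_at_cong[OF open_S x deriv_at_cmult[OF open_S _ f] smooth_map_on_deriv_at[OF sm]]])
  then show ?thesis
    unfolding hessian_def nabla1_def deriv_at_cmult[OF open_S x f]
      deriv_at_cmult[OF open_S x smooth_map_on_deriv_at[OF f]]
    by (simp add: algebra_simps)
qed

lemma laplacian_cmult:
  assumes f: "smooth_map_on S f" and x: "x \<in> S"
  shows "laplacian g (\<lambda>x. c * f x) x = c * laplacian g f x"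
proof -
  have sm: "smooth_map_on S (\<lambda>x. c * f x)"
    by (intro smooth_map_on_mult smooth_map_on_const open_S f)
  show ?thesis
    unfolding laplacian_frame[OF sm x] laplacian_frame[OF f x]
    by (simp add: hessian_cmult[OF f x] sum_distrib_left)
qed

lemma nabla2_add:
  assumes "tensor2 S h" "tensor2 S k" "x \<in> S"
  shows "nabla2 g (\<lambda>x u v. h x u v + k x u v) x u v w = nabla2 g h x u v w + nabla2 g k x u v w"
  by (simp add: nabla2_def deriv_at_add[OF open_S assms(3) tensor2D(5)[OF assms(1)] tensor2D(5)[OF assms(2)]])

text \<open>Formulas for a first covariant derivative hold at points of \<open>S\<close> only;
  openness of \<open>S\<close> allows them to be substituted under a second one.\<close>

lemma nabla3_cong:
  assumes "tensor3 S T" "\<And>y u v w. y \<in> S \<Longrightarrow> T y u v w = T' y u v w" "x \<in> S"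
  shows "nabla3 g T x u v w z = nabla3 g T' x u v w z"
  using deriv_at_cong[OF open_S assms(3) assms(2) tensor3D(7)[OF assms(1)]] assms(2,3)
  by (simp add: nabla3_def)

lemma nabla3_add:
  assumes "tensor3 S T" "tensor3 S T'" "x \<in> S"
  shows "nabla3 g (\<lambda>x u v w. T x u v w + T' x u v w) x u v w z = nabla3 g T x u v w z + nabla3 g T' x u v w z"
  by (simp add: nabla3_def deriv_at_add[OF open_S assms(3) tensor3D(7)[OF assms(1)] tensor3D(7)[OF assms(2)]])

lemma einstein_operator_add:
  assumes h: "tensor2 S h" and k: "tensor2 S k" and x: "x \<in> S"
  shows "einstein_operator g (\<lambda>x u v. h x u v + k x u v) x u v =
    einstein_operator g h x u v + einstein_operator g k x u v"
proof -
  have hk: "tensor2 S (\<lambda>x u v. h x u v + k x u v)" by (intro tensor2_add open_S h k)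
  have "nabla3 g (nabla2 g (\<lambda>x u v. h x u v + k x u v)) x a b c d =
      nabla3 g (nabla2 g h) x a b c d + nabla3 g (nabla2 g k) x a b c d" for a b c d
    unfolding nabla3_add[OF tensor3_nabla2[OF h] tensor3_nabla2[OF k] x, symmetric]
    by (rule nabla3_cong[OF tensor3_nabla2[OF hk] nabla2_add[OF h k] x])
  then show ?thesis
    by (simp add: einstein_operator_def nabla_adjoint_frame[OF tensor3_nabla2 x] h k hk
        curvature_action_frame[OF _ x] sum.distrib algebra_simps)
qed

lemma tensor2_scaled_metric: "smooth_map_on S \<phi> \<Longrightarrow> tensor2 S (\<lambda>x u v. \<phi> x * g x u v)"
  using tensor2_scaleR[OF open_S _ tensor2_g] by simp

text \<open>The metric is parallel, so the derivative falls on the factor alone.\<close>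

lemma nabla2_scaled_metric:
  assumes \<phi>: "smooth_map_on S \<phi>" and x: "x \<in> S"
  shows "nabla2 g (\<lambda>x u v. \<phi> x * g x u v) x u v w = deriv_at \<phi> x u * g x v w"
  by (simp add: nabla2_def deriv_at_mult[OF open_S x \<phi> smooth_g] metric_compatible[OF x] algebra_simps)

lemma nabla3_scaled_metric:
  assumes \<alpha>: "tensor1 S \<alpha>" and x: "x \<in> S"
  shows "nabla3 g (\<lambda>x u v w. \<alpha> x u * g x v w) x a u v w = nabla1 g \<alpha> x a u * g x v w"
  by (simp add: nabla3_def nabla1_def deriv_at_mult[OF open_S x tensor1D(2)[OF \<alpha>] smooth_g]
      metric_compatible[OF x] algebra_simps)

lemma nabla3_nabla2_scaled_metric:
  assumes \<phi>: "smooth_map_on S \<phi>" and x: "x \<in> S"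
  shows "nabla3 g (nabla2 g (\<lambda>x u v. \<phi> x * g x u v)) x a u v w = hessian g \<phi> x a u * g x v w"
  unfolding hessian_def nabla3_scaled_metric[OF tensor1_deriv_at[OF open_S \<phi>] x, symmetric]
  by (rule nabla3_cong[OF tensor3_nabla2[OF tensor2_scaled_metric[OF \<phi>]] nabla2_scaled_metric[OF \<phi>] x])

end


section \<open>Hessians of eigenfunctions on Einstein manifolds\<close>

locale einstein_chart = riemannian_chart +
  fixes \<mu> :: real
  assumes einstein: "x \<in> S \<Longrightarrow> ricci g x u v = \<mu> * g x u v"
begin

lemma ricci_sum:
  assumes "x \<in> S"
  shows "(\<Sum>b\<in>Basis. g x (R x (frame b x) u v) (frame b x)) = \<mu> * g x u v"
  using einstein[OF assms] ricci_frame[OF assms] by simp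

text \<open>The Einstein condition with an index raised. The sign arises when skew-symmetry in the
  last pair moves the frame vector into the slot that \<open>ricci\<close> traces.\<close>

lemma ricci_vector:
  assumes x: "x \<in> S"
  shows "(\<Sum>b\<in>Basis. R x (frame b x) w (frame b x)) = - \<mu> *\<^sub>R w"
proof (rule nondegenerate[OF x])
  fix z
  have lin: "linear (\<lambda>u. g x u z)"
    using tensor2D(4)[OF tensor2_g x] .
  have "g x (\<Sum>b\<in>Basis. R x (frame b x) w (frame b x)) z
      = - (\<Sum>b\<in>Basis. g x (R x (frame b x) w z) (frame b x))"
    unfolding linear_sum[OF lin] sum_negf[symmetric]
    by (intro sum.cong refl curvature_skew_last[OF x])
  then show "g x (\<Sum>b\<in>Basis. R x (frame b x) w (frame b x)) z = g x (- \<mu> *\<^sub>R w) z"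
    by (simp add: ricci_sum[OF x] linear_neg[OF lin] linear_cmul[OF lin])
qed

text \<open>The Ricci tensor equals \<mu> g and is therefore parallel; the trace may be taken before
  or after differentiating.\<close>

lemma nabla_ricci_zero:
  assumes x: "x \<in> S"
  shows "(\<Sum>b\<in>Basis. g x (nabla_curvature x a (frame b x) u v) (frame b x)) = 0"
proof -
  define B where "B y e e' = g y (R y e u v) e'" for y e e'
  have B: "tensor2 S B"
    unfolding B_def[abs_def] by (rule riemann_tensor(1))
  have "metric_trace (g y) (B y) = \<mu> * g y u v" if "y \<in> S" for y
    using einstein[OF that, of u v] by (simp add: ricci_def B_def[abs_def])
  then have "deriv_at (\<lambda>y. metric_trace (g y) (B y)) x a = deriv_at (\<lambda>y. \<mu> * g y u v) x a"
    by (intro fun_cong[OF deriv_at_cong[OF open_S x _ smooth_metric_trace[OF B]]])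
  also have "\<dots> = \<mu> * deriv_at (\<lambda>y. g y u v) x a"
    by (rule deriv_at_cmult[OF open_S x smooth_g])
  also have "\<dots> = \<mu> * g x (\<Gamma> x a u) v + \<mu> * g x u (\<Gamma> x a v)"
    by (simp add: metric_compatible[OF x] algebra_simps)
  finally have "(\<Sum>b\<in>Basis. nabla2 g B x a (frame b x) (frame b x)) = \<mu> * g x (\<Gamma> x a u) v + \<mu> * g x u (\<Gamma> x a v)"
    unfolding deriv_at_metric_trace[OF B x]
    by (simp add: metric_trace_frame[OF x tensor2_bilinear[OF tensor3D(1)[OF tensor3_nabla2[OF B]] x]])
  \<comment> \<open>\<open>B\<close> has only its two traced slots corrected. The missing
    corrections for \<open>u\<close> and \<open>v\<close> are Ricci terms and match those from
    differentiating \<mu> g(u, v).\<close>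
  moreover have "nabla2 g B x a e e = g x (nabla_curvature x a e u v) e + g x (R x e (\<Gamma> x a u) v) e
      + g x (R x e u (\<Gamma> x a v)) e" for e
    unfolding nabla2_def by (simp add: B_def deriv_at_riemann[OF x])
  ultimately show ?thesis by (simp add: sum.distrib ricci_sum[OF x])
qed

lemma nabla_ricci_vector_zero:
  assumes x: "x \<in> S"
  shows "(\<Sum>b\<in>Basis. nabla_curvature x a (frame b x) w (frame b x)) = 0"
proof (rule nondegenerate[OF x])
  fix z
  have lin: "linear (\<lambda>u. g x u z)"
    using tensor2D(4)[OF tensor2_g x] .
  have "g x (\<Sum>b\<in>Basis. nabla_curvature x a (frame b x) w (frame b x)) z
      = - (\<Sum>b\<in>Basis. g x (nabla_curvature x a (frame b x) w z) (frame b x))"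
    unfolding linear_sum[OF lin] sum_negf[symmetric]
    by (intro sum.cong refl nabla_curvature_skew_last[OF x])
  then show "g x (\<Sum>b\<in>Basis. nabla_curvature x a (frame b x) w (frame b x)) z = g x 0 z"
    by (simp add: nabla_ricci_zero[OF x] linear_0[OF lin])
qed

text \<open>The contracted second Bianchi identity expresses the divergence of the curvature by an
  antisymmetrised derivative of the Ricci tensor, which vanishes here. Pair symmetry first moves the
  derivative direction to where the cyclic identity can act on it.\<close>

lemma divergence_curvature_zero:
  assumes x: "x \<in> S"
  shows "(\<Sum>b\<in>Basis. nabla_curvature x (frame b x) (frame b x) w z) = 0"
proof (rule nondegenerate[OF x])
  fix y
  let ?e = "\<lambda>b. frame b x"
  have lin: "linear (\<lambda>u. g x u v)" for v
    using tensor2D(4)[OF tensor2_g x] .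
  have "g x (nabla_curvature x e e w z) y =
      g x (nabla_curvature x z e y e) w - g x (nabla_curvature x y e z e) w" for e
  proof -
    have "g x (nabla_curvature x e e w z) y = g x (nabla_curvature x e z y e) w"
      by (rule nabla_curvature_pair[OF x])
    also have "nabla_curvature x e z y e = nabla_curvature x z e y e - nabla_curvature x y e z e"
      using bianchi_second[OF x, of e z y e] nabla_curvature_skew[OF x, of z y e e]
      by (simp add: algebra_simps eq_neg_iff_add_eq_0)
    finally show ?thesis by (simp add: linear_diff[OF lin])
  qed
  then have "g x (\<Sum>b\<in>Basis. nabla_curvature x (?e b) (?e b) w z) y
      = g x (\<Sum>b\<in>Basis. nabla_curvature x z (?e b) y (?e b)) w
        - g x (\<Sum>b\<in>Basis. nabla_curvature x y (?e b) z (?e b)) w"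
    by (simp add: linear_sum[OF lin] sum_subtractf)
  then show "g x (\<Sum>b\<in>Basis. nabla_curvature x (?e b) (?e b) w z) y = g x 0 y"
    by (simp add: nabla_ricci_vector_zero[OF x] linear_0[OF lin])
qed

text \<open>The rough Laplacian passes to \<phi> because \<open>g\<close> is parallel, and the
  curvature action on \<open>g\<close> is the Ricci tensor.\<close>

lemma einstein_operator_scaled_metric:
  assumes \<phi>: "smooth_map_on S \<phi>" and x: "x \<in> S"
  shows "einstein_operator g (\<lambda>x u v. \<phi> x * g x u v) x u v = (laplacian g \<phi> x - 2 * \<mu> * \<phi> x) * g x u v"
proof -
  note t = tensor2_scaled_metric[OF \<phi>]
  show ?thesis
    unfolding einstein_operator_def nabla_adjoint_frame[OF tensor3_nabla2[OF t] x]
      curvature_action_frame[OF t x] nabla3_nabla2_scaled_metric[OF \<phi> x] laplacian_frame[OF \<phi> x]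
    by (simp add: sum_distrib_left[symmetric] sum_distrib_right[symmetric] ricci_sum[OF x] algebra_simps)
qed

section \<open>Third and fourth covariant derivatives of an eigenfunction\<close>

context
  fixes f :: "'a \<Rightarrow> real" and l :: real
  assumes f: "smooth_map_on S f"
    and eigen: "\<And>x. x \<in> S \<Longrightarrow> laplacian g f x = l * f x"
begin

abbreviation H where "H \<equiv> hessian g f"

lemma tensor1_df: "tensor1 S (deriv_at f)"
  by (rule tensor1_deriv_at[OF open_S f])

lemma tensor2_H: "tensor2 S H"
  by (rule hessian_tensor2[OF f])

text \<open>The Ricci identity for the covector field df.\<close>

lemma nabla2_hessian_swap:
  assumes "x \<in> S"
  shows "nabla2 g H x u v w = nabla2 g H x v u w - deriv_at f x (R x u v w)"
  using ricci_identity1[OF tensor1_df assms, of u v w] by (simp add: hessian_def)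

lemma nabla2_hessian_commute:
  assumes "x \<in> S"
  shows "nabla2 g H x u v w = nabla2 g H x u w v"
  using deriv_at_cong[OF open_S assms hessian_commute[OF f] tensor2D(5)[OF tensor2_H], of v w]
    hessian_commute[OF f assms]
  by (simp add: nabla2_def)

lemma nabla3_hessian_commute:
  assumes "x \<in> S"
  shows "nabla3 g (nabla2 g H) x a u v w = nabla3 g (nabla2 g H) x a u w v"
  using deriv_at_cong[OF open_S assms nabla2_hessian_commute tensor3D(7)[OF tensor3_nabla2[OF tensor2_H]], of u v w]
    nabla2_hessian_commute[OF assms]
  by (simp add: nabla3_def)

text \<open>The covariant derivative of the preceding exchange rule: the product rule splits its
  curvature term into one with the Hessian and one with the derivative of the curvature.\<close>

lemma nabla3_hessian_swap:
  assumes x: "x \<in> S"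
  shows "nabla3 g (nabla2 g H) x a u v w = nabla3 g (nabla2 g H) x a v u w
    - H x a (R x u v w) - deriv_at f x (nabla_curvature x a u v w)"
proof -
  note T = tensor3D(7)[OF tensor3_nabla2[OF tensor2_H]]
  note s = smooth_tensor1_contract[OF open_S tensor1_df curvature_smooth]
  note l = linear_add[OF tensor1D(1)[OF tensor1_df x]] linear_diff[OF tensor1D(1)[OF tensor1_df x]]
  have "deriv_at (\<lambda>y. nabla2 g H y u v w) x a =
      deriv_at (\<lambda>y. nabla2 g H y v u w - deriv_at f y (R y u v w)) x a"
    by (rule fun_cong[OF deriv_at_cong[OF open_S x nabla2_hessian_swap T]])
  also have "\<dots> = deriv_at (\<lambda>y. nabla2 g H y v u w) x a
      - (deriv_at (\<lambda>y. deriv_at f y (R x u v w)) x a + deriv_at f x (deriv_at (\<lambda>y. R y u v w) x a))"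
    by (simp add: deriv_at_diff[OF open_S x T s]
        deriv_at_tensor1_contract[OF open_S tensor1_df curvature_smooth x])
  finally have *: "deriv_at (\<lambda>y. nabla2 g H y u v w) x a = deriv_at (\<lambda>y. nabla2 g H y v u w) x a
      - deriv_at (\<lambda>y. deriv_at f y (R x u v w)) x a - deriv_at f x (deriv_at (\<lambda>y. R y u v w) x a)"
    by simp
  have H: "H x a (R x u v w) = deriv_at (\<lambda>y. deriv_at f y (R x u v w)) x a - deriv_at f x (\<Gamma> x a (R x u v w))"
    by (simp add: hessian_def nabla1_def)
  show ?thesis
    unfolding nabla3_def * H nabla_curvature_def
    using nabla2_hessian_swap[OF x, of "\<Gamma> x a u" v w] nabla2_hessian_swap[OF x, of u "\<Gamma> x a v" w]
      nabla2_hessian_swap[OF x, of u v "\<Gamma> x a w"]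
    by (simp add: l)
qed

lemma trace_hessian:
  assumes "x \<in> S"
  shows "metric_trace (g x) (H x) = - l * f x"
  using eigen[OF assms] by (simp add: laplacian_def)

lemma trace_nabla2_hessian:
  assumes x: "x \<in> S"
  shows "metric_trace (g x) (nabla2 g H x u) = - l * deriv_at f x u"
proof -
  have "deriv_at (\<lambda>y. metric_trace (g y) (H y)) x u = deriv_at (\<lambda>y. - l * f y) x u"
    by (rule fun_cong[OF deriv_at_cong[OF open_S x trace_hessian smooth_metric_trace[OF tensor2_H]]])
  also have "\<dots> = - l * deriv_at f x u"
    by (rule deriv_at_cmult[OF open_S x f])
  finally show ?thesis
    unfolding deriv_at_metric_trace[OF tensor2_H x] .
qed

text \<open>The trace commutes with both derivatives, so the Hessian of the function - l f appears.
  Freezing \<open>z\<close> reduces this to the rule for \<open>nabla2\<close>; the correction in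
  that slot is the difference of the two operators.\<close>

lemma trace_nabla3_hessian:
  assumes x: "x \<in> S"
  shows "(\<Sum>b\<in>Basis. nabla3 g (nabla2 g H) x w z (frame b x) (frame b x)) = - l * H x w z"
proof -
  note T = tensor3_nabla2[OF tensor2_H]
  note Tz = tensor3D(1)[OF T]
  have sum: "(\<Sum>b\<in>Basis. nabla2 g H x u (frame b x) (frame b x)) = - l * deriv_at f x u" for u
    using trace_nabla2_hessian[OF x] metric_trace_frame[OF x tensor2_bilinear[OF Tz x]] by simp
  have "deriv_at (\<lambda>y. metric_trace (g y) (nabla2 g H y z)) x w = deriv_at (\<lambda>y. - l * deriv_at f y z) x w"
    by (rule fun_cong[OF deriv_at_cong[OF open_S x trace_nabla2_hessian smooth_metric_trace[OF Tz]]])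
  also have "\<dots> = - l * deriv_at (\<lambda>y. deriv_at f y z) x w"
    by (rule deriv_at_cmult[OF open_S x smooth_map_on_deriv_at[OF f]])
  finally have "(\<Sum>b\<in>Basis. nabla2 g (\<lambda>y. nabla2 g H y z) x w (frame b x) (frame b x))
      = - l * deriv_at (\<lambda>y. deriv_at f y z) x w"
    unfolding deriv_at_metric_trace[OF Tz x]
    using metric_trace_frame[OF x tensor2_bilinear[OF tensor3D(1)[OF tensor3_nabla2[OF Tz]] x]] by simp
  moreover have "nabla3 g (nabla2 g H) x w z e e = nabla2 g (\<lambda>y. nabla2 g H y z) x w e e
      - nabla2 g H x (\<Gamma> x w z) e e" for e
    by (simp add: nabla3_def nabla2_def[where h = "\<lambda>y. nabla2 g H y z"])
  moreover have "H x w z = deriv_at (\<lambda>y. deriv_at f y z) x w - deriv_at f x (\<Gamma> x w z)"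
    by (simp add: hessian_def nabla1_def)
  ultimately show ?thesis
    by (simp add: sum_subtractf sum right_diff_distrib)
qed

text \<open>Moving the two contracted derivatives past the Hessian produces Ricci terms, which account for
  \<open>- 2\<mu>\<close>, and traces of derivatives of the curvature, which vanish by the Einstein condition.\<close>

lemma einstein_operator_hessian:
  assumes x: "x \<in> S"
  shows "einstein_operator g H x w z = (l - 2 * \<mu>) * H x w z"
proof -
  let ?e = "\<lambda>b. frame b x"
  let ?F = "nabla3 g (nabla2 g H) x"
  note H2 = tensor2_H
  note df = tensor1D(1)[OF tensor1_df x]
  note Hl = tensor2D(4)[OF H2 x] and Hr = tensor2D(3)[OF H2 x]
  \<comment> \<open>Four exchanges turn the index order e e w z into w z e e: second with third,
    first with second, third with fourth, second with third. All cost curvature terms except the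
    third, which is the symmetry of the Hessian.\<close>
  have step: "?F e e w z = ?F w z e e - 2 * H x (R x e w z) e - H x (R x e w e) z - H x w (R x e z e)
      - deriv_at f x (nabla_curvature x e e w z) - deriv_at f x (nabla_curvature x w e z e)" for e
    using nabla3_hessian_swap[OF x, of e e w z] ricci_identity2[OF H2 x, of e w e z]
      nabla3_hessian_commute[OF x, of w e e z] nabla3_hessian_swap[OF x, of w e z e]
      hessian_commute[OF f x, of e "R x e w z"]
    by simp
  have "(\<Sum>b\<in>Basis. ?F (?e b) (?e b) w z) = (\<Sum>b\<in>Basis. ?F w z (?e b) (?e b))
      - 2 * (\<Sum>b\<in>Basis. H x (R x (?e b) w z) (?e b))
      - H x (\<Sum>b\<in>Basis. R x (?e b) w (?e b)) z - H x w (\<Sum>b\<in>Basis. R x (?e b) z (?e b))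
      - deriv_at f x (\<Sum>b\<in>Basis. nabla_curvature x (?e b) (?e b) w z)
      - deriv_at f x (\<Sum>b\<in>Basis. nabla_curvature x w (?e b) z (?e b))"
    unfolding step linear_sum[OF df] linear_sum[OF Hl] linear_sum[OF Hr] sum_distrib_left
    by (simp add: sum_subtractf)
  also have "\<dots> = - l * H x w z - 2 * (\<Sum>b\<in>Basis. H x (R x (?e b) w z) (?e b)) + 2 * \<mu> * H x w z"
    unfolding ricci_vector[OF x] divergence_curvature_zero[OF x] nabla_ricci_vector_zero[OF x]
      trace_nabla3_hessian[OF x]
    by (simp add: linear_neg[OF Hl] linear_neg[OF Hr] linear_cmul[OF Hl] linear_cmul[OF Hr] linear_0[OF df])
  finally show ?thesis
    unfolding einstein_operator_def nabla_adjoint_frame[OF tensor3_nabla2[OF H2] x] curvature_action_frame[OF H2 x]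
    by (simp add: algebra_simps)
qed

text \<open>Moving the traced derivative past \<open>v\<close> costs a Ricci term, here a multiple
  \<mu> of df. What remains is the derivative of the trace of the Hessian.\<close>

lemma divergence_hessian:
  assumes x: "x \<in> S"
  shows "divergence g H x v = (l - \<mu>) * deriv_at f x v"
proof -
  let ?e = "\<lambda>b. frame b x"
  note df = tensor1D(1)[OF tensor1_df x]
  have "nabla2 g H x e e v = nabla2 g H x v e e - deriv_at f x (R x e v e)" for e
    using nabla2_hessian_commute[OF x, of e e v] nabla2_hessian_swap[OF x, of e v e] by simp
  then have "(\<Sum>b\<in>Basis. nabla2 g H x (?e b) (?e b) v) =
      (\<Sum>b\<in>Basis. nabla2 g H x v (?e b) (?e b)) - deriv_at f x (\<Sum>b\<in>Basis. R x (?e b) v (?e b))"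
    by (simp add: linear_sum[OF df] sum_subtractf)
  also have "\<dots> = - l * deriv_at f x v + \<mu> * deriv_at f x v"
    using trace_nabla2_hessian[OF x, of v]
      metric_trace_frame[OF x tensor2_bilinear[OF tensor3D(1)[OF tensor3_nabla2[OF tensor2_H]] x]]
    by (simp add: ricci_vector[OF x] linear_neg[OF df] linear_cmul[OF df])
  finally show ?thesis
    unfolding divergence_frame[OF tensor2_H x] by (simp add: algebra_simps)
qed

end

text \<open>The part of the deformation carried by the first factor. Its trace n \<mu> f - 2 \<mu> f
  is left over for the second factor to cancel.\<close>

lemma
  assumes f: "smooth_map_on S f" and eigen: "\<And>x. x \<in> S \<Longrightarrow> laplacian g f x = 2 * \<mu> * f x"
  defines "A \<equiv> \<lambda>x u v. \<mu> * f x * g x u v + hessian g f x u v"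
  shows conformal_hessian_tensor2: "tensor2 S A"
    and trace_conformal_hessian: "x \<in> S \<Longrightarrow> metric_trace (g x) (A x) = (real DIM('a) - 2) * \<mu> * f x"
    and divergence_conformal_hessian: "x \<in> S \<Longrightarrow> divergence g A x v = 0"
    and einstein_operator_conformal_hessian: "x \<in> S \<Longrightarrow> einstein_operator g A x u v = 0"
proof -
  have sm: "smooth_map_on S (\<lambda>x. \<mu> * f x)"
    by (intro smooth_map_on_mult smooth_map_on_const open_S f)
  note H2 = hessian_tensor2[OF f]
  note g2 = tensor2_scaled_metric[OF sm]
  show A2: "tensor2 S A"
    unfolding A_def by (intro tensor2_add open_S g2 H2)
  assume x: "x \<in> S"
  have tr: "metric_trace (g x) (A x) = \<mu> * f x * DIM('a) + metric_trace (g x) (hessian g f x)"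
    unfolding A_def metric_trace_add[OF x tensor2_bilinear[OF g2 x] tensor2_bilinear[OF H2 x]]
      metric_trace_cmult[OF x bilinear_g[OF x]] metric_trace_g[OF x] by simp
  show "metric_trace (g x) (A x) = (real DIM('a) - 2) * \<mu> * f x"
    unfolding tr using trace_hessian[OF f eigen x] by (simp add: algebra_simps)
  have df: "deriv_at (\<lambda>x. \<mu> * f x) x u = \<mu> * deriv_at f x u" for u
    by (rule deriv_at_cmult[OF open_S x f])
  have dl: "linear (deriv_at f x)"
    by (rule linear_deriv_at[OF f open_S x])
  have "deriv_at f x v = deriv_at f x (\<Sum>b\<in>Basis. g x v (frame b x) *\<^sub>R frame b x)"
    by (simp add: frame_expand[OF x, symmetric])
  also have "\<dots> = (\<Sum>b\<in>Basis. deriv_at f x (frame b x) * g x (frame b x) v)"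
    by (simp add: linear_sum[OF dl] linear_cmul[OF dl] sym_g[OF x, of v] mult.commute)
  finally have dfv: "(\<Sum>b\<in>Basis. deriv_at f x (frame b x) * g x (frame b x) v) = deriv_at f x v"
    by simp
  \<comment> \<open>The conformal part gives - \<mu> df, and the Hessian (2 \<mu> - \<mu>)
    df.\<close>
  have "divergence g A x v = - \<mu> * deriv_at f x v + divergence g (hessian g f) x v"
    unfolding divergence_frame[OF A2 x] divergence_frame[OF H2 x]
    unfolding A_def nabla2_add[OF g2 H2 x] nabla2_scaled_metric[OF sm x]
    by (simp add: df sum.distrib dfv mult.assoc sum_distrib_left[symmetric])
  then show "divergence g A x v = 0"
    by (simp add: divergence_hessian[OF f eigen x])
  have "laplacian g (\<lambda>x. \<mu> * f x) x = \<mu> * laplacian g f x"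
    by (rule laplacian_cmult[OF f x])
  moreover have "einstein_operator g (hessian g f) x u v = 0"
    using einstein_operator_hessian[OF f eigen x, of u v] by simp
  ultimately show "einstein_operator g A x u v = 0"
    unfolding A_def einstein_operator_add[OF g2 H2 x] einstein_operator_scaled_metric[OF sm x] eigen[OF x]
    by simp
qed

end


section \<open>Products\<close>

lemma
  fixes S :: "'a::euclidean_space set" and T :: "'b::euclidean_space set"
  assumes S: "open S" and T: "open T"
  shows smooth_map_on_fst: "smooth_map_on S F \<Longrightarrow> smooth_map_on (S \<times> T) (\<lambda>p. F (fst p))"
    and smooth_map_on_snd: "smooth_map_on T F' \<Longrightarrow> smooth_map_on (S \<times> T) (\<lambda>p. F' (snd p))"
    and deriv_at_fst: "smooth_map_on S F \<Longrightarrow> p \<in> S \<times> T \<Longrightarrow>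
      deriv_at (\<lambda>p. F (fst p)) p u = deriv_at F (fst p) (fst u)"
    and deriv_at_snd: "smooth_map_on T F' \<Longrightarrow> p \<in> S \<times> T \<Longrightarrow>
      deriv_at (\<lambda>p. F' (snd p)) p u = deriv_at F' (snd p) (snd u)"
proof -
  have ST: "open (S \<times> T)" using S T by (rule open_Times)
  have f: "smooth_map_on (S \<times> T) (fst :: 'a \<times> 'b \<Rightarrow> 'a)" "smooth_map_on (S \<times> T) (snd :: 'a \<times> 'b \<Rightarrow> 'b)"
    by (intro smooth_map_on_linear ST linear_fst linear_snd)+
  show "smooth_map_on S F \<Longrightarrow> smooth_map_on (S \<times> T) (\<lambda>p. F (fst p))"
    by (rule smooth_map_on_compose[OF ST S _ _ f(1)]) auto
  show "smooth_map_on T F' \<Longrightarrow> smooth_map_on (S \<times> T) (\<lambda>p. F' (snd p))"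
    by (rule smooth_map_on_compose[OF ST T _ _ f(2)]) auto
  show "smooth_map_on S F \<Longrightarrow> p \<in> S \<times> T \<Longrightarrow> deriv_at (\<lambda>p. F (fst p)) p u = deriv_at F (fst p) (fst u)"
    using deriv_at_compose[OF ST _ f(1) S, of p F u] by (auto simp: deriv_at_linear[OF linear_fst])
  show "smooth_map_on T F' \<Longrightarrow> p \<in> S \<times> T \<Longrightarrow> deriv_at (\<lambda>p. F' (snd p)) p u = deriv_at F' (snd p) (snd u)"
    using deriv_at_compose[OF ST _ f(2) T, of p F' u] by (auto simp: deriv_at_linear[OF linear_snd])
qed

text \<open>\<open>H\<close> is prescribed on the open product only, since transitions and
  Christoffel symbols are controlled there and nowhere else.\<close>

lemma deriv_at_map_prod:
  fixes S :: "'a::euclidean_space set" and T :: "'b::euclidean_space set"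
    and F :: "'a \<Rightarrow> 'c::euclidean_space" and F' :: "'b \<Rightarrow> 'd::euclidean_space"
  assumes S: "open S" and T: "open T" and F: "smooth_map_on S F" and F': "smooth_map_on T F'"
    and p: "p \<in> S \<times> T" and H: "\<And>q. q \<in> S \<times> T \<Longrightarrow> H q = (F (fst q), F' (snd q))"
  shows "deriv_at H p u = (deriv_at F (fst p) (fst u), deriv_at F' (snd p) (snd u))"
proof (rule deriv_at_eq)
  have "((\<lambda>q. (F (fst q), F' (snd q))) has_derivative
    (\<lambda>u. (deriv_at F (fst p) (fst u), deriv_at F' (snd p) (snd u)))) (at p)"
    using p
    by (intro has_derivative_Pair has_derivative_compose[OF has_derivative_fst[OF has_derivative_ident]]
      has_derivative_compose[OF has_derivative_snd[OF has_derivative_ident]]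
      smooth_map_on_has_derivative[OF F S] smooth_map_on_has_derivative[OF F' T]) auto
  then show "(H has_derivative (\<lambda>u. (deriv_at F (fst p) (fst u), deriv_at F' (snd p) (snd u)))) (at p)"
    by (rule has_derivative_transform_within_open[OF _ open_Times[OF S T] p]) (simp add: H)
qed

locale product_chart = M: riemannian_chart S g\<^sub>1 + N: riemannian_chart T g\<^sub>2
  for S :: "'a::euclidean_space set" and g\<^sub>1 and T :: "'b::euclidean_space set" and g\<^sub>2
begin

text \<open>The expression of \<open>product_metric\<close> in a single pair of charts.\<close>

definition G :: "('a \<times> 'b) local_tensor2" where
  "G = (\<lambda>(x, y) u v. g\<^sub>1 x (fst u) (fst v) + g\<^sub>2 y (snd u) (snd v))"

lemma G_eq: "G p u v = g\<^sub>1 (fst p) (fst u) (fst v) + g\<^sub>2 (snd p) (snd u) (snd v)"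
  by (simp add: G_def case_prod_unfold)

lemmas open_ST = open_Times[OF M.open_S N.open_S]
lemmas smooth_fst = smooth_map_on_fst[OF M.open_S N.open_S]
lemmas smooth_snd = smooth_map_on_snd[OF M.open_S N.open_S]
lemmas D_fst = deriv_at_fst[OF M.open_S N.open_S]
lemmas D_snd = deriv_at_snd[OF M.open_S N.open_S]

lemma linear_fst_comp: "linear h \<Longrightarrow> linear (\<lambda>u. h (fst u))"
  and linear_snd_comp: "linear k \<Longrightarrow> linear (\<lambda>u. k (snd u))"
  using linear_compose[OF linear_fst, of h] linear_compose[OF linear_snd, of k] by (simp_all add: o_def)

lemma tensor2_fst:
  assumes "tensor2 S A"
  shows "tensor2 (S \<times> T) (\<lambda>p u v. A (fst p) (fst u) (fst v))"
  unfolding tensor2_def tensor1_def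
  by (auto intro!: smooth_fst tensor2D(5)[OF assms] linear_fst_comp tensor2D(3,4)[OF assms])

lemma tensor2_snd:
  assumes "tensor2 T B"
  shows "tensor2 (S \<times> T) (\<lambda>p u v. B (snd p) (snd u) (snd v))"
  unfolding tensor2_def tensor1_def
  by (auto intro!: smooth_snd tensor2D(5)[OF assms] linear_snd_comp tensor2D(3,4)[OF assms])

lemma tensor2_G: "tensor2 (S \<times> T) G"
  using tensor2_add[OF open_ST tensor2_fst[OF M.tensor2_g] tensor2_snd[OF N.tensor2_g]]
  by (simp add: G_eq[abs_def])

sublocale P: riemannian_chart "S \<times> T" G
proof
  show "open (S \<times> T)" by (rule open_ST)
  show "smooth_map_on (S \<times> T) (\<lambda>p. G p u v)" for u v
    by (rule tensor2D(5)[OF tensor2_G])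
  fix p u v assume p: "p \<in> S \<times> T"
  then have p': "fst p \<in> S" "snd p \<in> T" by auto
  show "bilinear (G p)" by (rule tensor2_bilinear[OF tensor2_G p])
  show "G p u v = G p v u"
    using p' by (simp add: G_eq M.sym_g[of _ "fst u"] N.sym_g[of _ "snd u"])
  assume "u \<noteq> 0"
  have nn: "g\<^sub>1 (fst p) (fst u) (fst u) \<ge> 0" "g\<^sub>2 (snd p) (snd u) (snd u) \<ge> 0"
    using M.pos_g[OF p'(1)] N.pos_g[OF p'(2)] bilinear_lzero[OF M.bilinear_g[OF p'(1)]]
      bilinear_lzero[OF N.bilinear_g[OF p'(2)]] by (metis less_eq_real_def)+
  have "fst u \<noteq> 0 \<or> snd u \<noteq> 0" using \<open>u \<noteq> 0\<close> by (metis prod.collapse zero_prod_def)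
  then show "G p u u > 0"
    using nn M.pos_g[OF p'(1)] N.pos_g[OF p'(2)] unfolding G_eq by (metis add_nonneg_pos add_pos_nonneg)
qed

lemma D_G:
  assumes "p \<in> S \<times> T"
  shows "deriv_at (\<lambda>q. G q v w) p u =
    deriv_at (\<lambda>x. g\<^sub>1 x (fst v) (fst w)) (fst p) (fst u) + deriv_at (\<lambda>y. g\<^sub>2 y (snd v) (snd w)) (snd p) (snd u)"
  unfolding G_eq
    deriv_at_add[OF open_ST assms smooth_fst[OF M.smooth_g] smooth_snd[OF N.smooth_g]]
    D_fst[OF M.smooth_g assms] D_snd[OF N.smooth_g assms] ..

text \<open>The Koszul expression of a metric without mixed terms, each summand depending on its own
  coordinates, is a sum over the factors. The connection splits accordingly, and with it the
  curvature.\<close>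

lemma christoffel_G:
  assumes "p \<in> S \<times> T"
  shows "christoffel G p u v =
    (christoffel g\<^sub>1 (fst p) (fst u) (fst v), christoffel g\<^sub>2 (snd p) (snd u) (snd v))"
proof (rule P.christoffel_eqI[OF assms])
  fix z
  have p': "fst p \<in> S" "snd p \<in> T" using assms by auto
  show "2 * G p (christoffel g\<^sub>1 (fst p) (fst u) (fst v), christoffel g\<^sub>2 (snd p) (snd u) (snd v)) z = P.koszul p u v z"
    unfolding P.koszul_def D_G[OF assms]
    by (simp add: G_eq M.koszul_def N.koszul_def
        M.christoffel_koszul[OF p'(1)] N.christoffel_koszul[OF p'(2)] distrib_left)
qed

lemma curvature_G:
  assumes p: "p \<in> S \<times> T"
  shows "curvature G p u v w =
    (curvature g\<^sub>1 (fst p) (fst u) (fst v) (fst w), curvature g\<^sub>2 (snd p) (snd u) (snd v) (snd w))"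
proof -
  have p': "fst p \<in> S" "snd p \<in> T" using p by auto
  have "deriv_at (\<lambda>q. christoffel G q v w) p u =
    (deriv_at (\<lambda>x. christoffel g\<^sub>1 x (fst v) (fst w)) (fst p) (fst u),
     deriv_at (\<lambda>y. christoffel g\<^sub>2 y (snd v) (snd w)) (snd p) (snd u))" for u v w
    by (rule deriv_at_map_prod[OF M.open_S N.open_S M.christoffel_smooth N.christoffel_smooth p christoffel_G])
  then show ?thesis
    by (simp add: P.curvature_eq[OF p] M.curvature_eq[OF p'(1)] N.curvature_eq[OF p'(2)] christoffel_G[OF p])
qed

text \<open>Frames of the two factors, embedded as (e, 0) and (0, e), together form a frame of the
  product.\<close>

lemma metric_trace_G:
  assumes p: "p \<in> S \<times> T" and B: "bilinear B"
  shows "metric_trace (G p) B = metric_trace (g\<^sub>1 (fst p)) (\<lambda>e e'. B (e, 0) (e', 0))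
    + metric_trace (g\<^sub>2 (snd p)) (\<lambda>e e'. B (0, e) (0, e'))"
proof -
  have p': "fst p \<in> S" "snd p \<in> T" using p by auto
  define E\<^sub>1 where "E\<^sub>1 = (\<lambda>b. M.frame b (fst p)) ` Basis"
  define E\<^sub>2 where "E\<^sub>2 = (\<lambda>b. N.frame b (snd p)) ` Basis"
  have E\<^sub>1: "orthonormal_frame (g\<^sub>1 (fst p)) E\<^sub>1" and E\<^sub>2: "orthonormal_frame (g\<^sub>2 (snd p)) E\<^sub>2"
    unfolding E\<^sub>1_def E\<^sub>2_def by (rule M.orthonormal_frame_frame N.orthonormal_frame_frame, rule p')+
  define F\<^sub>1 where "F\<^sub>1 = (\<lambda>e. (e, 0 :: 'b)) ` E\<^sub>1"
  define F\<^sub>2 where "F\<^sub>2 = (\<lambda>e. (0 :: 'a, e)) ` E\<^sub>2"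
  have fin: "finite E\<^sub>1" "finite E\<^sub>2" "finite F\<^sub>1" "finite F\<^sub>2"
    using E\<^sub>1 E\<^sub>2 by (auto simp: orthonormal_frame_def F\<^sub>1_def F\<^sub>2_def)
  have inj: "inj_on (\<lambda>e. (e, 0 :: 'b)) E\<^sub>1" "inj_on (\<lambda>e. (0 :: 'a, e)) E\<^sub>2"
    by (auto simp: inj_on_def)
  have z: "g\<^sub>1 (fst p) 0 v = 0" "g\<^sub>1 (fst p) v 0 = 0" "g\<^sub>2 (snd p) 0 w = 0" "g\<^sub>2 (snd p) w 0 = 0" for v w
    using bilinear_lzero[OF M.bilinear_g[OF p'(1)]] bilinear_rzero[OF M.bilinear_g[OF p'(1)]]
      bilinear_lzero[OF N.bilinear_g[OF p'(2)]] bilinear_rzero[OF N.bilinear_g[OF p'(2)]] by auto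
  \<comment> \<open>The embedded frames could meet in the zero vector only. Excluding it makes the
    cardinalities add up to the dimension of the product.\<close>
  have "0 \<notin> E\<^sub>1"
    using E\<^sub>1 z by (force simp: orthonormal_frame_def)
  then have disj: "F\<^sub>1 \<inter> F\<^sub>2 = {}" by (auto simp: F\<^sub>1_def F\<^sub>2_def)
  have card: "card (F\<^sub>1 \<union> F\<^sub>2) = DIM('a \<times> 'b)"
    using E\<^sub>1 E\<^sub>2 card_Un_disjoint[OF fin(3,4) disj]
    by (simp add: F\<^sub>1_def F\<^sub>2_def card_image[OF inj(1)] card_image[OF inj(2)] orthonormal_frame_def)
  have on\<^sub>1: "g\<^sub>1 (fst p) a b = (if a = b then 1 else 0)" if "a \<in> E\<^sub>1" "b \<in> E\<^sub>1" for a b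
    using E\<^sub>1 that by (simp add: orthonormal_frame_def)
  have on\<^sub>2: "g\<^sub>2 (snd p) a b = (if a = b then 1 else 0)" if "a \<in> E\<^sub>2" "b \<in> E\<^sub>2" for a b
    using E\<^sub>2 that by (simp add: orthonormal_frame_def)
  have on: "G p e e' = (if e = e' then 1 else 0)" if "e \<in> F\<^sub>1 \<union> F\<^sub>2" "e' \<in> F\<^sub>1 \<union> F\<^sub>2" for e e'
    using that \<open>0 \<notin> E\<^sub>1\<close> by (auto simp: F\<^sub>1_def F\<^sub>2_def G_eq z on\<^sub>1 on\<^sub>2 split: if_splits)
  have F: "orthonormal_frame (G p) (F\<^sub>1 \<union> F\<^sub>2)"
    using fin card on by (simp add: orthonormal_frame_def)
  have "metric_trace (G p) B = (\<Sum>e\<in>F\<^sub>1 \<union> F\<^sub>2. B e e)"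
    by (rule metric_trace_eq[OF P.bilinear_g[OF p] _ P.sym_g[OF p] F B]) (rule P.pos_g[OF p])
  also have "\<dots> = (\<Sum>e\<in>F\<^sub>1. B e e) + (\<Sum>e\<in>F\<^sub>2. B e e)"
    by (rule sum.union_disjoint[OF fin(3,4) disj])
  also have "(\<Sum>e\<in>F\<^sub>1. B e e) = (\<Sum>e\<in>E\<^sub>1. B (e, 0) (e, 0))"
    by (simp add: F\<^sub>1_def sum.reindex[OF inj(1)])
  also have "(\<Sum>e\<in>F\<^sub>2. B e e) = (\<Sum>e\<in>E\<^sub>2. B (0, e) (0, e))"
    by (simp add: F\<^sub>2_def sum.reindex[OF inj(2)])
  also have "(\<Sum>e\<in>E\<^sub>1. B (e, 0) (e, 0)) = metric_trace (g\<^sub>1 (fst p)) (\<lambda>e e'. B (e, 0) (e', 0))"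
  proof (rule metric_trace_eq[symmetric, OF M.bilinear_g M.pos_g M.sym_g E\<^sub>1], (rule p' | assumption)+)
    have "linear (\<lambda>e :: 'a. (e, 0 :: 'b))" by (simp add: linear_iff)
    from linear_compose[OF this, unfolded o_def] show "bilinear (\<lambda>e e'. B (e, 0) (e', 0))"
      using B unfolding bilinear_def by blast
  qed
  also have "(\<Sum>e\<in>E\<^sub>2. B (0, e) (0, e)) = metric_trace (g\<^sub>2 (snd p)) (\<lambda>e e'. B (0, e) (0, e'))"
  proof (rule metric_trace_eq[symmetric, OF N.bilinear_g N.pos_g N.sym_g E\<^sub>2], (rule p' | assumption)+)
    have "linear (\<lambda>e :: 'b. (0 :: 'a, e))" by (simp add: linear_iff)
    from linear_compose[OF this, unfolded o_def] show "bilinear (\<lambda>e e'. B (0, e) (0, e'))"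
      using B unfolding bilinear_def by blast
  qed
  finally show ?thesis .
qed

section \<open>Fields combining both factors\<close>

context
  fixes A :: "'a local_tensor2" and \<phi> :: "'a \<Rightarrow> real"
  assumes A: "tensor2 S A" and \<phi>: "smooth_map_on S \<phi>"
begin

text \<open>The shape of the deformation in a chart. The second factor enters only through its
  parallel metric, so covariant derivatives fall on \<open>A\<close> and \<phi> alone and see only
  directions tangent to the first factor.\<close>

abbreviation mixed :: "('a \<times> 'b) local_tensor2" where
  "mixed \<equiv> \<lambda>p u v. A (fst p) (fst u) (fst v) + \<phi> (fst p) * g\<^sub>2 (snd p) (snd u) (snd v)"

lemma smooth_scaled_g2: "smooth_map_on (S \<times> T) (\<lambda>p. \<phi> (fst p) * g\<^sub>2 (snd p) v w)"
  by (intro smooth_map_on_mult open_ST smooth_fst \<phi> smooth_snd N.smooth_g)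

lemma tensor2_mixed: "tensor2 (S \<times> T) mixed"
  using tensor2_add[OF open_ST tensor2_fst[OF A] tensor2_scaleR[OF open_ST smooth_fst[OF \<phi>] tensor2_snd[OF N.tensor2_g]]]
  by simp

lemma nabla2_mixed:
  assumes p: "p \<in> S \<times> T"
  shows "nabla2 G mixed p u v w = nabla2 g\<^sub>1 A (fst p) (fst u) (fst v) (fst w)
    + deriv_at \<phi> (fst p) (fst u) * g\<^sub>2 (snd p) (snd v) (snd w)"
proof -
  have p': "snd p \<in> T" using p by auto
  have "deriv_at (\<lambda>q. mixed q v w) p u = deriv_at (\<lambda>x. A x (fst v) (fst w)) (fst p) (fst u)
    + (\<phi> (fst p) * deriv_at (\<lambda>y. g\<^sub>2 y (snd v) (snd w)) (snd p) (snd u)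
       + deriv_at \<phi> (fst p) (fst u) * g\<^sub>2 (snd p) (snd v) (snd w))"
    unfolding deriv_at_add[OF open_ST p smooth_fst[OF tensor2D(5)[OF A]] smooth_scaled_g2]
      deriv_at_mult[OF open_ST p smooth_fst[OF \<phi>] smooth_snd[OF N.smooth_g]]
      D_fst[OF \<phi> p] D_fst[OF tensor2D(5)[OF A] p] D_snd[OF N.smooth_g p] ..
  then show ?thesis
    by (simp add: nabla2_def christoffel_G[OF p] N.metric_compatible[OF p'] algebra_simps)
qed

lemma nabla3_nabla2_mixed:
  assumes p: "p \<in> S \<times> T"
  shows "nabla3 G (nabla2 G mixed) p a u v w =
    nabla3 g\<^sub>1 (nabla2 g\<^sub>1 A) (fst p) (fst a) (fst u) (fst v) (fst w)
    + hessian g\<^sub>1 \<phi> (fst p) (fst a) (fst u) * g\<^sub>2 (snd p) (snd v) (snd w)"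
proof -
  have p': "snd p \<in> T" using p by auto
  note T = tensor3D(7)[OF M.tensor3_nabla2[OF A]]
  note d\<phi> = smooth_map_on_deriv_at[OF \<phi>]
  let ?K = "\<lambda>p u v w. nabla2 g\<^sub>1 A (fst p) (fst u) (fst v) (fst w)
    + deriv_at \<phi> (fst p) (fst u) * g\<^sub>2 (snd p) (snd v) (snd w)"
  have "deriv_at (\<lambda>q. ?K q u v w) p a = deriv_at (\<lambda>x. nabla2 g\<^sub>1 A x (fst u) (fst v) (fst w)) (fst p) (fst a)
    + (deriv_at \<phi> (fst p) (fst u) * deriv_at (\<lambda>y. g\<^sub>2 y (snd v) (snd w)) (snd p) (snd a)
       + deriv_at (\<lambda>x. deriv_at \<phi> x (fst u)) (fst p) (fst a) * g\<^sub>2 (snd p) (snd v) (snd w))"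
    unfolding deriv_at_add[OF open_ST p smooth_fst[OF T]
        smooth_map_on_mult[OF open_ST smooth_fst[OF d\<phi>] smooth_snd[OF N.smooth_g]]]
      deriv_at_mult[OF open_ST p smooth_fst[OF d\<phi>] smooth_snd[OF N.smooth_g]]
      D_fst[OF d\<phi> p] D_fst[OF T p] D_snd[OF N.smooth_g p] ..
  then have "nabla3 G ?K p a u v w = nabla3 g\<^sub>1 (nabla2 g\<^sub>1 A) (fst p) (fst a) (fst u) (fst v) (fst w)
    + hessian g\<^sub>1 \<phi> (fst p) (fst a) (fst u) * g\<^sub>2 (snd p) (snd v) (snd w)"
    by (simp add: nabla3_def hessian_def nabla1_def christoffel_G[OF p] N.metric_compatible[OF p'] algebra_simps)
  moreover have "nabla3 G (nabla2 G mixed) p a u v w = nabla3 G ?K p a u v w"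
    by (rule P.nabla3_cong[OF P.tensor3_nabla2[OF tensor2_mixed] nabla2_mixed p])
  ultimately show ?thesis by simp
qed

lemma metric_trace_mixed:
  assumes p: "p \<in> S \<times> T"
  shows "metric_trace (G p) (mixed p) = metric_trace (g\<^sub>1 (fst p)) (A (fst p)) + \<phi> (fst p) * DIM('b)"
proof -
  have p': "fst p \<in> S" "snd p \<in> T" using p by auto
  show ?thesis
    unfolding metric_trace_G[OF p tensor2_bilinear[OF tensor2_mixed p]]
    by (simp add: bilinear_lzero[OF N.bilinear_g[OF p'(2)]] bilinear_lzero[OF tensor2_bilinear[OF A p'(1)]]
        N.metric_trace_cmult[OF p'(2) N.bilinear_g[OF p'(2)]] N.metric_trace_g[OF p'(2)])
qed

lemma metric_trace_zero: "metric_trace b (\<lambda>e e'. 0) = 0"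
  by (simp add: metric_trace_def)

text \<open>Frame vectors (0, e) do not differentiate anything, and frame vectors (e, 0) are
  annihilated by the metric of the second factor.\<close>

lemma divergence_mixed:
  assumes p: "p \<in> S \<times> T"
  shows "divergence G mixed p v = divergence g\<^sub>1 A (fst p) (fst v)"
proof -
  have p': "fst p \<in> S" "snd p \<in> T" using p by auto
  have bil: "bilinear (\<lambda>e e'. nabla2 G mixed p e e' v)"
    using tensor3D(4,5)[OF P.tensor3_nabla2[OF tensor2_mixed] p] by (simp add: bilinear_def)
  show ?thesis
    unfolding divergence_def metric_trace_G[OF p bil]
    by (simp add: nabla2_mixed[OF p] bilinear_lzero[OF N.bilinear_g[OF p'(2)]]
        linear_0[OF linear_deriv_at[OF \<phi> M.open_S p'(1)]]
        linear_0[OF tensor3D(4)[OF M.tensor3_nabla2[OF A] p'(1)]] metric_trace_zero)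
qed

text \<open>Directions tangent to the first factor carry the whole rough Laplacian. In the curvature
  action the directions of the second factor trace its own curvature against its metric, which gives
  the Ricci term.\<close>

lemma einstein_operator_mixed:
  assumes p: "p \<in> S \<times> T"
  shows "einstein_operator G mixed p u v = einstein_operator g\<^sub>1 A (fst p) (fst u) (fst v)
    + laplacian g\<^sub>1 \<phi> (fst p) * g\<^sub>2 (snd p) (snd u) (snd v)
    - 2 * \<phi> (fst p) * ricci g\<^sub>2 (snd p) (snd u) (snd v)"
proof -
  have p': "fst p \<in> S" "snd p \<in> T" using p by auto
  note zeros = bilinear_lzero[OF N.bilinear_g[OF p'(2)]] bilinear_rzero[OF N.bilinear_g[OF p'(2)]]
    bilinear_rzero[OF tensor2_bilinear[OF A p'(1)]] bilinear_lzero[OF tensor2_bilinear[OF A p'(1)]]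
    linear_0[OF tensor4D(4)[OF M.tensor4_nabla3[OF M.tensor3_nabla2[OF A]] p'(1)]]
    linear_0[OF tensor2D(4)[OF M.hessian_tensor2[OF \<phi>] p'(1)]]
  have bil: "bilinear (\<lambda>e e'. nabla3 G (nabla2 G mixed) p e e' u v)"
    using tensor4D(4,5)[OF P.tensor4_nabla3[OF P.tensor3_nabla2[OF tensor2_mixed]] p] by (simp add: bilinear_def)
  have bil1: "bilinear (\<lambda>e e'. nabla3 g\<^sub>1 (nabla2 g\<^sub>1 A) (fst p) e e' (fst u) (fst v))"
    using tensor4D(4,5)[OF M.tensor4_nabla3[OF M.tensor3_nabla2[OF A]] p'(1)] by (simp add: bilinear_def)
  note bil2 = tensor2_bilinear[OF M.hessian_tensor2[OF \<phi>] p'(1)]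
  have bil2': "bilinear (\<lambda>e e'. hessian g\<^sub>1 \<phi> (fst p) e e' * g\<^sub>2 (snd p) (snd u) (snd v))"
    using bil2 linear_compose_scale_right[where c = "g\<^sub>2 (snd p) (snd u) (snd v)"]
    by (fastforce simp: bilinear_def mult.commute[of _ "g\<^sub>2 (snd p) (snd u) (snd v)"])
  have bil3: "bilinear (\<lambda>e e'. mixed p (curvature G p e u v) e')"
    using linear_compose[OF P.curvature_linear(1)[OF p] tensor2D(4)[OF tensor2_mixed p], unfolded o_def]
      tensor2D(3)[OF tensor2_mixed p] by (simp add: bilinear_def)
  have "metric_trace (g\<^sub>1 (fst p)) (\<lambda>e e'. nabla3 G (nabla2 G mixed) p (e, 0) (e', 0) u v)
      = metric_trace (g\<^sub>1 (fst p)) (\<lambda>e e'. nabla3 g\<^sub>1 (nabla2 g\<^sub>1 A) (fst p) e e' (fst u) (fst v))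
        + g\<^sub>2 (snd p) (snd u) (snd v) * metric_trace (g\<^sub>1 (fst p)) (hessian g\<^sub>1 \<phi> (fst p))"
    unfolding M.metric_trace_cmult[OF p'(1) bil2, symmetric]
    using M.metric_trace_add[OF p'(1) bil1 bil2']
    by (simp add: nabla3_nabla2_mixed[OF p] mult.commute)
  then have 1: "nabla_adjoint G (nabla2 G mixed) p u v = nabla_adjoint g\<^sub>1 (nabla2 g\<^sub>1 A) (fst p) (fst u) (fst v)
      + laplacian g\<^sub>1 \<phi> (fst p) * g\<^sub>2 (snd p) (snd u) (snd v)"
    unfolding nabla_adjoint_def laplacian_def metric_trace_G[OF p bil]
    by (simp add: nabla3_nabla2_mixed[OF p] zeros metric_trace_zero)
  have 2: "curvature_action G mixed p u v = curvature_action g\<^sub>1 A (fst p) (fst u) (fst v)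
      + \<phi> (fst p) * ricci g\<^sub>2 (snd p) (snd u) (snd v)"
    unfolding curvature_action_def ricci_def metric_trace_G[OF p bil3]
      N.metric_trace_cmult[OF p'(2) tensor2_bilinear[OF N.riemann_tensor(1) p'(2)], symmetric]
    by (simp add: curvature_G[OF p] zeros)
  show ?thesis
    unfolding einstein_operator_def 1 2 by (simp add: algebra_simps)
qed

end

end


section \<open>Change of charts\<close>

text \<open>The second derivative of the coordinate change appears in the chain rule for second
  derivatives of f and in the transformation law of the Christoffel symbols; in the Hessian the two
  contributions cancel.\<close>

lemma hessian_change_of_chart:
  fixes \<phi> :: "'a::euclidean_space \<Rightarrow> 'a" and f f' :: "'a \<Rightarrow> real"
  assumes c: "riemannian_chart S g" and c': "riemannian_chart S' g'"
    and U: "open U" "U \<subseteq> S" and \<phi>: "smooth_map_on U \<phi>" "\<phi> ` U \<subseteq> S'"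
    and g: "\<And>x u v. x \<in> U \<Longrightarrow> g x u v = g' (\<phi> x) (deriv_at \<phi> x u) (deriv_at \<phi> x v)"
    and f': "smooth_map_on S' f'" and f: "\<And>x. x \<in> U \<Longrightarrow> f x = f' (\<phi> x)"
    and x: "x \<in> U"
  shows "hessian g f x u v = hessian g' f' (\<phi> x) (deriv_at \<phi> x u) (deriv_at \<phi> x v)"
proof -
  interpret C: riemannian_chart S g by (rule c)
  interpret C': riemannian_chart S' g' by (rule c')
  define L where "L = deriv_at \<phi> x"
  define D2 where "D2 u v = deriv_at (\<lambda>y. deriv_at \<phi> y v) x u" for u v
  have xS: "x \<in> S" and xS': "\<phi> x \<in> S'" using x U \<phi> by auto
  have D2_commute: "D2 u v = D2 v u" for u v
    unfolding D2_def by (rule deriv_at_commute[OF U(1) x \<phi>(1)])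
  have L: "linear L" unfolding L_def by (rule linear_deriv_at[OF \<phi>(1) U(1) x])
  have d\<phi>: "smooth_map_on U (\<lambda>y. deriv_at \<phi> y v)" for v by (rule smooth_map_on_deriv_at[OF \<phi>(1)])
  have t2: "tensor2 U (\<lambda>y. g' (\<phi> y))"
    unfolding tensor2_def tensor1_def
    using \<phi>(2) tensor2D(3,4)[OF C'.tensor2_g] smooth_map_on_compose[OF U(1) C'.open_S \<phi>(2) C'.smooth_g \<phi>(1)]
    by blast
  have gx: "g x u v = g' (\<phi> x) (L u) (L v)" for u v
    unfolding L_def by (rule g[OF x])
  have dg: "deriv_at (\<lambda>y. g y v z) x u = deriv_at (\<lambda>q. g' q (L v) (L z)) (\<phi> x) (L u)
      + g' (\<phi> x) (D2 u v) (L z) + g' (\<phi> x) (L v) (D2 u z)" for u v z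
  proof -
    have "deriv_at (\<lambda>y. g y v z) x u = deriv_at (\<lambda>y. g' (\<phi> y) (deriv_at \<phi> y v) (deriv_at \<phi> y z)) x u"
      by (rule fun_cong[OF deriv_at_cong[OF U(1) x g smooth_map_on_subset[OF C.smooth_g U(2)]]])
    then show ?thesis
      unfolding deriv_at_tensor2_contract[OF U(1) t2 d\<phi> d\<phi> x]
        deriv_at_compose[OF U(1) x \<phi>(1) C'.open_S xS' C'.smooth_g]
      by (simp add: L_def D2_def)
  qed
  have sg': "g' (\<phi> x) a b = g' (\<phi> x) b a" for a b
    by (rule C'.sym_g[OF xS'])
  \<comment> \<open>\<open>L\<close> pulls a positive definite form back to a positive definite
    form, so it is injective, hence bijective in finite dimension. Surjectivity allows testing
    against vectors \<open>L z\<close> only.\<close>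
  have "inj L"
  proof (subst linear_injective_0[OF L], intro allI impI)
    fix w assume "L w = 0"
    then have "g x w w = 0" using gx bilinear_lzero[OF C'.bilinear_g[OF xS']] by simp
    then show "w = 0" using C.pos_g[OF xS, of w] by force
  qed
  then have "surj L" using linear_injective_imp_surjective[OF L] by blast
  \<comment> \<open>The inhomogeneous transformation law. In the Koszul expression the second
    derivatives of the coordinate change cancel except for two equal copies of \<open>D2 u v\<close>
    paired with \<open>L z\<close>.\<close>
  have \<Gamma>: "L (christoffel g x u v) = christoffel g' (\<phi> x) (L u) (L v) + D2 u v" for u v
  proof (rule C'.nondegenerate[OF xS'])
    fix z'
    obtain z where z: "z' = L z" using \<open>surj L\<close> by (metis surjD)
    have "2 * g' (\<phi> x) (L (christoffel g x u v)) (L z) = C.koszul x u v z"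
      using C.christoffel_koszul[OF xS] gx by simp
    also have "\<dots> = C'.koszul (\<phi> x) (L u) (L v) (L z) + 2 * g' (\<phi> x) (D2 u v) (L z)"
      unfolding C.koszul_def C'.koszul_def dg D2_commute[of z] D2_commute[of v u]
      using sg'[of "L v" "D2 u z"] sg'[of "L u" "D2 v z"] sg'[of "D2 v z" "L u"] by simp
    finally show "g' (\<phi> x) (L (christoffel g x u v)) z' =
        g' (\<phi> x) (christoffel g' (\<phi> x) (L u) (L v) + D2 u v) z'"
      unfolding z bilinear_ladd[OF C'.bilinear_g[OF xS']]
      using C'.christoffel_koszul[OF xS', of "L u" "L v" "L z"] by simp
  qed
  have f_smooth: "smooth_map_on U f"
    by (rule smooth_map_on_cong[OF U(1) f[symmetric] smooth_map_on_compose[OF U(1) C'.open_S \<phi>(2) f' \<phi>(1)]])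
  have df: "deriv_at f y w = deriv_at f' (\<phi> y) (deriv_at \<phi> y w)" if y: "y \<in> U" for y w
  proof -
    have "deriv_at f y w = deriv_at (\<lambda>y. f' (\<phi> y)) y w"
      by (rule fun_cong[OF deriv_at_cong[OF U(1) y f f_smooth]])
    also have "\<dots> = deriv_at f' (\<phi> y) (deriv_at \<phi> y w)"
      using y \<phi>(2) by (intro deriv_at_compose[OF U(1) y \<phi>(1) C'.open_S _ f']) auto
    finally show ?thesis .
  qed
  have t1: "tensor1 U (\<lambda>y. deriv_at f' (\<phi> y))"
    unfolding tensor1_def
    using \<phi>(2) linear_deriv_at[OF f' C'.open_S]
      smooth_map_on_compose[OF U(1) C'.open_S \<phi>(2) smooth_map_on_deriv_at[OF f'] \<phi>(1)] by blast
  have "deriv_at (\<lambda>y. deriv_at f y v) x u = deriv_at (\<lambda>y. deriv_at f' (\<phi> y) (deriv_at \<phi> y v)) x u"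
    by (rule fun_cong[OF deriv_at_cong[OF U(1) x df smooth_map_on_deriv_at[OF f_smooth]]])
  also have "\<dots> = deriv_at (\<lambda>q. deriv_at f' q (L v)) (\<phi> x) (L u) + deriv_at f' (\<phi> x) (D2 u v)"
    unfolding deriv_at_tensor1_contract[OF U(1) t1 d\<phi> x]
      deriv_at_compose[OF U(1) x \<phi>(1) C'.open_S xS' smooth_map_on_deriv_at[OF f']]
    by (simp add: L_def D2_def)
  finally show ?thesis
    unfolding hessian_def nabla1_def df[OF x] L_def[symmetric] \<Gamma>
    by (simp add: linear_add[OF linear_deriv_at[OF f' C'.open_S xS']])
qed


section \<open>Deformations of product manifolds\<close>

lemma
  assumes M: "smooth_manifold M" and i: "i \<in> chart_index M"
  shows open_chart_range: "open (chart_range M i)"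
    and inj_on_chart_map: "inj_on (chart_map M i) (chart_dom M i)"
    and chart_inv_chart_map: "p \<in> chart_dom M i \<Longrightarrow> chart_inv M i (chart_map M i p) = p"
    and open_chart_overlap: "j \<in> chart_index M \<Longrightarrow> open (chart_map M i ` (chart_dom M i \<inter> chart_dom M j))"
proof -
  have o: "openin (mtop M) (chart_dom M i)" "open (chart_range M i)"
    and h: "homeomorphic_map (subtopology (mtop M) (chart_dom M i)) (top_of_set (chart_range M i)) (chart_map M i)"
    using M i by (auto simp: smooth_manifold_def)
  have sub: "chart_dom M i \<subseteq> topspace (mtop M)" using o(1) by (rule openin_subset)
  show "open (chart_range M i)" by (rule o(2))
  show inj: "inj_on (chart_map M i) (chart_dom M i)"
    using homeomorphic_imp_injective_map[OF h] sub by (simp add: Int_absorb1)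
  show "p \<in> chart_dom M i \<Longrightarrow> chart_inv M i (chart_map M i p) = p"
    unfolding chart_inv_def by (rule inv_into_f_f[OF inj])
  assume "j \<in> chart_index M"
  then have "openin (mtop M) (chart_dom M j)" using M by (auto simp: smooth_manifold_def)
  then have "openin (subtopology (mtop M) (chart_dom M i)) (chart_dom M i \<inter> chart_dom M j)"
    by (rule openin_subtopology_Int2)
  then have "openin (top_of_set (chart_range M i)) (chart_map M i ` (chart_dom M i \<inter> chart_dom M j))"
    using homeomorphic_imp_open_map[OF h] by (simp add: open_map_def)
  then show "open (chart_map M i ` (chart_dom M i \<inter> chart_dom M j))"
    using o(2) openin_open_trans by blast
qed

lemma transition_chart_map:
  assumes "smooth_manifold M" "i \<in> chart_index M" "p \<in> chart_dom M i"
  shows "transition M i j (chart_map M i p) = chart_map M j p"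
  using chart_inv_chart_map[OF assms] by (simp add: transition_def)

lemma riemannian_metric_chart:
  assumes M: "smooth_manifold M" and g: "riemannian_metric M g" and i: "i \<in> chart_index M"
  shows "riemannian_chart (chart_range M i) (g i)"
  using assms open_chart_range[OF M i]
  by unfold_locales (auto simp: riemannian_metric_def smooth_symmetric_tensor2_def)

lemma product_manifold_simps:
  "chart_index (product_manifold M N) = chart_index M \<times> chart_index N"
  "chart_dom (product_manifold M N) (i, j) = chart_dom M i \<times> chart_dom N j"
  "chart_map (product_manifold M N) (i, j) (p, q) = (chart_map M i p, chart_map N j q)"
  "chart_range (product_manifold M N) (i, j) = chart_range M i \<times> chart_range N j"
  by (auto simp: product_manifold_def chart_range_def map_prod_def image_iff)

lemma transition_product_manifold:
  assumes M: "smooth_manifold M" "i \<in> chart_index M" "p \<in> chart_dom M i"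
    and N: "smooth_manifold N" "j \<in> chart_index N" "q \<in> chart_dom N j"
  shows "transition (product_manifold M N) (i, j) (i', j') (chart_map M i p, chart_map N j q) =
    (chart_map M i' p, chart_map N j' q)"
proof -
  have "inj_on (map_prod (chart_map M i) (chart_map N j)) (chart_dom M i \<times> chart_dom N j)"
    by (rule map_prod_inj_on[OF inj_on_chart_map[OF M(1,2)] inj_on_chart_map[OF N(1,2)]])
  from inv_into_f_f[OF this, of "(p, q)"] show ?thesis
    using M(3) N(3) by (simp add: transition_def chart_inv_def product_manifold_def)
qed

text \<open>The transition of the product is a pair of transitions on the overlap, so its
  differential is block diagonal. This lets the transformation law of the deformation be checked
  factor by factor.\<close>

lemma deriv_at_transition_product:
  assumes M: "smooth_manifold M" "i \<in> chart_index M" "i' \<in> chart_index M" "p \<in> chart_dom M i \<inter> chart_dom M i'"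
    and N: "smooth_manifold N" "j \<in> chart_index N" "j' \<in> chart_index N" "q \<in> chart_dom N j \<inter> chart_dom N j'"
  shows "deriv_at (transition (product_manifold M N) (i, j) (i', j')) (chart_map M i p, chart_map N j q) u =
    (deriv_at (transition M i i') (chart_map M i p) (fst u), deriv_at (transition N j j') (chart_map N j q) (snd u))"
proof -
  have s: "smooth_map_on (chart_map M i ` (chart_dom M i \<inter> chart_dom M i')) (transition M i i')"
    "smooth_map_on (chart_map N j ` (chart_dom N j \<inter> chart_dom N j')) (transition N j j')"
    using M N by (simp_all add: smooth_manifold_def)
  have "deriv_at (transition (product_manifold M N) (i, j) (i', j')) (chart_map M i p, chart_map N j q) u =
    (deriv_at (transition M i i') (fst (chart_map M i p, chart_map N j q)) (fst u),
     deriv_at (transition N j j') (snd (chart_map M i p, chart_map N j q)) (snd u))"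
  proof (rule deriv_at_map_prod[OF open_chart_overlap[OF M(1-3)] open_chart_overlap[OF N(1-3)] s])
    show "(chart_map M i p, chart_map N j q) \<in>
        chart_map M i ` (chart_dom M i \<inter> chart_dom M i') \<times> chart_map N j ` (chart_dom N j \<inter> chart_dom N j')"
      using M(4) N(4) by blast
    fix z assume "z \<in> chart_map M i ` (chart_dom M i \<inter> chart_dom M i') \<times> chart_map N j ` (chart_dom N j \<inter> chart_dom N j')"
    then show "transition (product_manifold M N) (i, j) (i', j') z =
        (transition M i i' (fst z), transition N j j' (snd z))"
      using transition_product_manifold[OF M(1,2) _ N(1,2)] transition_chart_map[OF M(1,2)]
        transition_chart_map[OF N(1,2)] by auto
  qed
  then show ?thesis by simp
qed

lemma metric_transition:
  assumes "riemannian_metric M g" "i \<in> chart_index M" "j \<in> chart_index M" "p \<in> chart_dom M i \<inter> chart_dom M j"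
  shows "g i (chart_map M i p) u v = g j (chart_map M j p)
    (deriv_at (transition M i j) (chart_map M i p) u) (deriv_at (transition M i j) (chart_map M i p) v)"
  using assms unfolding riemannian_metric_def smooth_symmetric_tensor2_def by blast

lemma hessian_transition:
  assumes M: "smooth_manifold M" and g: "riemannian_metric M g" and f: "smooth_function M f"
    and i: "i \<in> chart_index M" and j: "j \<in> chart_index M" and p: "p \<in> chart_dom M i \<inter> chart_dom M j"
  shows "hessian (g i) (local_rep M f i) (chart_map M i p) u v =
    hessian (g j) (local_rep M f j) (chart_map M j p) (deriv_at (transition M i j) (chart_map M i p) u)
      (deriv_at (transition M i j) (chart_map M i p) v)"
proof -
  let ?U = "chart_map M i ` (chart_dom M i \<inter> chart_dom M j)" and ?\<phi> = "transition M i j"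
  have t: "?\<phi> (chart_map M i q) = chart_map M j q" if "q \<in> chart_dom M i" for q
    using transition_chart_map[OF M i that] .
  have "hessian (g i) (local_rep M f i) (chart_map M i p) u v =
    hessian (g j) (local_rep M f j) (?\<phi> (chart_map M i p)) (deriv_at ?\<phi> (chart_map M i p) u)
      (deriv_at ?\<phi> (chart_map M i p) v)"
  proof (rule hessian_change_of_chart[OF riemannian_metric_chart[OF M g i] riemannian_metric_chart[OF M g j]
        open_chart_overlap[OF M i j]])
    show "?U \<subseteq> chart_range M i" by (auto simp: chart_range_def)
    show "?\<phi> ` ?U \<subseteq> chart_range M j" using t by (auto simp: chart_range_def)
    show "smooth_map_on ?U ?\<phi>" using M i j by (simp add: smooth_manifold_def)
    show "smooth_map_on (chart_range M j) (local_rep M f j)" using f j by (simp add: smooth_function_def)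
    show "chart_map M i p \<in> ?U" using p by blast
    fix x assume "x \<in> ?U"
    then obtain q where q: "x = chart_map M i q" "q \<in> chart_dom M i" "q \<in> chart_dom M j" by auto
    show "local_rep M f i x = local_rep M f j (?\<phi> x)"
      using q t chart_inv_chart_map[OF M i q(2)] chart_inv_chart_map[OF M j q(3)] by (simp add: local_rep_def)
    show "g i x u v = g j (?\<phi> x) (deriv_at ?\<phi> x u) (deriv_at ?\<phi> x v)" for u v
      unfolding q(1) t[OF q(2)] by (rule metric_transition[OF g i j]) (use q in blast)
  qed
  then show ?thesis using p t by simp
qed

section \<open>The deformation as a global tensor field\<close>

text \<open>\<mu> and \<open>\<beta>\<close> are free parameters here: the result is a smooth
  symmetric tensor field for all their values. The trace condition fixes \<open>\<beta>\<close>
  later.\<close>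

definition deformation ::
  "('i, 'p, 'a::euclidean_space) manifold \<Rightarrow> ('i, 'a) tensor2 \<Rightarrow> ('j, 'b::euclidean_space) tensor2 \<Rightarrow>
    ('p \<Rightarrow> real) \<Rightarrow> real \<Rightarrow> real \<Rightarrow> ('i \<times> 'j, 'a \<times> 'b) tensor2" where
  "deformation M g\<^sub>1 g\<^sub>2 f \<mu> \<beta> = (\<lambda>(i, j) p u v.
     \<mu> * local_rep M f i (fst p) * g\<^sub>1 i (fst p) (fst u) (fst v)
     + hessian (g\<^sub>1 i) (local_rep M f i) (fst p) (fst u) (fst v)
     + \<beta> * local_rep M f i (fst p) * g\<^sub>2 j (snd p) (snd u) (snd v))"

lemma compact_einstein_manifold_chart:
  assumes "compact_einstein_manifold M g \<mu>" "i \<in> chart_index M"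
  shows "einstein_chart (chart_range M i) (g i) \<mu>"
  using assms riemannian_metric_chart
  by (auto simp: compact_einstein_manifold_def einstein_chart_def einstein_chart_axioms_def)

text \<open>Within a chart the field has the shape \<open>mixed\<close>, which settles bilinearity
  and smoothness. Across charts each summand transforms correctly: the metrics by assumption, the
  Hessian by \<open>hessian_transition\<close>, and f because it is a function on points.\<close>

lemma smooth_symmetric_deformation:
  assumes M: "smooth_manifold M" "riemannian_metric M g\<^sub>1" and N: "smooth_manifold N" "riemannian_metric N g\<^sub>2"
    and f: "smooth_function M f"
  shows "smooth_symmetric_tensor2 (product_manifold M N) (deformation M g\<^sub>1 g\<^sub>2 f \<mu> \<beta>)"
proof -
  let ?h = "deformation M g\<^sub>1 g\<^sub>2 f \<mu> \<beta>" and ?P = "product_manifold M N"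
  have t: "tensor2 (chart_range M i \<times> chart_range N j) (?h (i, j))"
    if i: "i \<in> chart_index M" and j: "j \<in> chart_index N" for i j
  proof -
    interpret product_chart "chart_range M i" "g\<^sub>1 i" "chart_range N j" "g\<^sub>2 j"
      using riemannian_metric_chart[OF M i] riemannian_metric_chart[OF N j] by (simp add: product_chart_def)
    have F: "smooth_map_on (chart_range M i) (local_rep M f i)"
      using f i by (simp add: smooth_function_def)
    have F': "smooth_map_on (chart_range M i) (\<lambda>x. c * local_rep M f i x)" for c
      by (intro smooth_map_on_mult smooth_map_on_const M.open_S F)
    show ?thesis
      using tensor2_mixed[OF tensor2_add[OF M.open_S M.tensor2_scaled_metric[OF F'] M.hessian_tensor2[OF F]] F']
      by (simp add: deformation_def)
  qed
  have sym: "?h (i, j) p u v = ?h (i, j) p v u"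
    if i: "i \<in> chart_index M" and j: "j \<in> chart_index N" and p: "p \<in> chart_range M i \<times> chart_range N j" for i j p u v
  proof -
    interpret M: riemannian_chart "chart_range M i" "g\<^sub>1 i" by (rule riemannian_metric_chart[OF M i])
    interpret N: riemannian_chart "chart_range N j" "g\<^sub>2 j" by (rule riemannian_metric_chart[OF N j])
    have F: "smooth_map_on (chart_range M i) (local_rep M f i)"
      using f i by (simp add: smooth_function_def)
    show ?thesis
      using p M.sym_g[of "fst p" "fst u" "fst v"] N.sym_g[of "snd p" "snd u" "snd v"]
        M.hessian_commute[OF F, of "fst p" "fst u" "fst v"]
      by (auto simp: deformation_def)
  qed
  have tr: "?h (i, j) (chart_map ?P (i, j) (p, q)) u v =
      ?h (i', j') (chart_map ?P (i', j') (p, q))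
        (deriv_at (transition ?P (i, j) (i', j')) (chart_map ?P (i, j) (p, q)) u)
        (deriv_at (transition ?P (i, j) (i', j')) (chart_map ?P (i, j) (p, q)) v)"
    if i: "i \<in> chart_index M" "i' \<in> chart_index M" and p: "p \<in> chart_dom M i \<inter> chart_dom M i'"
      and j: "j \<in> chart_index N" "j' \<in> chart_index N" and q: "q \<in> chart_dom N j \<inter> chart_dom N j'"
    for i i' j j' p q u v
  proof -
    have "g\<^sub>1 i (chart_map M i p) u v = g\<^sub>1 i' (chart_map M i' p) (deriv_at (transition M i i') (chart_map M i p) u)
        (deriv_at (transition M i i') (chart_map M i p) v)" for u v
      by (rule metric_transition[OF M(2) i p])
    moreover have "g\<^sub>2 j (chart_map N j q) u v = g\<^sub>2 j' (chart_map N j' q) (deriv_at (transition N j j') (chart_map N j q) u)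
        (deriv_at (transition N j j') (chart_map N j q) v)" for u v
      by (rule metric_transition[OF N(2) j q])
    moreover have "local_rep M f i (chart_map M i p) = local_rep M f i' (chart_map M i' p)"
      using p chart_inv_chart_map[OF M(1) i(1)] chart_inv_chart_map[OF M(1) i(2)] by (simp add: local_rep_def)
    ultimately show ?thesis
      unfolding product_manifold_simps deriv_at_transition_product[OF M(1) i p N(1) j q]
      by (simp add: deformation_def hessian_transition[OF M f i p])
  qed
  show ?thesis
    unfolding smooth_symmetric_tensor2_def
  proof (intro conjI ballI allI)
    fix ij x u v
    assume "ij \<in> chart_index ?P" "x \<in> chart_range ?P ij"
    then obtain i j where ij: "ij = (i, j)" "i \<in> chart_index M" "j \<in> chart_index N"
      "x \<in> chart_range M i \<times> chart_range N j"
      by (cases ij) (auto simp: product_manifold_simps)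
    show "bilinear (?h ij x)" unfolding ij(1) by (rule tensor2_bilinear[OF t[OF ij(2,3)] ij(4)])
    show "?h ij x u v = ?h ij x v u" unfolding ij(1) by (rule sym[OF ij(2-4)])
  next
    fix ij u v
    assume "ij \<in> chart_index ?P"
    then show "smooth_map_on (chart_range ?P ij) (\<lambda>x. ?h ij x u v)"
      using tensor2D(5)[OF t] by (cases ij) (simp add: product_manifold_simps)
  next
    fix ij ij' pq u v
    assume "ij \<in> chart_index ?P" "ij' \<in> chart_index ?P" "pq \<in> chart_dom ?P ij \<inter> chart_dom ?P ij'"
    then obtain i j i' j' p q where ij: "ij = (i, j)" "ij' = (i', j')" "pq = (p, q)" and
      1: "i \<in> chart_index M" "i' \<in> chart_index M" "p \<in> chart_dom M i \<inter> chart_dom M i'"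
        "j \<in> chart_index N" "j' \<in> chart_index N" "q \<in> chart_dom N j \<inter> chart_dom N j'"
      by (cases ij; cases ij'; cases pq) (auto simp: product_manifold_simps)
    show "?h ij (chart_map ?P ij pq) u v =
      ?h ij' (chart_map ?P ij' pq) (deriv_at (transition ?P ij ij') (chart_map ?P ij pq) u)
        (deriv_at (transition ?P ij ij') (chart_map ?P ij pq) v)"
      unfolding ij by (rule tr[OF 1])
  qed
qed

theorem theorem1p2:
  fixes M :: "('i, 'p, 'a::euclidean_space) manifold" and g\<^sub>1 :: "('i, 'a) tensor2"
    and N :: "('j, 'q, 'b::euclidean_space) manifold" and g\<^sub>2 :: "('j, 'b) tensor2"
    and \<mu> :: real
  assumes "compact_einstein_manifold M g\<^sub>1 \<mu>" and "DIM('a) \<ge> 3" and "\<mu> > 0"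
    and "2 * \<mu> \<in> laplace_spectrum M g\<^sub>1"
    and "compact_einstein_manifold N g\<^sub>2 \<mu>" and "DIM('b) \<ge> 3"
  shows "\<exists>h. infinitesimal_einstein_deformation (product_manifold M N) (product_metric g\<^sub>1 g\<^sub>2) h \<and>
             nonzero_tensor2 (product_manifold M N) h"
proof -
  have M: "smooth_manifold M" "riemannian_metric M g\<^sub>1" and N: "smooth_manifold N" "riemannian_metric N g\<^sub>2"
    using assms by (auto simp: compact_einstein_manifold_def)
  obtain f where f: "smooth_function M f" and nz: "\<exists>p\<in>topspace (mtop M). f p \<noteq> 0"
    and eigen: "\<And>i x. i \<in> chart_index M \<Longrightarrow> x \<in> chart_range M i \<Longrightarrow>
      laplacian (g\<^sub>1 i) (local_rep M f i) x = 2 * \<mu> * local_rep M f i x"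
    using assms(4) unfolding laplace_spectrum_def by blast
  \<comment> \<open>The value for which the trace m \<beta> f of the second summand cancels the
    trace (n - 2) \<mu> f of the first, with n and m the two dimensions. It is nonzero since n > 2
    and \<mu> > 0.\<close>
  define \<beta> where "\<beta> = - (real DIM('a) - 2) * \<mu> / real DIM('b)"
  have \<beta>: "\<beta> \<noteq> 0" "\<beta> * DIM('b) = - (real DIM('a) - 2) * \<mu>"
    using assms(2,3) by (simp_all add: \<beta>_def)
  define h where "h = deformation M g\<^sub>1 g\<^sub>2 f \<mu> \<beta>"
  have smooth: "smooth_symmetric_tensor2 (product_manifold M N) h"
    unfolding h_def by (rule smooth_symmetric_deformation[OF M N f])
  have "metric_trace (product_metric g\<^sub>1 g\<^sub>2 (i, j) p) (h (i, j) p) = 0 \<and>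
      divergence (product_metric g\<^sub>1 g\<^sub>2 (i, j)) (h (i, j)) p v = 0 \<and>
      einstein_operator (product_metric g\<^sub>1 g\<^sub>2 (i, j)) (h (i, j)) p u v = 0"
    if i: "i \<in> chart_index M" and j: "j \<in> chart_index N" and p: "p \<in> chart_range M i \<times> chart_range N j"
    for i j p u v
  proof -
    interpret E1: einstein_chart "chart_range M i" "g\<^sub>1 i" \<mu>
      by (rule compact_einstein_manifold_chart[OF assms(1) i])
    interpret E2: einstein_chart "chart_range N j" "g\<^sub>2 j" \<mu>
      by (rule compact_einstein_manifold_chart[OF assms(5) j])
    interpret product_chart "chart_range M i" "g\<^sub>1 i" "chart_range N j" "g\<^sub>2 j" ..
    have p': "fst p \<in> chart_range M i" "snd p \<in> chart_range N j" using p by auto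
    define F where "F = local_rep M f i"
    have F: "smooth_map_on (chart_range M i) F"
      using f i by (simp add: smooth_function_def F_def)
    have \<beta>F: "smooth_map_on (chart_range M i) (\<lambda>x. \<beta> * F x)"
      by (intro smooth_map_on_mult smooth_map_on_const E1.open_S F)
    have e: "laplacian (g\<^sub>1 i) F x = 2 * \<mu> * F x" if "x \<in> chart_range M i" for x
      unfolding F_def by (rule eigen[OF i that])
    define A where "A = (\<lambda>x u v. \<mu> * F x * g\<^sub>1 i x u v + hessian (g\<^sub>1 i) F x u v)"
    have A: "tensor2 (chart_range M i) A"
      unfolding A_def by (rule E1.conformal_hessian_tensor2[OF F e])
    have G: "product_metric g\<^sub>1 g\<^sub>2 (i, j) = G"
      by (simp add: product_metric_def G_def)
    have hij: "h (i, j) = (\<lambda>p u v. A (fst p) (fst u) (fst v) + \<beta> * F (fst p) * g\<^sub>2 j (snd p) (snd u) (snd v))"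
      by (simp add: h_def deformation_def A_def F_def)
    have "metric_trace (G p) (h (i, j) p) = 0"
    proof -
      have "metric_trace (G p) (h (i, j) p) = (real DIM('a) - 2) * \<mu> * F (fst p) + \<beta> * DIM('b) * F (fst p)"
        unfolding hij metric_trace_mixed[OF A \<beta>F p]
        using E1.trace_conformal_hessian[OF F e p'(1)] by (simp add: A_def)
      then show ?thesis unfolding \<beta>(2) by (simp add: algebra_simps)
    qed
    moreover have "divergence G (h (i, j)) p v = 0"
      unfolding hij divergence_mixed[OF A \<beta>F p]
      unfolding A_def by (rule E1.divergence_conformal_hessian[OF F e p'(1)])
    moreover have "einstein_operator G (h (i, j)) p u v = 0"
    proof -
      have "einstein_operator (g\<^sub>1 i) A (fst p) (fst u) (fst v) = 0"
        unfolding A_def by (rule E1.einstein_operator_conformal_hessian[OF F e p'(1)])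
      \<comment> \<open>The Laplacian of \<beta> f contributes 2 \<mu> \<beta> f g2, and the
        curvature term removes 2 \<beta> f Ric, the same quantity because N has Einstein constant
        \<mu>.\<close>
      then show ?thesis
        unfolding hij einstein_operator_mixed[OF A \<beta>F p] E1.laplacian_cmult[OF F p'(1)] e[OF p'(1)] E2.einstein[OF p'(2)]
        by simp
    qed
    ultimately show ?thesis unfolding G by simp
  qed
  then have "infinitesimal_einstein_deformation (product_manifold M N) (product_metric g\<^sub>1 g\<^sub>2) h"
    using smooth by (auto simp: infinitesimal_einstein_deformation_def product_manifold_simps)
  moreover have "nonzero_tensor2 (product_manifold M N) h"
  proof -
    obtain p i where p: "f p \<noteq> 0" "i \<in> chart_index M" "p \<in> chart_dom M i"
      using nz M(1) unfolding smooth_manifold_def by blast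
    obtain q j where q: "j \<in> chart_index N" "q \<in> chart_dom N j"
      using N(1) unfolding smooth_manifold_def by blast
    interpret M: riemannian_chart "chart_range M i" "g\<^sub>1 i" by (rule riemannian_metric_chart[OF M p(2)])
    interpret N: riemannian_chart "chart_range N j" "g\<^sub>2 j" by (rule riemannian_metric_chart[OF N q(1)])
    define x y where "x = chart_map M i p" and "y = chart_map N j q"
    have xy: "x \<in> chart_range M i" "y \<in> chart_range N j"
      using p q by (auto simp: x_def y_def chart_range_def)
    have F: "local_rep M f i x = f p"
      using chart_inv_chart_map[OF M(1) p(2,3)] by (simp add: local_rep_def x_def)
    have sm: "smooth_map_on (chart_range M i) (local_rep M f i)"
      using f p(2) by (simp add: smooth_function_def)
    \<comment> \<open>On vectors (0, b) the terms coming from the first factor vanish, leaving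
      \<beta> f g2(b, b) at a point where f is nonzero.\<close>
    obtain b :: 'b where b: "b \<in> Basis" using nonempty_Basis by blast
    then have "g\<^sub>2 j y b b > 0" by (intro N.pos_g xy nonzero_Basis)
    moreover have "h (i, j) (x, y) (0, b) (0, b) = \<beta> * f p * g\<^sub>2 j y b b"
      by (simp add: h_def deformation_def F bilinear_lzero[OF M.bilinear_g[OF xy(1)]]
          bilinear_lzero[OF tensor2_bilinear[OF M.hessian_tensor2[OF sm] xy(1)]])
    ultimately have "h (i, j) (x, y) (0, b) (0, b) \<noteq> 0" using \<beta>(1) p(1) by simp
    then show ?thesis
      unfolding nonzero_tensor2_def
      by (intro bexI[of _ "(i, j)"] bexI[of _ "(x, y)"] exI) (auto simp: product_manifold_simps p q xy)
  qed
  ultimately show ?thesis by blast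
qed

end
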